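(* Let $m\in\frac12\mathbb{N}_{\rm odd}$ and $p\in\mathbb{Z}_{\ge0}$. Then, with $\alpha=\frac{m(2p+1)}{2m+1}$, $\beta=\frac{2mp}{2m+1}$, all sums over $j,r$ running over $\mathbb{Z}$, and all sums over $k$ running over $k\in\frac12\mathbb{Z}_{\rm odd}$ in the displayed range: 1) $q^{-\frac m4}\theta^{(-)}_{(2p+1)m,m+\frac12}(\tau,0)\,\widetilde\Phi^{(-)[m,\frac12]}\big(\tau,\frac z2+\frac\tau2-\frac12,\frac z2-\frac\tau2+\frac12,0\big)$ $=-i\,\eta(\tau)^3\dfrac{\theta^{(-)}_{p+\frac12,m+\frac12}(\tau,z)-\theta^{(-)}_{-(p+\frac12),m+\frac12}(\tau,z)}{\theta_{0,\frac12}(\tau,z)}$ $+\big[\sum_{0\le r<j}-\sum_{j\le r<0}\big]\sum_{0<k\le m}(-1)^je^{\pi ik}q^{(m+\frac12)(j+\alpha)^2-m(r+p+\frac{m+k}{2m})^2}\big[\theta^{(-)}_{k,m}-\theta^{(-)}_{-k,m}\big](\tau,z)$ $+\big[\sum_{0\le r\le j}-\sum_{j<r<0}\big]\sum_{0<k<m}(-1)^je^{\pi ik}q^{(m+\frac12)(j+\alpha)^2-m(r+p+\frac{m-k}{2m})^2}\big[\theta^{(-)}_{k,m}-\theta^{(-)}_{-k,m}\big](\tau,z)$ $+\theta^{(-)}_{(2p+1)m,m+\frac12}(\tau,0)\sum_{-p<r\le p}\sum_{0<k<m}e^{\pi ik}q^{-m(r+\frac{k-m}{2m})^2}\big[\theta^{(-)}_{k,m}-\theta^{(-)}_{-k,m}\big](\tau,z)$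 $+e^{\pi im}\theta^{(-)}_{(2p+1)m,m+\frac12}(\tau,0)\sum_{-p\le r\le p}q^{-mr^2}\theta^{(-)}_{m,m}(\tau,z)$. 2) $q^{-\frac m4}\theta_{(2p+1)m,m+\frac12}(\tau,0)\,\widetilde\Phi^{(-)[m,\frac12]}\big(\tau,\frac z2+\frac\tau2,\frac z2-\frac\tau2,0\big)$ $=\eta(\tau)^3\dfrac{\theta_{p+\frac12,m+\frac12}(\tau,z)-\theta_{-(p+\frac12),m+\frac12}(\tau,z)}{\theta^{(-)}_{0,\frac12}(\tau,z)}$ $+(-1)^p\big[\sum_{0\le r<j}-\sum_{j\le r<0}\big]\sum_{0<k\le m}(-1)^rq^{(m+\frac12)(j+\alpha)^2-m(r+p+\frac{m+k}{2m})^2}\big[\theta^{(-)}_{k,m}-\theta^{(-)}_{-k,m}\big](\tau,z)$ $-(-1)^p\big[\sum_{0\le r\le j}-\sum_{j<r<0}\big]\sum_{0<k<m}(-1)^rq^{(m+\frac12)(j+\alpha)^2-m(r+p+\frac{m-k}{2m})^2}\big[\theta^{(-)}_{k,m}-\theta^{(-)}_{-k,m}\big](\tau,z)$ $-\theta_{(2p+1)m,m+\frac12}(\tau,0)\sum_{-p<r\le p}\sum_{0<k<m}(-1)^rq^{-m(r+\frac{k-m}{2m})^2}\big[\theta^{(-)}_{k,m}-\theta^{(-)}_{-k,m}\big](\tau,z)$ $-\theta_{(2p+1)m,m+\frac12}(\tau,0)\sum_{-p\le r\le p}(-1)^rq^{-mr^2}\theta^{(-)}_{m,m}(\tau,z)$.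 3) $\theta^{(-)}_{2pm,m+\frac12}(\tau,0)\,\Phi^{(-)[m,\frac12]}\big(\tau,\frac z2-\frac12,\frac z2+\frac12,0\big)$ $=-i\,\eta(\tau)^3\dfrac{\theta^{(-)}_{p,m+\frac12}(\tau,z)-\theta^{(-)}_{-p,m+\frac12}(\tau,z)}{\theta_{\frac12,\frac12}(\tau,z)}$ $+\big[\sum_{0\le r<j}-\sum_{j\le r<0}\big]\sum_{0<k\le m}(-1)^je^{\pi ik}q^{(m+\frac12)(j+\beta)^2-m(r+p+\frac{k}{2m})^2}\big[\theta^{(-)}_{k,m}-\theta^{(-)}_{-k,m}\big](\tau,z)$ $+\big[\sum_{0\le r\le j}-\sum_{j<r<0}\big]\sum_{0<k<m}(-1)^je^{\pi ik}q^{(m+\frac12)(j+\beta)^2-m(r+p-\frac{k}{2m})^2}\big[\theta^{(-)}_{k,m}-\theta^{(-)}_{-k,m}\big](\tau,z)$ $+\theta^{(-)}_{2pm,m+\frac12}(\tau,0)\sum_{-p<r<p}\sum_{0<k<m}e^{\pi ik}q^{-\frac{(2mr+k)^2}{4m}}\big[\theta^{(-)}_{k,m}-\theta^{(-)}_{-k,m}\big](\tau,z)$ $+2e^{\pi im}\theta^{(-)}_{2pm,m+\frac12}(\tau,0)\sum_{r=0}^{p-1}q^{-\frac m4(2r+1)^2}\theta^{(-)}_{m,m}(\tau,z)$.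
   Context: $\tau\in\mathbb{C}_+$ (upper half-plane), $z\in\mathbb{C}$, $q=e^{2\pi i\tau}$, $q^x:=e^{2\pi i\tau x}$. $\frac12\mathbb{Z}_{\rm odd}=\{n/2:n\text{ odd}\}$, $\frac12\mathbb{N}=\{n/2:n\in\mathbb{Z}_{>0}\}$, $\frac12\mathbb{N}_{\rm odd}=\{n/2: n \text{ positive odd}\}$. $\eta$ is the Dedekind eta function. For $M\in\frac12\mathbb{N}$, $k\in\frac12\mathbb{Z}$: $\theta^{(\pm)}_{k,M}(\tau,z)=\sum_{n\in\mathbb{Z}}(\pm1)^ne^{2\pi iM(n+\frac k{2M})z}q^{M(n+\frac k{2M})^2}$, $\theta_{k,M}:=\theta^{(+)}_{k,M}$. $\big[\sum_A-\sum_B\big]F$ means $\sum_AF-\sum_BF$. For $m\in\frac12\mathbb{N}$, $s\in\frac12\mathbb{Z}$, $z_1,z_2,t\in\mathbb{C}$ (meromorphic functions): $\Phi^{(\pm)[m,s]}_1(\tau,z_1,z_2,t)=e^{-2\pi imt}\sum_{j\in\mathbb{Z}}(\pm1)^j\frac{e^{2\pi imj(z_1+z_2)+2\pi isz_1}q^{mj^2+sj}}{1-e^{2\pi iz_1}q^j}$, $\Phi^{(\pm)[m,s]}_2(\tau,z_1,z_2,t)=e^{-2\pi imt}\sum_{j\in\mathbb{Z}}(\pm1)^j\frac{e^{-2\pi imj(z_1+z_2)-2\pi isz_2}q^{mj^2+sj}}{1-e^{-2\pi iz_2}q^j}$, $\Phi^{(\pm)[m,s]}=\Phi^{(\pm)[m,s]}_1-\Phi^{(\pm)[m,s]}_2$.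 Let $E(x)=2\int_0^xe^{-\pi t^2}dt$ and, for $j\in\frac12\mathbb{Z}$, $w\in\mathbb{C}$, $R^{(\pm)}_{j,m}(\tau,w)=\sum_{n\in\frac12\mathbb{Z},\,n-j\in2m\mathbb{Z}}(\pm1)^{\frac{n-j}{2m}}\Big\{\mathrm{sgn}\big(n-\tfrac12-j+2m\big)-E\Big(\big(n-2m\tfrac{\mathrm{Im}\,w}{\mathrm{Im}\,\tau}\big)\sqrt{\tfrac{\mathrm{Im}\,\tau}{m}}\Big)\Big\}e^{-\frac{\pi i\tau}{2m}n^2+2\pi inw}$. $\Phi^{(\pm)[m,s]}_{\rm add}(\tau,z_1,z_2,t)=-\frac12e^{-2\pi imt}\sum_{k\in s+\mathbb{Z},\,s\le k<s+2m}R^{(\pm)}_{k,m}\big(\tau,\frac{z_1-z_2}2\big)\big[\theta^{(\pm)}_{k,m}-\theta^{(\pm)}_{-k,m}\big](\tau,z_1+z_2)$, and $\widetilde\Phi^{(\pm)[m,s]}=\Phi^{(\pm)[m,s]}+\Phi^{(\pm)[m,s]}_{\rm add}$.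
   Formalization: In part 3 with p=0 the printed formula fails for m≥3/2 if the sum over -p<r<p is taken as empty; there it is read as the oriented sum from r=1-p to p-1, that is, minus the r=0 term. For p≥1 it is the printed sum. *)

theory Defs
  imports "HOL-Analysis.Analysis"
begin

definition half_ints :: "real set" where
  "half_ints = {of_int n / 2 | n :: int. True}"

definition half_odd_ints :: "real set" where
  "half_odd_ints = {of_int n / 2 | n :: int. odd n}"

text \<open>\<open>qpow \<tau> x\<close> is \<open>q\<^sup>x\<close>, with the branch fixed by \<open>\<tau>\<close> and not by \<open>q\<close>.\<close>

definition qpow :: "complex \<Rightarrow> real \<Rightarrow> complex" where
  "qpow \<tau> x = exp (2 * of_real pi * \<i> * \<tau> * of_real x)"

definition dedekind_eta :: "complex \<Rightarrow> complex" where
  "dedekind_eta \<tau> = qpow \<tau> (1 / 24) * (\<Prod>n. 1 - qpow \<tau> (real (Suc n)))"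

text \<open>
  The superscript \<open>(\<plusminus>)\<close> is rendered by a parameter \<open>\<epsilon>\<close>, which is meant to be \<open>1\<close> or \<open>-1\<close>.
  All infinite sums below converge absolutely for \<open>\<tau>\<close> in the upper half-plane
  (away from the poles, in the case of \<open>\<Phi>\<close>).
\<close>

definition theta :: "complex \<Rightarrow> real \<Rightarrow> real \<Rightarrow> complex \<Rightarrow> complex \<Rightarrow> complex" where
  "theta \<epsilon> k M \<tau> z =
     (\<Sum>\<^sub>\<infinity>n::int. \<epsilon> powi n
        * exp (2 * of_real pi * \<i> * of_real M * of_real (of_int n + k / (2 * M)) * z)
        * qpow \<tau> (M * (of_int n + k / (2 * M))\<^sup>2))"

definition theta_diff :: "complex \<Rightarrow> real \<Rightarrow> real \<Rightarrow> complex \<Rightarrow> complex \<Rightarrow> complex" where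
  "theta_diff \<epsilon> k M \<tau> z = theta \<epsilon> k M \<tau> z - theta \<epsilon> (- k) M \<tau> z"

definition Phi1 ::
  "complex \<Rightarrow> real \<Rightarrow> real \<Rightarrow> complex \<Rightarrow> complex \<Rightarrow> complex \<Rightarrow> complex \<Rightarrow> complex" where
  "Phi1 \<epsilon> m s \<tau> z1 z2 t =
     exp (- 2 * of_real pi * \<i> * of_real m * t)
     * (\<Sum>\<^sub>\<infinity>j::int. \<epsilon> powi j
          * (exp (2 * of_real pi * \<i> * of_real m * of_int j * (z1 + z2)
                  + 2 * of_real pi * \<i> * of_real s * z1)
             * qpow \<tau> (m * (of_int j)\<^sup>2 + s * of_int j))
          / (1 - exp (2 * of_real pi * \<i> * z1) * qpow \<tau> (of_int j)))"

definition Phi2 ::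
  "complex \<Rightarrow> real \<Rightarrow> real \<Rightarrow> complex \<Rightarrow> complex \<Rightarrow> complex \<Rightarrow> complex \<Rightarrow> complex" where
  "Phi2 \<epsilon> m s \<tau> z1 z2 t =
     exp (- 2 * of_real pi * \<i> * of_real m * t)
     * (\<Sum>\<^sub>\<infinity>j::int. \<epsilon> powi j
          * (exp (- 2 * of_real pi * \<i> * of_real m * of_int j * (z1 + z2)
                  - 2 * of_real pi * \<i> * of_real s * z2)
             * qpow \<tau> (m * (of_int j)\<^sup>2 + s * of_int j))
          / (1 - exp (- 2 * of_real pi * \<i> * z2) * qpow \<tau> (of_int j)))"

definition Phi ::
  "complex \<Rightarrow> real \<Rightarrow> real \<Rightarrow> complex \<Rightarrow> complex \<Rightarrow> complex \<Rightarrow> complex \<Rightarrow> complex" where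
  "Phi \<epsilon> m s \<tau> z1 z2 t = Phi1 \<epsilon> m s \<tau> z1 z2 t - Phi2 \<epsilon> m s \<tau> z1 z2 t"

text \<open>The oriented integral: \<open>E_fun\<close> is odd.\<close>

definition E_fun :: "real \<Rightarrow> real" where
  "E_fun x = 2 * (LBINT t=ereal 0..ereal x. exp (- pi * t\<^sup>2))"

text \<open>The exponent \<open>(n - j) / (2 * m)\<close> of the sign is an integer on the index set,
  so the floor merely changes its type.\<close>

definition R_fun :: "complex \<Rightarrow> real \<Rightarrow> real \<Rightarrow> complex \<Rightarrow> complex \<Rightarrow> complex" where
  "R_fun \<epsilon> j m \<tau> w =
     (\<Sum>\<^sub>\<infinity>n \<in> {n \<in> half_ints. \<exists>l::int. n - j = 2 * m * of_int l}.
        \<epsilon> powi \<lfloor>(n - j) / (2 * m)\<rfloor>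
        * of_real (sgn (n - 1 / 2 - j + 2 * m)
                   - E_fun ((n - 2 * m * (Im w / Im \<tau>)) * sqrt (Im \<tau> / m)))
        * exp (- (of_real pi * \<i> * \<tau> / of_real (2 * m)) * of_real (n\<^sup>2)
               + 2 * of_real pi * \<i> * of_real n * w))"

definition Phi_add ::
  "complex \<Rightarrow> real \<Rightarrow> real \<Rightarrow> complex \<Rightarrow> complex \<Rightarrow> complex \<Rightarrow> complex \<Rightarrow> complex" where
  "Phi_add \<epsilon> m s \<tau> z1 z2 t =
     - (1 / 2) * exp (- 2 * of_real pi * \<i> * of_real m * t)
     * (\<Sum>k \<in> {k. k - s \<in> \<int> \<and> s \<le> k \<and> k < s + 2 * m}.
          R_fun \<epsilon> k m \<tau> ((z1 - z2) / 2) * theta_diff \<epsilon> k m \<tau> (z1 + z2))"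

definition Phi_tilde ::
  "complex \<Rightarrow> real \<Rightarrow> real \<Rightarrow> complex \<Rightarrow> complex \<Rightarrow> complex \<Rightarrow> complex \<Rightarrow> complex" where
  "Phi_tilde \<epsilon> m s \<tau> z1 z2 t = Phi \<epsilon> m s \<tau> z1 z2 t + Phi_add \<epsilon> m s \<tau> z1 z2 t"

text \<open>\<open>bracket_sum A B F\<close> is \<open>[\<Sum>\<^sub>A - \<Sum>\<^sub>B] F\<close>.
  With \<open>A = {- p<..<p}\<close> and \<open>B = {p..- p}\<close> it is the oriented sum from \<open>r = 1 - p\<close> to \<open>r = p - 1\<close>:
  for \<open>p \<ge> 1\<close> the set \<open>B\<close> is empty and this is the sum over \<open>- p < r < p\<close>; for \<open>p = 0\<close> the set \<open>A\<close>
  is empty and it is minus the term \<open>r = 0\<close>.\<close>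

definition bracket_sum :: "'a set \<Rightarrow> 'a set \<Rightarrow> ('a \<Rightarrow> complex) \<Rightarrow> complex" where
  "bracket_sum A B F = infsum F A - infsum F B"

end

theory Submission
  imports Defs "HOL-Real_Asymp.Real_Asymp" "HOL-Probability.Distributions"
begin

text \<open>
  All three left-hand sides vanish. At the given arguments the denominators of \<open>\<Phi>\<^sub>1\<close> and \<open>\<Phi>\<^sub>2\<close>
  agree up to a reflection of the summation index. In part 3 the two sums coincide; in parts 1 and 2
  the difference is a sum of geometric quotients \<open>(1 - y\<^bsup>2m\<^esup>) / (1 - y)\<close>, hence a finite combination of
  theta functions, and the same combination with the opposite sign comes out of \<open>\<Phi>\<^sub>a\<^sub>d\<^sub>d\<close>, because on
  the line \<open>Im w / Im \<tau> = 1/2\<close> the error functions in \<open>R\<^sub>k\<close> and \<open>R\<^bsub>2m-k\<^esub>\<close> cancel in pairs.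

  What remains is a formula for a quotient of theta functions of indices \<open>m + 1/2\<close> and \<open>1/2\<close>.
  The Laurent coefficients of \<open>\<eta>\<^sup>3 / \<theta>\<close> are partial theta values, bounded because the full sums vanish;
  multiplying by the numerator turns the coefficients of the quotient into the Hecke-type
  double sums, and their symmetries collect these coefficients into theta functions of index \<open>m\<close>.
  As the product of \<open>\<theta>\<close> with the resulting series is computed coefficient by coefficient,
  the identity holds for every \<open>z\<close> without analytic continuation.
\<close>

section \<open>Powers of q and Gaussian sums\<close>

text \<open>The Laurent series of the reciprocal theta function converges only in an annulus, so it
  is not clear that the product with the numerator makes sense elsewhere. The remedy is a
  periodicity: moving the index by 2m moves the lower limit of every partial theta by one, which
  leaves an error row; the two thetas of the numerator leave the same row with opposite signs,
  thanks to \<open>eps_p2\<close>. The coefficients are therefore a Gaussian times a sequence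
  periodic up to sign, and the series converges everywhere.

  The reciprocal is normalised by one convolution value, the sum of (2n+1)(-1)^n q^(n(n+1)/2) up to
  sign. It is identified by Jacobi's identity, which comes from a finite version: the q-binomial
  theorem differentiated at its middle root.

  For \<epsilon> = -1 the quotient produces thetas of index m with sign (+). Replacing z by z + 1
  changes the sign for the indices m and 1/2, keeps it for m + 1/2, and is the origin of the factors
  e^(\<pi>ik).\<close>

lemma qpow_add: "qpow \<tau> (x + y) = qpow \<tau> x * qpow \<tau> y"
  by (simp add: qpow_def algebra_simps flip: exp_add)

lemma qpow_mult: "x + y = z \<Longrightarrow> qpow \<tau> x * qpow \<tau> y = qpow \<tau> z"
  using qpow_add by auto

lemma qpow_0 [simp]: "qpow \<tau> 0 = 1"
  by (simp add: qpow_def)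

lemma qpow_nonzero [simp]: "qpow \<tau> x \<noteq> 0"
  by (simp add: qpow_def)

lemma qpow_minus: "qpow \<tau> (- x) = inverse (qpow \<tau> x)"
  by (simp add: qpow_def exp_minus)

lemma qpow_power: "qpow \<tau> x ^ n = qpow \<tau> (real n * x)"
  by (simp add: qpow_def mult_ac flip: exp_of_nat_mult)

lemma norm_qpow: "norm (qpow \<tau> x) = exp (- (2 * pi * Im \<tau> * x))"
  by (simp add: qpow_def)

lemma norm_qpow_le_1: "Im \<tau> > 0 \<Longrightarrow> x \<ge> 0 \<Longrightarrow> norm (qpow \<tau> x) \<le> 1"
  by (simp add: norm_qpow)

lemma norm_powi_sign: "e = 1 \<or> e = -1 \<Longrightarrow> norm (e powi n :: complex) = 1"
  by (auto simp: norm_power_int)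

lemma powi_sign_minus: "e = 1 \<or> e = -1 \<Longrightarrow> (e powi (- n) :: complex) = e powi n"
  by (auto simp: power_int_minus power_int_minus_left)

lemma powi_sign_add: "e = 1 \<or> e = -1 \<Longrightarrow> (e powi (m + n) :: complex) = e powi m * e powi n"
  by (auto simp: power_int_add)

lemma powi_sign_diff: "e = 1 \<or> e = -1 \<Longrightarrow> (e powi (m - n) :: complex) = e powi m * e powi n"
  using powi_sign_add[of e m "-n"] powi_sign_minus[of e n] by simp

lemma powi_sign_square: "e = 1 \<or> e = -1 \<Longrightarrow> e powi n * e powi n = (1::complex)"
  by (auto simp: power_int_minus_left)

text \<open>Expanding (2c|x| - (|b| + 1))^2 \<ge> 0. The extra 1 next to |b| leaves the spare term
  -|x|, so that a Gaussian is dominated by a geometric series.\<close>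

lemma quadratic_le_linear:
  fixes c b x :: real
  assumes "c > 0"
  shows "- c * x\<^sup>2 + b * x \<le> (\<bar>b\<bar> + 1)\<^sup>2 / (4 * c) - \<bar>x\<bar>"
proof -
  have "0 \<le> (2 * c * \<bar>x\<bar> - (\<bar>b\<bar> + 1))\<^sup>2"
    by simp
  then have "(\<bar>b\<bar> + 1) * \<bar>x\<bar> \<le> c * x\<^sup>2 + (\<bar>b\<bar> + 1)\<^sup>2 / (4 * c)"
    using assms by (simp add: field_simps power2_eq_square flip: abs_mult)
  moreover have "b * x \<le> \<bar>b\<bar> * \<bar>x\<bar>"
    by (metis abs_ge_self abs_mult)
  ultimately show ?thesis
    by (simp add: algebra_simps)
qed

lemma summable_exp_minus_abs_int: "(\<lambda>n::int. exp (- \<bar>real_of_int n\<bar>)) summable_on UNIV"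
proof -
  have "summable (\<lambda>n. exp (- 1 :: real) ^ n)"
    by (rule summable_geometric) simp
  then have nat: "(\<lambda>n. exp (- real n)) summable_on UNIV"
    by (subst summable_on_UNIV_nonneg_real_iff) (simp_all flip: exp_of_nat_mult)
  have "(\<lambda>n::int. exp (- \<bar>real_of_int n\<bar>)) summable_on range int"
    by (subst summable_on_reindex) (use nat in \<open>auto simp: o_def\<close>)
  moreover have "(\<lambda>n::int. exp (- \<bar>real_of_int n\<bar>)) summable_on range (\<lambda>n. - int n)"
    by (subst summable_on_reindex) (use nat in \<open>auto simp: o_def inj_def\<close>)
  ultimately have "(\<lambda>n::int. exp (- \<bar>real_of_int n\<bar>)) summable_on range int \<union> range (\<lambda>n. - int n)"
    by (rule summable_on_union)
  moreover have "range int \<union> range (\<lambda>n. - int n) = UNIV"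
    by (auto simp: image_iff) (metis int_cases2)
  ultimately show ?thesis
    by simp
qed

lemma summable_exp_quadratic:
  fixes b c d :: real
  assumes "c > 0"
  shows "(\<lambda>n::int. exp (- c * (of_int n)\<^sup>2 + b * of_int n + d)) summable_on A"
proof (rule summable_on_subset[OF summable_on_comparison_test subset_UNIV])
  show "(\<lambda>n::int. exp ((\<bar>b\<bar> + 1)\<^sup>2 / (4 * c) + d) * exp (- \<bar>real_of_int n\<bar>)) summable_on UNIV"
    by (intro summable_on_cmult_right summable_exp_minus_abs_int)
  show "exp (- c * (of_int n)\<^sup>2 + b * of_int n + d) \<le> exp ((\<bar>b\<bar> + 1)\<^sup>2 / (4 * c) + d) * exp (- \<bar>real_of_int n\<bar>)" for n :: int
    using quadratic_le_linear[OF assms, of "of_int n" b] by (simp flip: exp_add)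
qed simp

lemma summable_gaussian:
  fixes f :: "int \<Rightarrow> complex"
  assumes "c > 0" "\<And>n. n \<in> A \<Longrightarrow> norm (f n) \<le> K * exp (- c * (of_int n)\<^sup>2 + b * of_int n)"
  shows "f summable_on A"
proof -
  have "(\<lambda>n. norm (f n)) summable_on A"
    by (rule summable_on_comparison_test[OF summable_on_cmult_right[OF summable_exp_quadratic[OF assms(1), of b 0]]])
      (use assms in auto)
  then show ?thesis
    by (rule abs_summable_summable)
qed

lemma norm_infsum_le_infsum:
  fixes f :: "'a \<Rightarrow> complex"
  assumes "\<And>x. x \<in> A \<Longrightarrow> norm (f x) \<le> g x" "g summable_on A"
  shows "norm (infsum f A) \<le> infsum g A"
proof (rule norm_infsum_le[OF has_sum_infsum has_sum_infsum])
  show "f summable_on A"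
    by (rule abs_summable_summable[OF summable_on_comparison_test[OF assms(2)]]) (use assms in auto)
qed (use assms in auto)

section \<open>Partial theta functions\<close>

text \<open>The terms of the theta series (-1)^n q^(n(n+1)/2) x^n at its zero x = q^s;
  \<open>ptheta\<close> is a tail of this series.\<close>

definition pterm :: "complex \<Rightarrow> int \<Rightarrow> int \<Rightarrow> complex" where
  "pterm \<tau> s n = (-1) powi n * qpow \<tau> (of_int n * (of_int n + 1) / 2 + of_int n * of_int s)"

definition ptheta :: "complex \<Rightarrow> int \<Rightarrow> int \<Rightarrow> complex" where
  "ptheta \<tau> a s = (\<Sum>\<^sub>\<infinity>n\<in>{a..}. pterm \<tau> s n)"

lemma pterm_shift_s: "pterm \<tau> (s - 1) n = - qpow \<tau> (of_int s) * pterm \<tau> s (n - 1)"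
proof -
  have "(-1) powi (n - 1) = - ((-1) powi n :: complex)"
    by (simp add: power_int_diff)
  then show ?thesis
    unfolding pterm_def by (auto simp flip: qpow_add simp: field_simps intro!: arg_cong[of _ _ "qpow \<tau>"])
qed

lemma pterm_reflect: "pterm \<tau> s (- 1 - n) = - qpow \<tau> (- of_int s) * pterm \<tau> (- s) n"
proof -
  have "(-1) powi (- 1 - n) = - ((-1) powi n :: complex)"
    by (simp add: power_int_diff power_int_minus_left)
  then show ?thesis
    unfolding pterm_def by (auto simp flip: qpow_add simp: field_simps intro!: arg_cong[of _ _ "qpow \<tau>"])
qed

lemma pterm_translate: "pterm \<tau> s (n + a) = pterm \<tau> s a * pterm \<tau> (s + a) n"
  unfolding pterm_def
  by (auto simp: power_int_add field_simps simp flip: qpow_add intro!: arg_cong[of _ _ "qpow \<tau>"])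

lemma norm_pterm: "norm (pterm \<tau> s n) = exp (- (pi * Im \<tau>) * (of_int n)\<^sup>2 + (- (pi * Im \<tau> * (2 * of_int s + 1))) * of_int n)"
  by (simp add: pterm_def norm_mult norm_power_int norm_qpow power2_eq_square field_simps)

context
  fixes \<tau> :: complex
  assumes tau: "Im \<tau> > 0"
begin

lemma summable_pterm: "pterm \<tau> s summable_on A"
  by (rule summable_gaussian[of "pi * Im \<tau>" _ _ 1 "- (pi * Im \<tau> * (2 * of_int s + 1))"]) 
    (use tau in \<open>simp_all add: norm_pterm\<close>)

lemma summable_norm_pterm: "(\<lambda>n. norm (pterm \<tau> s n)) summable_on A"
  using summable_pterm summable_on_iff_abs_summable_on_complex by blast

text \<open>The exponent is symmetric about n = -s - 1/2, and reflection there changes the parity of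
  n. The vanishing lets a tail be traded for its complement, the only control on tails for negative
  s, where the single terms are unbounded in s.\<close>

lemma infsum_pterm_UNIV: "infsum (pterm \<tau> s) UNIV = 0"
proof -
  have "(-1) powi (- 1 - 2 * s - n) = - ((-1) powi n :: complex)" for n
    by (simp add: power_int_diff power_int_minus_left)
  then have refl: "pterm \<tau> s (- 1 - 2 * s - n) = - pterm \<tau> s n" for n
    unfolding pterm_def by (auto simp: field_simps intro!: arg_cong[of _ _ "qpow \<tau>"])
  have "infsum (pterm \<tau> s) UNIV = (\<Sum>\<^sub>\<infinity>n. - pterm \<tau> s n)"
    by (rule infsum_reindex_bij_witness[of _ "\<lambda>n. - 1 - 2 * s - n" "\<lambda>n. - 1 - 2 * s - n"])
      (auto simp: refl)
  then show ?thesis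
    by (simp add: infsum_uminus)
qed

lemma infsum_pterm_lessThan: "infsum (pterm \<tau> s) {..<a} = - ptheta \<tau> a s"
proof -
  have "infsum (pterm \<tau> s) ({..<a} \<union> {a..}) = infsum (pterm \<tau> s) {..<a} + ptheta \<tau> a s"
    unfolding ptheta_def by (rule infsum_Un_disjoint) (auto intro: summable_pterm)
  moreover have "{..<a} \<union> {a..} = UNIV"
    by auto
  ultimately show ?thesis
    using infsum_pterm_UNIV[of s] by (simp add: eq_neg_iff_add_eq_0)
qed

lemma ptheta_rec: "ptheta \<tau> a s = pterm \<tau> s a + ptheta \<tau> (a + 1) s"
proof -
  have "{a..} = insert a {a + 1..}"
    by auto
  then show ?thesis
    unfolding ptheta_def by (simp add: infsum_insert summable_pterm)
qed

lemma ptheta_shift_s: "ptheta \<tau> a (s - 1) = - qpow \<tau> (of_int s) * ptheta \<tau> (a - 1) s"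
proof -
  have "ptheta \<tau> a (s - 1) = (\<Sum>\<^sub>\<infinity>n\<in>{a - 1..}. - qpow \<tau> (of_int s) * pterm \<tau> s n)"
    unfolding ptheta_def
    by (rule infsum_reindex_bij_witness[of _ "\<lambda>n. n + 1" "\<lambda>n. n - 1"]) (auto simp: pterm_shift_s)
  then show ?thesis
    by (simp only: infsum_cmult_right' ptheta_def)
qed

lemma ptheta_0_rec: "ptheta \<tau> 0 s = 1 - qpow \<tau> (of_int s + 1) * ptheta \<tau> 0 (s + 1)"
proof -
  \<comment> \<open>The constant 1 of the recursion is the term n = -1, split off after
    \<open>ptheta_shift_s\<close> has moved the lower limit to -1.\<close>
  have "qpow \<tau> (of_int s + 1) * pterm \<tau> (s + 1) (-1) = -1"
    by (simp add: pterm_def qpow_minus flip: qpow_add)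
  then show ?thesis
    using ptheta_shift_s[of 0 "s + 1"] ptheta_rec[of "-1" "s + 1"] by (simp add: algebra_simps)
qed

lemma ptheta_0_reflect: "ptheta \<tau> 0 s = qpow \<tau> (- of_int s) * ptheta \<tau> 0 (- s)"
proof -
  have "- qpow \<tau> (- of_int s) * pterm \<tau> (- s) (- 1 - n) = pterm \<tau> s n" for n
    using pterm_reflect[of \<tau> s "- 1 - n"] by simp
  then have "infsum (pterm \<tau> s) {..<0} = (\<Sum>\<^sub>\<infinity>n\<in>{0..}. - qpow \<tau> (- of_int s) * pterm \<tau> (- s) n)"
    by (intro infsum_reindex_bij_witness[of _ "\<lambda>n. - 1 - n" "\<lambda>n. - 1 - n"]) auto
  also have "\<dots> = - qpow \<tau> (- of_int s) * ptheta \<tau> 0 (- s)"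
    by (simp only: infsum_cmult_right' ptheta_def)
  finally show ?thesis
    using infsum_pterm_lessThan[of s 0] by simp
qed

lemma ptheta_translate: "ptheta \<tau> a s = pterm \<tau> s a * ptheta \<tau> 0 (s + a)"
proof -
  have "ptheta \<tau> a s = (\<Sum>\<^sub>\<infinity>n\<in>{0..}. pterm \<tau> s a * pterm \<tau> (s + a) n)"
    unfolding ptheta_def
    by (rule infsum_reindex_bij_witness[of _ "\<lambda>n. n + a" "\<lambda>n. n - a"]) 
      (auto simp flip: pterm_translate)
  then show ?thesis
    by (simp add: infsum_cmult_right' ptheta_def)
qed

text \<open>For s \<ge> 0 every term is dominated by the one for s = 0. For s < 0 the reflection,
  which rests on the vanishing of the full sum, reduces to -s at the price of a factor q^(-s) of
  norm at most 1.\<close>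

lemma ptheta_0_bounded: obtains C where "C > 0" "\<And>s. norm (ptheta \<tau> 0 s) \<le> C"
proof -
  define C where "C = (\<Sum>\<^sub>\<infinity>n\<in>{0..}. norm (pterm \<tau> 0 n))"
  have nonneg: "norm (ptheta \<tau> 0 s) \<le> C" if "s \<ge> 0" for s
    unfolding ptheta_def C_def
  proof (rule norm_infsum_le_infsum[OF _ summable_norm_pterm])
    fix n :: int assume "n \<in> {0..}"
    then have "0 \<le> pi * Im \<tau> * (of_int n * (2 * of_int s))"
      using tau that by (intro mult_nonneg_nonneg) auto
    then show "norm (pterm \<tau> s n) \<le> norm (pterm \<tau> 0 n)"
      by (simp add: norm_pterm algebra_simps)
  qed
  have "norm (ptheta \<tau> 0 s) \<le> C" for s
  proof (cases "s \<ge> 0")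
    case False
    have "norm (ptheta \<tau> 0 s) \<le> 1 * norm (ptheta \<tau> 0 (- s))"
      unfolding ptheta_0_reflect[of s] norm_mult using tau False
      by (intro mult_right_mono norm_qpow_le_1) auto
    also have "\<dots> \<le> C"
      using nonneg[of "- s"] False by simp
    finally show ?thesis .
  qed (rule nonneg)
  then show ?thesis
    by (intro that[of "max C 1"]) (auto simp: max_def intro: order.trans)
qed

end

lemma summable_mult_bounded:
  fixes f g :: "'a \<Rightarrow> complex"
  assumes "f summable_on A" "\<And>x. norm (g x) \<le> C"
  shows "(\<lambda>x. f x * g x) summable_on A"
proof (rule abs_summable_summable, rule summable_on_comparison_test)
  show "(\<lambda>x. norm (f x) * C) summable_on A"
    using assms(1) by (intro summable_on_cmult_left) (simp add: summable_on_iff_abs_summable_on_complex)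
qed (use assms(2) in \<open>auto simp: norm_mult intro: mult_left_mono\<close>)

section \<open>Convolution of a theta series with its reciprocal\<close>

context
  fixes \<tau> :: complex
  assumes tau: "Im \<tau> > 0"
begin

lemma summable_pterm_ptheta: "(\<lambda>s. pterm \<tau> k s * ptheta \<tau> 0 (f s)) summable_on A"
proof -
  obtain C where "\<And>s. norm (ptheta \<tau> 0 s) \<le> C"
    using ptheta_0_bounded[OF tau] by blast
  then show ?thesis
    by (intro summable_mult_bounded summable_pterm[OF tau])
qed

text \<open>By the recursion of \<open>ptheta\<close> the convolution equals \<open>q\<^bsup>L+1\<^esup>\<close> times itself.\<close>

lemma pterm_ptheta_convolution:
  assumes "L \<noteq> -1"
  shows "(\<Sum>\<^sub>\<infinity>s. pterm \<tau> 0 s * ptheta \<tau> 0 (L - s)) = 0"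
proof -
  define h where "h = (\<Sum>\<^sub>\<infinity>s. pterm \<tau> 0 s * ptheta \<tau> 0 (L - s))"
  have "pterm \<tau> 0 s * ptheta \<tau> 0 (L - s)
      = pterm \<tau> 0 s + qpow \<tau> (of_int L + 1) * (pterm \<tau> 0 (s - 1) * ptheta \<tau> 0 (L - (s - 1)))" for s
  proof -
    have "pterm \<tau> 0 s * qpow \<tau> (of_int (L - s) + 1) = - qpow \<tau> (of_int L + 1) * pterm \<tau> 0 (s - 1)"
    proof -
      have "(-1) powi (s - 1) = - ((-1) powi s :: complex)"
        by (simp add: power_int_diff)
      then show ?thesis
        unfolding pterm_def by (auto simp flip: qpow_add simp: field_simps intro!: arg_cong[of _ _ "qpow \<tau>"])
    qed
    note shift = this
    have "pterm \<tau> 0 s * ptheta \<tau> 0 (L - s)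
        = pterm \<tau> 0 s - (pterm \<tau> 0 s * qpow \<tau> (of_int (L - s) + 1)) * ptheta \<tau> 0 (L - s + 1)"
      by (subst ptheta_0_rec[OF tau]) (simp add: algebra_simps)
    also have "L - s + 1 = L - (s - 1)"
      by simp
    finally show ?thesis
      unfolding shift by simp
  qed
  then have "h = (\<Sum>\<^sub>\<infinity>s. pterm \<tau> 0 s + qpow \<tau> (of_int L + 1) * (pterm \<tau> 0 (s - 1) * ptheta \<tau> 0 (L - (s - 1))))"
    unfolding h_def by (intro infsum_cong)
  also have "\<dots> = infsum (pterm \<tau> 0) UNIV
      + (\<Sum>\<^sub>\<infinity>s. qpow \<tau> (of_int L + 1) * (pterm \<tau> 0 (s - 1) * ptheta \<tau> 0 (L - (s - 1))))"
  proof (intro infsum_add summable_pterm[OF tau] summable_on_cmult_right)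
    show "(\<lambda>s. pterm \<tau> 0 (s - 1) * ptheta \<tau> 0 (L - (s - 1))) summable_on UNIV"
      by (rule summable_on_reindex_bij_witness[of _ "\<lambda>s. s + 1" "\<lambda>s. s - 1", THEN iffD2, OF _ _ _ _ _ summable_pterm_ptheta[where k = 0 and f = "\<lambda>s. L - s"]]) auto
  qed
  also have "(\<Sum>\<^sub>\<infinity>s. qpow \<tau> (of_int L + 1) * (pterm \<tau> 0 (s - 1) * ptheta \<tau> 0 (L - (s - 1)))) = qpow \<tau> (of_int L + 1) * h"
    unfolding infsum_cmult_right' h_def
    by (intro arg_cong2[of _ _ _ _ "(*)"] infsum_reindex_bij_witness[of _ "\<lambda>s. s + 1" "\<lambda>s. s - 1"]) auto
  finally have "h * (1 - qpow \<tau> (of_int L + 1)) = 0"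
    by (simp add: infsum_pterm_UNIV[OF tau] algebra_simps)
  moreover have "qpow \<tau> (of_int L + 1) \<noteq> 1"
  proof
    assume "qpow \<tau> (of_int L + 1) = 1"
    then have "exp (- (2 * pi * Im \<tau> * (of_int L + 1))) = 1"
      by (metis norm_qpow norm_one)
    then have "real_of_int (L + 1) = 0"
      using tau by simp
    then show False
      using assms by linarith
  qed
  ultimately show ?thesis
    unfolding h_def by simp
qed

lemma summable_weighted_pterm: "(\<lambda>n. of_int (n + 1) * pterm \<tau> 0 n) summable_on {0..}"
proof (rule summable_gaussian[of "pi * Im \<tau>" _ _ 1 "- (pi * Im \<tau>) + 1"])
  fix n :: int assume "n \<in> {0..}"
  then have "\<bar>of_int (n + 1)\<bar> \<le> exp (real_of_int n)"
    using exp_ge_add_one_self[of "real_of_int n"] by (simp add: add.commute)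
  then have "norm (of_int (n + 1) * pterm \<tau> 0 n) \<le> exp (real_of_int n) * norm (pterm \<tau> 0 n)"
    unfolding norm_mult norm_of_int by (intro mult_right_mono) auto
  also have "\<dots> = exp (- (pi * Im \<tau>) * (of_int n)\<^sup>2 + (- (pi * Im \<tau>) + 1) * of_int n)"
    by (simp add: norm_pterm algebra_simps flip: exp_add)
  finally show "norm (of_int (n + 1) * pterm \<tau> 0 n)
      \<le> 1 * exp (- (pi * Im \<tau>) * (of_int n)\<^sup>2 + (- (pi * Im \<tau>) + 1) * of_int n)"
    by simp
qed (use tau in auto)

text \<open>After exchanging the sums the term n is counted once for each s in 0..n.\<close>

lemma infsum_ptheta_diagonal:
  "(\<Sum>\<^sub>\<infinity>s\<in>{0..}. ptheta \<tau> s 0) = (\<Sum>\<^sub>\<infinity>n\<in>{0..}. of_int (n + 1) * pterm \<tau> 0 n)"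
proof -
  have "(\<lambda>x. norm (case x of (n, s) \<Rightarrow> pterm \<tau> 0 n)) summable_on (SIGMA n:{0..}. {0..n})"
    unfolding Infinite_Sum.abs_summable_on_Sigma_iff
  proof (intro conjI ballI)
    have "(\<lambda>n. norm (of_int (n + 1) * pterm \<tau> 0 n)) summable_on {0..}"
      using summable_weighted_pterm by (simp only: summable_on_iff_abs_summable_on_complex[of "\<lambda>n. of_int (n + 1) * pterm \<tau> 0 n"])
    then show "(\<lambda>n. norm (\<Sum>\<^sub>\<infinity>s\<in>{0..n}. norm (case (n, s) of (n, s) \<Rightarrow> pterm \<tau> 0 n))) summable_on {0..}"
      by (rule summable_on_cong[THEN iffD1, rotated]) (auto simp: norm_mult norm_of_int simp del: of_int_add)
  qed auto
  then have sum2: "(\<lambda>(n, s). pterm \<tau> 0 n) summable_on (SIGMA n:{0..}. {0..n})"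
    by (rule abs_summable_summable)
  then have sum1: "(\<lambda>(s, n). pterm \<tau> 0 n) summable_on (SIGMA s:{0..}. {s..})"
    by (rule summable_on_reindex_bij_witness[of _ prod.swap prod.swap, THEN iffD1, rotated 5]) auto
  have "(\<Sum>\<^sub>\<infinity>s\<in>{0..}. ptheta \<tau> s 0) = (\<Sum>\<^sub>\<infinity>(s, n)\<in>(SIGMA s:{0..}. {s..}). pterm \<tau> 0 n)"
    unfolding ptheta_def by (rule infsum_Sigma'_banach[OF sum1])
  also have "\<dots> = (\<Sum>\<^sub>\<infinity>(n, s)\<in>(SIGMA n:{0..}. {0..n}). pterm \<tau> 0 n)"
    by (rule infsum_reindex_bij_witness[of _ prod.swap prod.swap]) auto
  also have "\<dots> = (\<Sum>\<^sub>\<infinity>n\<in>{0..}. \<Sum>\<^sub>\<infinity>s\<in>{0..n}. pterm \<tau> 0 n)"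
    by (rule infsum_Sigma'_banach[OF sum2, symmetric])
  also have "\<dots> = (\<Sum>\<^sub>\<infinity>n\<in>{0..}. of_int (n + 1) * pterm \<tau> 0 n)"
    by (rule infsum_cong) simp
  finally show ?thesis .
qed

text \<open>At L = -1 the recursion only says h = h, so the value is computed directly. Since
  \<open>pterm \<tau> 0 s * ptheta \<tau> 0 s = ptheta \<tau> s 0\<close>, each half of the sum
  turns into tails at parameter 0; the negative half is first reflected by s -> -1 - s.\<close>

lemma pterm_ptheta_convolution_minus_1:
  "(\<Sum>\<^sub>\<infinity>s. pterm \<tau> 0 s * ptheta \<tau> 0 (-1 - s)) = - (\<Sum>\<^sub>\<infinity>n\<in>{0..}. of_int (2 * n + 1) * pterm \<tau> 0 n)"
proof -
  let ?F = "\<lambda>s. pterm \<tau> 0 s * ptheta \<tau> 0 (-1 - s)"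
  have "infsum ?F UNIV = infsum ?F {0..} + infsum ?F {..<0}"
  proof -
    have "{0::int..} \<union> {..<0} = UNIV" "{0::int..} \<inter> {..<0} = {}"
      by auto
    then show ?thesis
      using infsum_Un_disjoint[of ?F "{0..}" "{..<0}"] summable_pterm_ptheta[of 0 "\<lambda>s. -1 - s"]
      by simp
  qed
  also have "infsum ?F {..<0} = (\<Sum>\<^sub>\<infinity>s\<in>{0..}. - ptheta \<tau> s 0)"
  proof (rule infsum_reindex_bij_witness[of _ "\<lambda>s. -1 - s" "\<lambda>s. -1 - s"])
    fix s :: int
    show "- ptheta \<tau> (-1 - s) 0 = pterm \<tau> 0 s * ptheta \<tau> 0 (-1 - s)"
      using ptheta_translate[OF tau, of "-1 - s" 0] pterm_reflect[of \<tau> 0 s] by simp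
  qed auto
  also have "infsum ?F {0..} = (\<Sum>\<^sub>\<infinity>s\<in>{0..}. pterm \<tau> 0 s - ptheta \<tau> s 0)"
  proof (rule infsum_cong)
    fix s :: int
    have "ptheta \<tau> 0 (-1 - s) = qpow \<tau> (of_int s + 1) * ptheta \<tau> 0 (s + 1)"
      using ptheta_0_reflect[OF tau, of "-1 - s"] by (simp add: add_ac)
    also have "\<dots> = 1 - ptheta \<tau> 0 s"
      using ptheta_0_rec[OF tau, of s] by simp
    finally have "?F s = pterm \<tau> 0 s * (1 - ptheta \<tau> 0 s)"
      by simp
    then show "?F s = pterm \<tau> 0 s - ptheta \<tau> s 0"
      using ptheta_translate[OF tau, of s 0] by (simp add: right_diff_distrib)
  qed
  also have "\<dots> + (\<Sum>\<^sub>\<infinity>s\<in>{0..}. - ptheta \<tau> s 0)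
      = infsum (pterm \<tau> 0) {0..} - 2 * (\<Sum>\<^sub>\<infinity>s\<in>{0..}. ptheta \<tau> s 0)"
  proof -
    have "ptheta \<tau> s 0 = pterm \<tau> 0 s * ptheta \<tau> 0 s" for s
      using ptheta_translate[OF tau, of s 0] by simp
    then have "(\<lambda>s. ptheta \<tau> s 0) summable_on {0..}"
      using summable_pterm_ptheta[of 0 "\<lambda>s. s" "{0..}"] by presburger
    then show ?thesis
      using infsum_add[of "pterm \<tau> 0" "{0..}" "\<lambda>s. - ptheta \<tau> s 0"] summable_pterm[OF tau, of 0 "{0..}"]
      by (simp add: infsum_uminus summable_on_uminus)
  qed
  also have "\<dots> = - (\<Sum>\<^sub>\<infinity>n\<in>{0..}. of_int (2 * n + 1) * pterm \<tau> 0 n)"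
  proof -
    have "(\<Sum>\<^sub>\<infinity>n\<in>{0..}. of_int (2 * n + 1) * pterm \<tau> 0 n)
        = (\<Sum>\<^sub>\<infinity>n\<in>{0..}. 2 * (of_int (n + 1) * pterm \<tau> 0 n) + - pterm \<tau> 0 n)"
      by (rule infsum_cong) (simp add: algebra_simps)
    also have "\<dots> = 2 * (\<Sum>\<^sub>\<infinity>n\<in>{0..}. of_int (n + 1) * pterm \<tau> 0 n) + - infsum (pterm \<tau> 0) {0..}"
      by (subst infsum_add[OF summable_on_cmult_right[OF summable_weighted_pterm]
            summable_on_uminus[THEN iffD2, OF summable_pterm[OF tau]]])
        (simp only: infsum_cmult_right' infsum_uminus)
    finally show ?thesis
      by (simp add: infsum_ptheta_diagonal)
  qed
  finally show ?thesis .
qed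

end

section \<open>Jacobi's identity for the cube of the eta function\<close>

definition qpoch :: "complex \<Rightarrow> nat \<Rightarrow> complex" where
  "qpoch q n = (\<Prod>i<n. 1 - q ^ Suc i)"

text \<open>The Gaussian binomial coefficient, for k \<le> n only: when k > n the truncated
  difference gives a nonzero value instead of 0. This is why Pascal's rule below is restricted to k
  < n.\<close>

definition qbinom :: "complex \<Rightarrow> nat \<Rightarrow> nat \<Rightarrow> complex" where
  "qbinom q n k = qpoch q n / (qpoch q k * qpoch q (n - k))"

lemma qpoch_0 [simp]: "qpoch q 0 = 1"
  by (simp add: qpoch_def)

lemma qpoch_Suc: "qpoch q (Suc n) = qpoch q n * (1 - q ^ Suc n)"
  by (simp add: qpoch_def)

lemma qpoch_nonzero:
  assumes "norm q < 1"
  shows "qpoch q n \<noteq> 0"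
proof -
  have "q ^ Suc i \<noteq> 1" for i
    using power_Suc_less_one[of "norm q" i] assms
    by (metis less_irrefl norm_ge_zero norm_one norm_power power_less_one_iff zero_less_Suc)
  then show ?thesis
    by (simp add: qpoch_def del: power_Suc)
qed

text \<open>Pascal's rule comes from splitting 1 - q^(n+1) as (1 - q^(n-k)) + q^(n-k) (1 -
  q^(k+1)).\<close>

lemma qbinom_Suc_Suc:
  assumes "norm q < 1" "k < n"
  shows "qbinom q (Suc n) (Suc k) = qbinom q n (Suc k) + q ^ (n - k) * qbinom q n k"
proof -
  obtain j where n: "n = Suc (k + j)"
    using assms(2) less_iff_Suc_add by auto
  have "1 - q ^ Suc k \<noteq> 0" "1 - q ^ Suc j \<noteq> 0"
    using qpoch_nonzero[OF assms(1), of "Suc k"] qpoch_nonzero[OF assms(1), of "Suc j"]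
    by (simp_all only: qpoch_Suc mult_eq_0_iff) auto
  moreover have "1 - q ^ Suc (Suc (k + j)) = (1 - q ^ Suc j) + q ^ Suc j * (1 - q ^ Suc k)"
    by (simp add: algebra_simps power_add)
  ultimately show ?thesis
    using qpoch_nonzero[OF assms(1), of k] qpoch_nonzero[OF assms(1), of j]
      qpoch_nonzero[OF assms(1), of "k + j"]
    unfolding qbinom_def n
    by (simp add: Suc_diff_le qpoch_Suc[of q "Suc (k + j)"] qpoch_Suc[of q k] qpoch_Suc[of q j] 
        del: power_Suc add: divide_simps) (simp add: algebra_simps power_add)
qed

lemma qbinom_0 [simp]: "norm q < 1 \<Longrightarrow> qbinom q n 0 = 1"
  by (simp add: qbinom_def qpoch_nonzero)

lemma qbinom_self [simp]: "norm q < 1 \<Longrightarrow> qbinom q n n = 1"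
  by (simp add: qbinom_def qpoch_nonzero)

theorem q_binomial:
  assumes "norm q < 1"
  shows "(\<Prod>i<n. 1 + y * q ^ i) = (\<Sum>k\<le>n. qbinom q n k * q ^ (k choose 2) * y ^ k)"
proof (induction n)
  case (Suc n)
  let ?t = "\<lambda>n k. qbinom q n k * q ^ (k choose 2) * y ^ k"
  have step: "?t (Suc n) (Suc k) = ?t n (Suc k) + ?t n k * (y * q ^ n)" if "k < n" for k
  proof -
    have "q ^ (Suc k choose 2) * q ^ (n - k) = q ^ (k choose 2) * q ^ n"
      using that by (simp add: numeral_2_eq_2 flip: power_add)
    then show ?thesis
      using qbinom_Suc_Suc[OF assms that] by (simp add: algebra_simps)
  qed
  \<comment> \<open>Both end terms are taken out, because Pascal's rule covers only the inner
    ones.\<close>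
  have "(\<Sum>k\<le>Suc n. ?t (Suc n) k) = 1 + (\<Sum>k<n. ?t (Suc n) (Suc k)) + ?t (Suc n) (Suc n)"
    using assms
    by (subst lessThan_Suc_atMost[symmetric], subst sum.lessThan_Suc, subst sum.lessThan_Suc_shift)
      (simp add: numeral_2_eq_2)
  also have "(\<Sum>k<n. ?t (Suc n) (Suc k)) = (\<Sum>k<n. ?t n (Suc k)) + (\<Sum>k<n. ?t n k * (y * q ^ n))"
    using step by (simp flip: sum.distrib)
  also have "?t (Suc n) (Suc n) = ?t n n * (y * q ^ n)"
    using assms by (simp add: numeral_2_eq_2 power_add)
  also have "1 + ((\<Sum>k<n. ?t n (Suc k)) + (\<Sum>k<n. ?t n k * (y * q ^ n))) + ?t n n * (y * q ^ n)
      = (1 + (\<Sum>k<n. ?t n (Suc k))) + (\<Sum>k<Suc n. ?t n k * (y * q ^ n))"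
    by simp
  also have "1 + (\<Sum>k<n. ?t n (Suc k)) = (\<Sum>k\<le>n. ?t n k)"
    using assms by (simp only: sum.atMost_shift) (simp add: numeral_2_eq_2)
  also have "(\<Sum>k<Suc n. ?t n k * (y * q ^ n)) = (\<Sum>k\<le>n. ?t n k) * (y * q ^ n)"
    by (simp only: lessThan_Suc_atMost sum_distrib_right)
  also have "(\<Sum>k\<le>n. ?t n k) + (\<Sum>k\<le>n. ?t n k) * (y * q ^ n) = (\<Prod>i<Suc n. 1 + y * q ^ i)"
    by (simp only: Suc.IH[symmetric] prod.lessThan_Suc) (simp add: algebra_simps)
  finally show ?case ..
qed (use assms in \<open>simp add: numeral_2_eq_2\<close>)

text \<open>Differentiating the \<open>q\<close>-binomial theorem at the root \<open>y = - q\<^sup>-\<^sup>N\<close> of its left-hand side.\<close>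

lemma q_binomial_deriv:
  assumes "norm q < 1" "q \<noteq> 0" "N < n"
  shows "(\<Sum>k\<le>n. of_nat k * (qbinom q n k * q ^ (k choose 2) * (- inverse (q ^ N)) ^ k))
      = - (\<Prod>i\<in>{..<n} - {N}. 1 - q ^ i / q ^ N)"
proof -
  define y0 where "y0 = - inverse (q ^ N)"
  define rest where "rest y = (\<Prod>i\<in>{..<n} - {N}. 1 + y * q ^ i)" for y
  have split: "(\<Prod>i<n. 1 + y * q ^ i) = (1 + y * q ^ N) * rest y" for y
    unfolding rest_def using assms(3) by (subst prod.remove[of _ N]) auto
  \<comment> \<open>Existence is enough: in the product rule D is multiplied by 1 + y0 q^N, which is
    0.\<close>
  have "\<exists>D. (rest has_field_derivative D) (at y0)"
    unfolding rest_def by (rule exI, rule has_field_derivative_prod) (auto intro!: derivative_eq_intros)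
  then obtain D where D: "(rest has_field_derivative D) (at y0)"
    by blast
  have "((\<lambda>y. (1 + y * q ^ N) * rest y) has_field_derivative q ^ N * rest y0) (at y0)"
    by (rule derivative_eq_intros D refl | simp)+ (use assms in \<open>simp add: y0_def\<close>)
  moreover have "((\<lambda>y. \<Sum>k\<le>n. qbinom q n k * q ^ (k choose 2) * y ^ k) has_field_derivative
      (\<Sum>k\<le>n. qbinom q n k * q ^ (k choose 2) * (of_nat k * y0 ^ (k - 1)))) (at y0)"
    by (auto intro!: derivative_eq_intros sum.cong)
  ultimately have "q ^ N * rest y0 = (\<Sum>k\<le>n. qbinom q n k * q ^ (k choose 2) * (of_nat k * y0 ^ (k - 1)))"
    unfolding split[symmetric] q_binomial[OF assms(1)] by (rule DERIV_unique)
  \<comment> \<open>Multiplying by y0 restores the power y0^k, and y0 q^N = -1 produces the sign of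
    the claim.\<close>
  then have "y0 * (q ^ N * rest y0) = (\<Sum>k\<le>n. y0 * (qbinom q n k * q ^ (k choose 2) * (of_nat k * y0 ^ (k - 1))))"
    by (simp add: sum_distrib_left)
  also have "\<dots> = (\<Sum>k\<le>n. of_nat k * (qbinom q n k * q ^ (k choose 2) * y0 ^ k))"
  proof (rule sum.cong)
    fix k
    show "y0 * (qbinom q n k * q ^ (k choose 2) * (of_nat k * y0 ^ (k - 1)))
        = of_nat k * (qbinom q n k * q ^ (k choose 2) * y0 ^ k)"
      by (cases k) simp_all
  qed simp
  finally show ?thesis
    using assms(2) by (simp add: y0_def rest_def field_simps)
qed

text \<open>The N factors above the root form \<open>qpoch q N\<close> directly. Those below are 1 -
  q^(-i) for i = 1..N, and q^(1 + ... + N) clears their denominators, turning each into -(1 -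
  q^i).\<close>

lemma prod_around_root:
  assumes "q \<noteq> 0"
  shows "q ^ (Suc N choose 2) * (\<Prod>i\<in>{..<2 * N + 1} - {N}. 1 - q ^ i / q ^ N) = (-1) ^ N * (qpoch q N)\<^sup>2"
proof -
  let ?f = "\<lambda>i. 1 - q ^ i / q ^ N"
  have "{..<2 * N + 1} - {N} = {..<N} \<union> {N + 1..<2 * N + 1}"
    by auto
  moreover have "prod ?f ({..<N} \<union> {N + 1..<2 * N + 1}) = prod ?f {..<N} * prod ?f {N + 1..<2 * N + 1}"
    by (rule prod.union_disjoint) auto
  ultimately have "prod ?f ({..<2 * N + 1} - {N}) = prod ?f {..<N} * prod ?f {N + 1..<2 * N + 1}"
    by argo
  also have "prod ?f {N + 1..<2 * N + 1} = (\<Prod>i<N. ?f (N + 1 + i))"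
    by (rule prod.reindex_bij_witness[of _ "\<lambda>i. N + 1 + i" "\<lambda>i. i - (N + 1)"]) auto
  also have "\<dots> = qpoch q N"
    unfolding qpoch_def using assms by (simp add: power_add)
  also have "prod ?f {..<N} = (\<Prod>i<N. ?f (N - Suc i))"
    by (rule prod.nat_diff_reindex[symmetric])
  finally have eq: "prod ?f ({..<2 * N + 1} - {N}) = (\<Prod>i<N. ?f (N - Suc i)) * qpoch q N" .
  have "q ^ (Suc N choose 2) = (\<Prod>i<N. q ^ Suc i)"
    by (induction N) (simp_all add: numeral_2_eq_2 power_add)
  then have "q ^ (Suc N choose 2) * (\<Prod>i<N. ?f (N - Suc i)) = (\<Prod>i<N. q ^ Suc i * ?f (N - Suc i))"
    by (simp add: prod.distrib)
  also have "\<dots> = (\<Prod>i<N. - (1 - q ^ Suc i))"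
  proof (rule prod.cong)
    fix i assume "i \<in> {..<N}"
    then have "q ^ N = q ^ Suc i * q ^ (N - Suc i)"
      by (simp del: power_Suc flip: power_add)
    then show "q ^ Suc i * ?f (N - Suc i) = - (1 - q ^ Suc i)"
      using assms by (simp add: field_simps)
  qed simp
  also have "\<dots> = (-1) ^ N * qpoch q N"
    unfolding qpoch_def prod_uminus by simp
  finally show ?thesis
    unfolding eq by (simp add: power2_eq_square mult_ac)
qed

text \<open>After normalisation by q^(N(N+1)/2), the terms k = N + 1 + d and k = N - d of the
  differentiated q-binomial sum carry the same power q^(d(d+1)/2), free of N. This is what allows
  the sum to be folded and N to tend to infinity.\<close>

lemma triangle_exponent:
  assumes "q \<noteq> 0" "d \<le> N"
  shows "q ^ (Suc N choose 2) * (q ^ (Suc (N + d) choose 2) * (- inverse (q ^ N)) ^ Suc (N + d))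
      = (-1) ^ Suc (N + d) * (q ^ (Suc d choose 2) :: complex)" (is ?A)
    and "q ^ (Suc N choose 2) * (q ^ ((N - d) choose 2) * (- inverse (q ^ N)) ^ (N - d))
      = (-1) ^ (N - d) * (q ^ (Suc d choose 2) :: complex)" (is ?B)
proof -
  have neg: "(- inverse (q ^ N)) ^ k = (-1) ^ k * inverse (q ^ (N * k))" for k
    by (subst power_minus) (simp add: power_inverse flip: power_mult)
  have tri: "real (Suc k choose 2) = real k * (real k + 1) / 2" for k
    by (induction k) (simp_all add: numeral_2_eq_2 field_simps)
  have "real ((Suc N choose 2) + (Suc (N + d) choose 2)) = real (N * Suc (N + d) + (Suc d choose 2))"
    by (simp only: of_nat_add tri of_nat_mult of_nat_Suc) (simp add: field_simps)
  then have "(Suc N choose 2) + (Suc (N + d) choose 2) = N * Suc (N + d) + (Suc d choose 2)"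
    by (simp only: of_nat_eq_iff)
  then have "q ^ (Suc N choose 2) * q ^ (Suc (N + d) choose 2) = q ^ (N * Suc (N + d)) * q ^ (Suc d choose 2)"
    by (simp only: flip: power_add)
  then show ?A
    unfolding neg using assms(1) by (simp add: field_simps del: power_Suc)
  have tri': "real (k choose 2) = real k * (real k - 1) / 2" for k
    by (cases k) (simp_all add: tri algebra_simps)
  have "real ((Suc N choose 2) + ((N - d) choose 2)) = real (N * (N - d) + (Suc d choose 2))"
    using assms(2) by (simp only: of_nat_add tri tri' of_nat_mult of_nat_diff) (simp add: field_simps)
  then have "(Suc N choose 2) + ((N - d) choose 2) = N * (N - d) + (Suc d choose 2)"
    by (simp only: of_nat_eq_iff)
  then have "q ^ (Suc N choose 2) * q ^ ((N - d) choose 2) = q ^ (N * (N - d)) * q ^ (Suc d choose 2)"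
    by (simp only: flip: power_add)
  then show ?B
    unfolding neg using assms(1) by (simp add: field_simps)
qed

text \<open>The sum in \<open>q_binomial_deriv\<close> is folded about \<open>k = N + 1/2\<close>.\<close>

lemma finite_jacobi:
  assumes "norm q < 1" "q \<noteq> 0"
  shows "(qpoch q N)\<^sup>2 = (\<Sum>d\<le>N. (-1) ^ d * of_nat (2 * d + 1) * q ^ (Suc d choose 2) * qbinom q (2 * N + 1) (N - d))"
proof -
  let ?n = "2 * N + 1"
  let ?t = "\<lambda>k. of_nat k * (qbinom q ?n k * q ^ (k choose 2) * (- inverse (q ^ N)) ^ k)"
  have "(\<Sum>k\<le>?n. ?t k) = - (\<Prod>i\<in>{..<?n} - {N}. 1 - q ^ i / q ^ N)"
    by (rule q_binomial_deriv) (use assms in auto)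
  then have "(qpoch q N)\<^sup>2 = (-1) ^ Suc N * (q ^ (Suc N choose 2) * (\<Sum>k\<le>?n. ?t k))"
    using prod_around_root[OF assms(2), of N] by (simp add: mult.assoc flip: power2_eq_square power_mult_distrib)
  also have "(\<Sum>k\<le>?n. ?t k) = (\<Sum>d\<le>N. ?t (N - d)) + (\<Sum>d\<le>N. ?t (Suc (N + d)))"
  proof -
    have "{..?n} = {..N} \<union> {Suc N..?n}"
      by auto
    moreover have "sum ?t ({..N} \<union> {Suc N..?n}) = sum ?t {..N} + sum ?t {Suc N..?n}"
      by (rule sum.union_disjoint) auto
    moreover have "sum ?t {Suc N..?n} = (\<Sum>d\<le>N. ?t (Suc (N + d)))"
      by (rule sum.reindex_bij_witness[of _ "\<lambda>d. Suc (N + d)" "\<lambda>k. k - Suc N"]) auto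
    moreover have "sum ?t {..N} = (\<Sum>d\<le>N. ?t (N - d))"
      by (rule sum.reindex_bij_witness[of _ "\<lambda>d. N - d" "\<lambda>d. N - d"]) auto
    ultimately show ?thesis
      by argo
  qed
  also have "(-1) ^ Suc N * (q ^ (Suc N choose 2) * \<dots>)
      = (\<Sum>d\<le>N. (-1) ^ Suc N * (q ^ (Suc N choose 2) * (?t (N - d) + ?t (Suc (N + d)))))"
    by (simp only: sum_distrib_left flip: sum.distrib)
  also have "\<dots> = (\<Sum>d\<le>N. (-1) ^ d * of_nat (2 * d + 1) * q ^ (Suc d choose 2) * qbinom q ?n (N - d))"
  proof (rule sum.cong)
    fix d assume "d \<in> {..N}"
    then have d: "d \<le> N"
      by simp
    have sym: "qbinom q ?n (Suc (N + d)) = qbinom q ?n (N - d)"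
    proof -
      have "?n - Suc (N + d) = N - d" "?n - (N - d) = Suc (N + d)"
        using d by auto
      then show ?thesis
        by (simp add: qbinom_def mult.commute)
    qed
    have sgn: "(-1) ^ N * (-1) ^ (N - d) = (-1 :: complex) ^ d"
      using d by (simp add: minus_one_power_iff)
    have "q ^ (Suc N choose 2) * (?t (N - d) + ?t (Suc (N + d)))
      = qbinom q ?n (N - d) * (of_nat (N - d) * (q ^ (Suc N choose 2) * (q ^ ((N - d) choose 2) * (- inverse (q ^ N)) ^ (N - d)))
         + of_nat (Suc (N + d)) * (q ^ (Suc N choose 2) * (q ^ (Suc (N + d) choose 2) * (- inverse (q ^ N)) ^ Suc (N + d))))"
      unfolding sym by (simp only: algebra_simps)
    also have "\<dots> = qbinom q ?n (N - d) * q ^ (Suc d choose 2)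
        * (of_nat (N - d) * (-1) ^ (N - d) - of_nat (Suc (N + d)) * (-1) ^ (N + d))"
      unfolding triangle_exponent[OF assms(2) d] by (simp add: algebra_simps)
    also have "(-1) ^ Suc N * \<dots> = qbinom q ?n (N - d) * q ^ (Suc d choose 2)
        * (of_nat (Suc (N + d)) * ((-1) ^ N * (-1) ^ (N + d)) - of_nat (N - d) * ((-1) ^ N * (-1) ^ (N - d)))"
      by (simp add: algebra_simps)
    also have "(-1) ^ N * (-1) ^ (N + d) = (-1 :: complex) ^ d"
      by (simp add: power_add mult.assoc[symmetric] flip: power_mult_distrib)
    \<comment> \<open>The weights N + d + 1 and N - d enter with opposite signs, so N cancels and 2d
      + 1 remains.\<close>
    finally show "(-1) ^ Suc N * (q ^ (Suc N choose 2) * (?t (N - d) + ?t (Suc (N + d))))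
        = (-1) ^ d * of_nat (2 * d + 1) * q ^ (Suc d choose 2) * qbinom q ?n (N - d)"
      unfolding sgn using d by (simp add: of_nat_diff algebra_simps)
  qed simp
  finally show ?thesis .
qed

lemma qpoch_limit:
  fixes q :: complex
  assumes "norm q < 1"
  shows "qpoch q \<longlonglongrightarrow> (\<Prod>n. 1 - q ^ Suc n)" "(\<Prod>n. 1 - q ^ Suc n) \<noteq> 0"
proof -
  have nz: "q ^ Suc i \<noteq> 1" for i
    using qpoch_nonzero[OF assms, of "Suc i"] by (auto simp: qpoch_Suc)
  have "convergent_prod (\<lambda>k. 1 + - (q ^ Suc k))"
  proof (rule summable_imp_convergent_prod_complex)
    show "summable (\<lambda>k. norm (- (q ^ Suc k)))"
      unfolding norm_minus_cancel norm_power using assms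
      by (simp only: summable_Suc_iff) (simp add: summable_geometric)
  qed (use nz in simp)
  then have conv: "convergent_prod (\<lambda>k. 1 - q ^ Suc k)"
    by simp
  from convergent_prod_LIMSEQ[OF conv] have "(\<lambda>n. qpoch q (Suc n)) \<longlonglongrightarrow> (\<Prod>n. 1 - q ^ Suc n)"
    by (simp add: qpoch_def lessThan_Suc_atMost)
  then show "qpoch q \<longlonglongrightarrow> (\<Prod>n. 1 - q ^ Suc n)"
    by (rule LIMSEQ_imp_Suc)
  show "(\<Prod>n. 1 - q ^ Suc n) \<noteq> 0"
    by (rule prodinf_nonzero[OF conv]) (use nz in simp)
qed

text \<open>Tannery's theorem applied to \<open>finite_jacobi\<close>: the left side tends to Q^2
  and every q-binomial coefficient to 1/Q, where Q is the infinite product. Hence Q^2 is the series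
  divided by Q.\<close>

theorem jacobi_cube:
  fixes q :: complex
  assumes "norm q < 1" "q \<noteq> 0"
  shows "(\<lambda>d. (-1) ^ d * of_nat (2 * d + 1) * q ^ (Suc d choose 2)) sums (\<Prod>n. 1 - q ^ Suc n) ^ 3"
proof -
  define Q where "Q = (\<Prod>n. 1 - q ^ Suc n)"
  define c where "c d = (-1) ^ d * of_nat (2 * d + 1) * q ^ (Suc d choose 2)" for d
  have Q: "qpoch q \<longlonglongrightarrow> Q" "Q \<noteq> 0"
    using qpoch_limit[OF assms(1)] by (simp_all add: Q_def)
  obtain B where B: "\<And>n. norm (qpoch q n) \<le> B"
    using convergent_imp_Bseq[OF convergentI[OF Q(1)]] by (auto simp: Bseq_def)
  obtain B' where B': "\<And>n. norm (inverse (qpoch q n)) \<le> B'"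
    using convergent_imp_Bseq[OF convergentI[OF tendsto_inverse[OF Q]]] by (auto simp: Bseq_def)
  have Bpos: "0 \<le> B" "0 \<le> B'"
    using B[of 0] B'[of 0] by auto
  \<comment> \<open>Cut off at d = N explicitly, as \<open>N - d\<close> would be truncated to 0
    beyond. The finite sum thus becomes a series over all d with a majorant independent of
    N.\<close>
  define a where "a d N = (if d \<le> N then c d * qbinom q (2 * N + 1) (N - d) else 0)" for d N
  have qb: "norm (qbinom q n k) \<le> B * B' * B'" for n k
    unfolding qbinom_def divide_inverse norm_mult inverse_mult_distrib
    using B B' Bpos by (simp add: mult.assoc mult_mono)
  have "(\<lambda>n. qbinom q (2 * n + 1) (n - d)) \<longlonglongrightarrow> Q / (Q * Q)" for d
  proof -
    have "(\<lambda>n. qpoch q (2 * n + 1)) \<longlonglongrightarrow> Q" "(\<lambda>n. qpoch q (n - d)) \<longlonglongrightarrow> Q" "(\<lambda>n. qpoch q (2 * n + 1 - (n - d))) \<longlonglongrightarrow> Q"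
      by (rule filterlim_compose[OF Q(1)], real_asymp)+
    then show ?thesis
      unfolding qbinom_def using Q(2) by (intro tendsto_intros) auto
  qed
  then have "(\<lambda>n. c d * qbinom q (2 * n + 1) (n - d)) \<longlonglongrightarrow> c d * (Q / (Q * Q))" for d
    by (intro tendsto_intros)
  then have lim: "(\<lambda>N. a d N) \<longlonglongrightarrow> c d * (Q / (Q * Q))" for d
    by (rule Lim_transform_eventually)
      (use eventually_ge_at_top[of d] in eventually_elim, simp add: a_def)
  have summ: "summable (\<lambda>d. norm (c d))"
  proof (rule summable_comparison_test')
    have "summable (\<lambda>d. diffs (\<lambda>d. 2 :: real) d * norm q ^ d)"
      by (rule termdiff_converges[of _ 1]) (use assms in \<open>auto intro!: summable_mult summable_geometric\<close>)
    then show "summable (\<lambda>d. (2 * real (Suc d)) * norm q ^ d)"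
      by (simp add: diffs_def mult.commute)
    fix d :: nat
    have "d \<le> Suc d choose 2"
      by (simp add: numeral_2_eq_2)
    then have "norm q ^ (Suc d choose 2) \<le> norm q ^ d"
      using assms by (intro power_decreasing) auto
    then have "real (2 * d + 1) * norm q ^ (Suc d choose 2) \<le> (2 * real (Suc d)) * norm q ^ d"
      by (intro mult_mono) auto
    then show "norm (norm (c d)) \<le> (2 * real (Suc d)) * norm q ^ d"
      by (simp add: c_def norm_mult norm_power del: of_nat_add of_nat_mult of_nat_Suc of_nat_numeral)
  qed
  have "((\<lambda>N. \<Sum>d. a d N) \<longlonglongrightarrow> (\<Sum>d. c d * (Q / (Q * Q))))"
  proof (rule tannerys_theorem[THEN conjunct2, THEN conjunct2])
    show "(\<lambda>N. a d N) \<longlonglongrightarrow> c d * (Q / (Q * Q))" for d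
      by (rule lim)
    show "\<forall>\<^sub>F (d, N) in at_top \<times>\<^sub>F at_top. norm (a d N) \<le> norm (c d) * (B * B' * B')"
      using qb Bpos by (intro always_eventually) (auto simp: a_def norm_mult intro!: mult_left_mono mult_nonneg_nonneg)
    show "summable (\<lambda>d. norm (c d) * (B * B' * B'))"
      using summ by (rule summable_mult2)
  qed simp
  moreover have "(\<Sum>d. a d N) = (qpoch q N)\<^sup>2" for N
  proof -
    have "(\<Sum>d. a d N) = (\<Sum>d\<le>N. a d N)"
      by (rule suminf_finite) (auto simp: a_def)
    then show ?thesis
      using finite_jacobi[OF assms, of N] by (simp add: a_def c_def)
  qed
  ultimately have "(\<lambda>N. (qpoch q N)\<^sup>2) \<longlonglongrightarrow> (\<Sum>d. c d * (Q / (Q * Q)))"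
    by simp
  moreover have "(\<lambda>N. (qpoch q N)\<^sup>2) \<longlonglongrightarrow> Q\<^sup>2"
    by (intro tendsto_intros Q)
  ultimately have "Q\<^sup>2 = (\<Sum>d. c d * (Q / (Q * Q)))"
    by (rule LIMSEQ_unique[rotated])
  also have "\<dots> = (\<Sum>d. c d) * (Q / (Q * Q))"
    using summable_norm_cancel[OF summ] by (rule suminf_mult2[symmetric])
  finally have "(\<Sum>d. c d) = Q ^ 3"
    using Q(2) by (simp add: field_simps power2_eq_square power3_eq_cube)
  then show ?thesis
    using summable_sums[OF summable_norm_cancel[OF summ]] by (simp add: c_def Q_def)
qed

section \<open>Hecke-type sums\<close>

lemma eta_cube:
  assumes "Im \<tau> > 0"
  shows "dedekind_eta \<tau> ^ 3 = qpow \<tau> (1 / 8) * (\<Sum>\<^sub>\<infinity>n\<in>{0..}. of_int (2 * n + 1) * pterm \<tau> 0 n)"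
proof -
  let ?f = "\<lambda>n. of_int (2 * n + 1) * pterm \<tau> 0 n"
  define q where "q = qpow \<tau> 1"
  have q: "norm q < 1" "q \<noteq> 0"
    using assms by (simp_all add: q_def norm_qpow)
  have tri: "real (Suc d choose 2) = real d * (real d + 1) / 2" for d
    by (induction d) (simp_all add: numeral_2_eq_2 field_simps)
  have f_nat: "?f (int d) = (-1) ^ d * of_nat (2 * d + 1) * q ^ (Suc d choose 2)" for d
    by (simp add: pterm_def q_def qpow_power tri)
  have "(\<lambda>n. 2 * (of_int (n + 1) * pterm \<tau> 0 n) + - pterm \<tau> 0 n) summable_on {0..}"
    by (intro summable_on_add summable_on_cmult_right summable_weighted_pterm assms
      summable_on_uminus[THEN iffD2] summable_pterm)
  then have "?f summable_on {0..}"
    by (rule summable_on_cong[THEN iffD1, rotated]) (simp add: algebra_simps)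
  moreover have "range int = {0..}"
    by (auto simp: image_iff) (metis int_nat_eq)
  ultimately have "(?f has_sum infsum ?f {0..}) (range int)"
    by simp
  then have "((?f \<circ> int) has_sum infsum ?f {0..}) UNIV"
    by (subst (asm) has_sum_reindex) auto
  then have "(\<lambda>d. ?f (int d)) sums infsum ?f {0..}"
    using has_sum_imp_sums by (simp add: o_def)
  then have "infsum ?f {0..} = (\<Prod>n. 1 - q ^ Suc n) ^ 3"
    unfolding f_nat using jacobi_cube[OF q] sums_unique2 by blast
  moreover have "(\<Prod>n. 1 - q ^ Suc n) = (\<Prod>n. 1 - qpow \<tau> (real (Suc n)))"
    by (simp only: q_def qpow_power mult_1_right)
  ultimately show ?thesis
    unfolding dedekind_eta_def by (simp add: power_mult_distrib qpow_power)
qed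

text \<open>Coefficientwise form of theta times its reciprocal: a delta at L = -1 of size -\<eta>^3.
  The exponent 1/8 is three times the 1/24 of \<open>dedekind_eta\<close>.\<close>

lemma pterm_ptheta_convolution_eta:
  assumes "Im \<tau> > 0"
  shows "qpow \<tau> (1 / 8) * (\<Sum>\<^sub>\<infinity>s. pterm \<tau> 0 s * ptheta \<tau> 0 (L - s)) = (if L = -1 then - (dedekind_eta \<tau> ^ 3) else 0)"
  using pterm_ptheta_convolution[OF assms, of L] pterm_ptheta_convolution_minus_1[OF assms]
  by (simp add: eta_cube[OF assms])

section \<open>Products of series and theta functions in exponential coordinates\<close>

lemma summable_times:
  fixes f :: "'a \<Rightarrow> complex" and g :: "'b \<Rightarrow> complex"
  assumes "f summable_on A" "g summable_on B"
  shows "(\<lambda>(x, y). f x * g y) summable_on A \<times> B"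
proof -
  have f: "(\<lambda>x. norm (f x)) summable_on A" and g: "(\<lambda>x. norm (g x)) summable_on B"
    using assms by (simp_all only: summable_on_iff_abs_summable_on_complex[symmetric])
  have "(\<lambda>p. norm (case p of (x, y) \<Rightarrow> f x * g y)) summable_on (SIGMA x:A. B)"
    unfolding Infinite_Sum.abs_summable_on_Sigma_iff
    using f g
    by (auto simp: norm_mult infsum_cmult_right' abs_mult intro!: summable_on_cmult_right summable_on_cmult_left)
  then show ?thesis
    by (rule abs_summable_summable)
qed

lemma infsum_times:
  fixes f :: "'a \<Rightarrow> complex" and g :: "'b \<Rightarrow> complex"
  assumes "f summable_on A" "g summable_on B"
  shows "infsum f A * infsum g B = (\<Sum>\<^sub>\<infinity>(x, y)\<in>A \<times> B. f x * g y)"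
  using infsum_Sigma'_banach[OF summable_times[OF assms]] by (simp add: infsum_cmult_right' infsum_cmult_left')

lemma infsum_laurent_product:
  fixes f g :: "int \<Rightarrow> complex"
  assumes "f summable_on UNIV" "g summable_on UNIV"
  shows "infsum f UNIV * infsum g UNIV = (\<Sum>\<^sub>\<infinity>k. \<Sum>\<^sub>\<infinity>s. f s * g (k - s))"
proof -
  have summ: "(\<lambda>(k, s). f s * g (k - s)) summable_on UNIV \<times> UNIV"
    using summable_times[OF assms]
    by (rule summable_on_reindex_bij_witness[of _ "\<lambda>(s, k). (s + k, s)" "\<lambda>(k, s). (s, k - s)", THEN iffD2, rotated 5]) auto
  have "infsum f UNIV * infsum g UNIV = (\<Sum>\<^sub>\<infinity>(k, s)\<in>UNIV \<times> UNIV. f s * g (k - s))"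
    unfolding infsum_times[OF assms]
    by (rule infsum_reindex_bij_witness[of _ "\<lambda>(k, s). (s, k - s)" "\<lambda>(s, k). (s + k, s)"]) auto
  also have "\<dots> = (\<Sum>\<^sub>\<infinity>k. \<Sum>\<^sub>\<infinity>s. f s * g (k - s))"
    using infsum_Sigma'_banach[OF summ] by simp
  finally show ?thesis .
qed

text \<open>Normalised with \<pi>i instead of 2\<pi>i, so that the summands of a theta function of
  index M and characteristic k have the exponents 2Mn + k.\<close>

definition xpow :: "complex \<Rightarrow> real \<Rightarrow> complex" where
  "xpow w u = exp (of_real pi * \<i> * w * of_real u)"

lemma xpow_add: "xpow w (x + y) = xpow w x * xpow w y"
  by (simp add: xpow_def algebra_simps flip: exp_add)

lemma xpow_nonzero [simp]: "xpow w u \<noteq> 0"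
  by (simp add: xpow_def)

lemma norm_xpow: "norm (xpow w u) = exp (- (pi * Im w * u))"
  by (simp add: xpow_def)

lemma theta_altdef:
  assumes "M > 0"
  shows "theta e k M \<tau> z = (\<Sum>\<^sub>\<infinity>n. e powi n * xpow z (2 * M * of_int n + k) * qpow \<tau> ((2 * M * of_int n + k)\<^sup>2 / (4 * M)))"
proof -
  have "2 * of_real pi * \<i> * of_real M * of_real (of_int n + k / (2 * M)) * z
      = of_real pi * \<i> * z * of_real (2 * M * of_int n + k)" for n :: int
  proof -
    have "of_real pi * \<i> * z * of_real (2 * M * of_int n + k) = of_real pi * \<i> * z * of_real (2 * M * (of_int n + k / (2 * M)))"
      using assms by (simp add: field_simps)
    then show ?thesis
      by (simp only: of_real_mult of_real_numeral mult_ac)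
  qed
  moreover have "M * (of_int n + k / (2 * M))\<^sup>2 = (2 * M * of_int n + k)\<^sup>2 / (4 * M)" for n :: int
    using assms by (simp add: field_simps power2_eq_square)
  ultimately show ?thesis
    unfolding theta_def xpow_def by presburger
qed

lemma summable_theta_like:
  fixes f :: "int \<Rightarrow> complex"
  assumes "Im \<tau> > 0" "A > 0" "\<And>n. norm (e n) \<le> D"
  shows "(\<lambda>n. e n * xpow w (a * of_int n + b) * qpow \<tau> (A * (of_int n)\<^sup>2 + B * of_int n + C)) summable_on S"
proof (rule summable_gaussian)
  show "2 * pi * Im \<tau> * A > 0"
    using assms by simp
  fix n :: int
  have "norm (e n * xpow w (a * of_int n + b) * qpow \<tau> (A * (of_int n)\<^sup>2 + B * of_int n + C))
     \<le> D * norm (xpow w (a * of_int n + b)) * norm (qpow \<tau> (A * (of_int n)\<^sup>2 + B * of_int n + C))"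
    unfolding norm_mult using assms(3) by (intro mult_right_mono) auto
  also have "\<dots> = (D * exp (- (pi * Im w * b) - 2 * pi * Im \<tau> * C)) * exp (- (2 * pi * Im \<tau> * A) * (of_int n)\<^sup>2 + (- (pi * Im w * a) - 2 * pi * Im \<tau> * B) * of_int n)"
    by (simp add: norm_xpow norm_qpow algebra_simps flip: exp_add)
  finally show "norm (e n * xpow w (a * of_int n + b) * qpow \<tau> (A * (of_int n)\<^sup>2 + B * of_int n + C))
    \<le> (D * exp (- (pi * Im w * b) - 2 * pi * Im \<tau> * C)) * exp (- (2 * pi * Im \<tau> * A) * (of_int n)\<^sup>2 + (- (pi * Im w * a) - 2 * pi * Im \<tau> * B) * of_int n)" .
qed

lemma theta_summand_summable:
  assumes "Im \<tau> > 0" "Mr > 0" "e = 1 \<or> e = -1"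
  shows "(\<lambda>n. e powi n * xpow z (2 * Mr * of_int n + k) * qpow \<tau> ((2 * Mr * of_int n + k)\<^sup>2 / (4 * Mr))) summable_on S"
proof -
  have "(\<lambda>n. e powi n * xpow z (2 * Mr * of_int n + k) * qpow \<tau> (Mr * (of_int n)\<^sup>2 + k * of_int n + k\<^sup>2 / (4 * Mr))) summable_on S"
    by (rule summable_theta_like[where D = 1]) (use assms norm_powi_sign[OF assms(3)] in auto)
  moreover have "Mr * (of_int n)\<^sup>2 + k * of_int n + k\<^sup>2 / (4 * Mr) = (2 * Mr * of_int n + k)\<^sup>2 / (4 * Mr)" for n :: int
    using assms(2) by (simp add: field_simps power2_eq_square)
  ultimately show ?thesis
    by simp
qed

lemma square_expand: "x \<noteq> 0 \<Longrightarrow> x * (y + z / (2 * x))\<^sup>2 = x * y\<^sup>2 + y * z + z\<^sup>2 / (4 * x)" for x y z :: real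
  by (simp add: field_simps power2_eq_square)

lemma square_expand_diff: "x \<noteq> 0 \<Longrightarrow> x * (y - z / (2 * x))\<^sup>2 = x * y\<^sup>2 - y * z + z\<^sup>2 / (4 * x)" for x y z :: real
  by (simp add: field_simps power2_eq_square)

text \<open>Parts 1, 2 and 3 are the cases \<open>(\<epsilon>, P) = (-1, p + 1/2)\<close>, \<open>(1, p + 1/2)\<close> and \<open>(-1, p)\<close>; for
  \<open>\<epsilon> = 1\<close> and integral \<open>P\<close>, which \<open>eps_p2\<close> excludes, the quotient would have poles.\<close>

locale theta_quotient =
  fixes \<tau> \<epsilon> :: complex and M p2 :: int and m P :: real
  assumes tau: "Im \<tau> > 0"
    and eps: "\<epsilon> = 1 \<or> \<epsilon> = -1"
    and M: "M \<ge> 1"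
    and m: "m = of_int M - 1 / 2"
    and P: "P = of_int p2 / 2"
    and p2: "p2 \<ge> 0"
    and eps_p2: "(- \<epsilon>) powi p2 = - \<epsilon>"
begin

lemma m_pos: "m > 0" and M_pos: "real_of_int M > 0"
  using M by (simp_all add: m)

lemma neg_eps: "- \<epsilon> = 1 \<or> - \<epsilon> = -1"
  using eps by auto

text \<open>The exponent of \<open>q\<close> in a summand of \<open>hecke\<close>; the index \<open>\<kappa>\<close> stands for \<open>K = \<kappa> + 1/2\<close>.\<close>

definition expo :: "int \<Rightarrow> int \<Rightarrow> real" where
  "expo \<kappa> l = of_int M * (l + P / (2 * of_int M))\<^sup>2 + P * (of_int \<kappa> - 2 * of_int M * of_int l + 1 / 2) - P\<^sup>2 / 2 - (\<kappa> + 1 / 2)\<^sup>2 / (4 * m)"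

text \<open>For a = 0 this is the Laurent coefficient at K = \<kappa> + 1/2 of -\<eta>^3 times the
  first numerator theta over \<open>theta0\<close>, with q^(K^2/(4m)) divided out (see
  \<open>hecke_gker\<close>). The lower limit a stays variable because index shifts move it.\<close>

definition hecke :: "int \<Rightarrow> int \<Rightarrow> complex" where
  "hecke \<kappa> a = (\<Sum>\<^sub>\<infinity>l. \<epsilon> powi l * qpow \<tau> (expo \<kappa> l) * ptheta \<tau> a (\<kappa> - 2 * M * l))"

definition hecke_row :: "int \<Rightarrow> int \<Rightarrow> complex" where
  "hecke_row \<kappa> a = theta \<epsilon> (2 * m * P) M \<tau> 0 * ((- \<epsilon>) powi a * qpow \<tau> (- m * (a + P - (\<kappa> + 1 / 2) / (2 * m))\<^sup>2))"

text \<open>Completing the square in j = a - l and in a, with M = m + 1/2. This is where the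
  indefinite form M j^2 - m r^2 of the double sums comes from.\<close>

lemma expo_shift: "expo \<kappa> l + (of_int a * (of_int a + 1) / 2 + of_int a * of_int (\<kappa> - 2 * M * l))
   = of_int M * (of_int (a - l) + 2 * m * P / (2 * of_int M))\<^sup>2 - m * (a + P - (\<kappa> + 1 / 2) / (2 * m))\<^sup>2"
proof -
  have M': "real_of_int M = m + 1 / 2"
    by (simp add: m)
  have nz: "real_of_int M \<noteq> 0" "m \<noteq> 0"
    using m_pos M_pos by auto
  \<comment> \<open>4m^2 - 1 = (2m - 1)(2m + 1), and 2m + 1 = 2M.\<close>
  have "(2 * m * P)\<^sup>2 / (4 * of_int M) = P\<^sup>2 / (4 * of_int M) + (m - 1 / 2) * P\<^sup>2"
    using m_pos unfolding M' by (simp add: field_simps power2_eq_square)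
  note const = this
  have "of_int M * (of_int l)\<^sup>2 + of_int l * P + X + P * (of_int \<kappa> - 2 * of_int M * of_int l + 1 / 2) - P\<^sup>2 / 2 - Y
      + (of_int a * (of_int a + 1) / 2 + of_int a * of_int (\<kappa> - 2 * M * l))
    = of_int M * (of_int (a - l))\<^sup>2 + of_int (a - l) * (2 * m * P) + (X + (m - 1 / 2) * P\<^sup>2)
      - (m * (a + P)\<^sup>2 - (a + P) * (\<kappa> + 1 / 2) + Y)" for X Y
    by (simp add: M' power2_eq_square algebra_simps) (simp add: field_simps)
  then show ?thesis
    unfolding expo_def by (simp only: square_expand[OF nz(1)] square_expand_diff[OF nz(2)] const)
qed

lemma hecke_term_pterm: "\<epsilon> powi l * qpow \<tau> (expo \<kappa> l) * pterm \<tau> (\<kappa> - 2 * M * l) a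
  = (\<epsilon> powi (a - l) * qpow \<tau> (of_int M * (of_int (a - l) + 2 * m * P / (2 * of_int M))\<^sup>2))
      * ((- \<epsilon>) powi a * qpow \<tau> (- m * (a + P - (\<kappa> + 1 / 2) / (2 * m))\<^sup>2))"
proof -
  have "qpow \<tau> (expo \<kappa> l) * qpow \<tau> (of_int a * (of_int a + 1) / 2 + of_int a * of_int (\<kappa> - 2 * M * l))
    = qpow \<tau> (of_int M * (of_int (a - l) + 2 * m * P / (2 * of_int M))\<^sup>2) * qpow \<tau> (- m * (a + P - (\<kappa> + 1 / 2) / (2 * m))\<^sup>2)"
    unfolding qpow_add[symmetric] expo_shift by simp
  moreover have "\<epsilon> powi l * (-1) powi a = \<epsilon> powi (a - l) * (- \<epsilon>) powi a"
  proof -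
    have "(- \<epsilon>) powi a = (-1) powi a * \<epsilon> powi a"
      by (simp flip: power_int_mult_distrib)
    then show ?thesis
      using powi_sign_diff[OF eps, of a l] powi_sign_square[OF eps, of a] by (simp add: mult_ac)
  qed
  ultimately show ?thesis
    unfolding pterm_def by (simp add: mult_ac)
qed

text \<open>With the inner index fixed at a, the squares separate j = a - l from \<kappa>, so the
  sum over l is a theta value at 0. A row is thus what \<open>hecke\<close> gains when its lower
  limit drops from a + 1 to a.\<close>

lemma hecke_row_altdef: "hecke_row \<kappa> a = (\<Sum>\<^sub>\<infinity>l. \<epsilon> powi l * qpow \<tau> (expo \<kappa> l) * pterm \<tau> (\<kappa> - 2 * M * l) a)"
proof -
  have "theta \<epsilon> (2 * m * P) M \<tau> 0 = (\<Sum>\<^sub>\<infinity>j. \<epsilon> powi j * qpow \<tau> (M * (of_int j + 2 * m * P / (2 * of_int M))\<^sup>2))"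
    by (simp add: theta_def)
  also have "\<dots> = (\<Sum>\<^sub>\<infinity>l. \<epsilon> powi (a - l) * qpow \<tau> (of_int M * (of_int (a - l) + 2 * m * P / (2 * of_int M))\<^sup>2))"
    by (rule infsum_reindex_bij_witness[of _ "\<lambda>l. a - l" "\<lambda>j. a - j"]) auto
  finally show ?thesis
    unfolding hecke_row_def hecke_term_pterm by (simp add: infsum_cmult_left')
qed

lemma summable_row: "(\<lambda>l. \<epsilon> powi l * qpow \<tau> (expo \<kappa> l) * pterm \<tau> (\<kappa> - 2 * M * l) a) summable_on S"
proof -
  define b c where "b = - 2 * of_int M * (of_int a + 2 * m * P / (2 * of_int M))" and "c = of_int M * (of_int a + 2 * m * P / (2 * of_int M))\<^sup>2"
  have "(\<lambda>l. \<epsilon> powi (a - l) * xpow 0 (0 * of_int l + 0) * qpow \<tau> (of_int M * (of_int l)\<^sup>2 + b * of_int l + c)) summable_on S"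
    by (rule summable_theta_like) (use tau M_pos norm_powi_sign[OF eps] in auto)
  moreover have "of_int M * (of_int (a - l) + 2 * m * P / (2 * of_int M))\<^sup>2 = of_int M * (of_int l)\<^sup>2 + b * of_int l + c" for l
    unfolding b_def c_def by (simp add: power2_eq_square algebra_simps)
  ultimately show ?thesis
    unfolding hecke_term_pterm by (intro summable_on_cmult_left) (simp add: xpow_def)
qed

text \<open>Translating the tail to start at 0 exposes the Gaussian summand of a row times a bounded
  factor.\<close>

lemma summable_hecke: "(\<lambda>l. \<epsilon> powi l * qpow \<tau> (expo \<kappa> l) * ptheta \<tau> a (\<kappa> - 2 * M * l)) summable_on S"
proof -
  obtain C where "\<And>s. norm (ptheta \<tau> 0 s) \<le> C"
    using ptheta_0_bounded[OF tau] by blast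
  then have "(\<lambda>l. (\<epsilon> powi l * qpow \<tau> (expo \<kappa> l) * pterm \<tau> (\<kappa> - 2 * M * l) a) * ptheta \<tau> 0 (\<kappa> - 2 * M * l + a)) summable_on S"
    by (intro summable_mult_bounded[OF summable_row])
  then show ?thesis
    by (simp add: ptheta_translate[OF tau, of a] mult.assoc)
qed

lemma hecke_rec: "hecke \<kappa> a = hecke_row \<kappa> a + hecke \<kappa> (a + 1)"
  unfolding hecke_def hecke_row_altdef
  by (subst ptheta_rec[OF tau], subst distrib_left, rule infsum_add[OF summable_row summable_hecke])

text \<open>The step is 2m. Together with l -> l + 1 it lowers the parameter of the partial theta by
  1, which \<open>ptheta_shift_s\<close> converts into the lower limit a - 1; the power of q created
  there is absorbed by the exponent.\<close>

lemma hecke_periodic: "hecke (\<kappa> + (2 * M - 1)) a = - \<epsilon> * hecke \<kappa> (a - 1)"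
proof -
  have "\<epsilon> powi (l + 1) * qpow \<tau> (expo (\<kappa> + (2 * M - 1)) (l + 1)) * ptheta \<tau> a (\<kappa> + (2 * M - 1) - 2 * M * (l + 1))
     = - \<epsilon> * (\<epsilon> powi l * qpow \<tau> (expo \<kappa> l) * ptheta \<tau> (a - 1) (\<kappa> - 2 * M * l))" for l
  proof -
    have s: "\<kappa> + (2 * M - 1) - 2 * M * (l + 1) = \<kappa> - 2 * M * l - 1"
      by (simp add: algebra_simps)
    have "expo (\<kappa> + (2 * M - 1)) (l + 1) + of_int (\<kappa> - 2 * M * l) = expo \<kappa> l"
    proof -
      have "(of_int (\<kappa> + (2 * M - 1)) + 1 / 2)\<^sup>2 / (4 * m) = (\<kappa> + 1 / 2)\<^sup>2 / (4 * m) + (\<kappa> + 1 / 2) + m"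
      proof -
        have "real_of_int (\<kappa> + (2 * M - 1)) + 1 / 2 = \<kappa> + 1 / 2 + 2 * m"
          by (simp add: m)
        then show ?thesis
          using m_pos by (simp only:) (simp add: field_simps power2_eq_square)
      qed
      then show ?thesis
        using M_pos unfolding expo_def by (simp add: square_expand) (simp add: m power2_eq_square algebra_simps)
    qed
    then have "qpow \<tau> (expo (\<kappa> + (2 * M - 1)) (l + 1)) * qpow \<tau> (of_int (\<kappa> - 2 * M * l)) = qpow \<tau> (expo \<kappa> l)"
      by (rule qpow_mult)
    then show ?thesis
      unfolding s ptheta_shift_s[OF tau] using eps powi_sign_add[OF eps, of l 1] by (simp add: mult_ac)
  qed
  note step = this
  have "hecke (\<kappa> + (2 * M - 1)) a = (\<Sum>\<^sub>\<infinity>l. - \<epsilon> * (\<epsilon> powi l * qpow \<tau> (expo \<kappa> l) * ptheta \<tau> (a - 1) (\<kappa> - 2 * M * l)))"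
    unfolding hecke_def
  proof (rule infsum_reindex_bij_witness[of _ "\<lambda>l. l + 1" "\<lambda>l. l - 1"])
    fix l
    show "- \<epsilon> * (\<epsilon> powi (l - 1) * qpow \<tau> (expo \<kappa> (l - 1)) * ptheta \<tau> (a - 1) (\<kappa> - 2 * M * (l - 1)))
      = \<epsilon> powi l * qpow \<tau> (expo (\<kappa> + (2 * M - 1)) l) * ptheta \<tau> a (\<kappa> + (2 * M - 1) - 2 * M * l)"
      using step[of "l - 1"] by simp
  qed auto
  then show ?thesis
    unfolding hecke_def by (simp only: infsum_cmult_right')
qed

end

text \<open>Resums the deltas left by the division: values of k for which k + 1 is missed by i
  contribute 0, the others exactly one l. The offset 1 is that of the delta at L = -1.\<close>

lemma infsum_delta_reindex:
  fixes c :: "int \<Rightarrow> complex" and i :: "int \<Rightarrow> int"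
  assumes "inj i" "((\<lambda>l. c l * f (i l)) has_sum S) UNIV"
  shows "((\<lambda>k. f (k + 1) * (\<Sum>\<^sub>\<infinity>l. if i l = k + 1 then c l else 0)) has_sum S) UNIV"
proof -
  let ?G = "\<lambda>k. f (k + 1) * (\<Sum>\<^sub>\<infinity>l. if i l = k + 1 then c l else 0)"
  have "(\<Sum>\<^sub>\<infinity>l'. if i l' = i l then c l' else 0) = (\<Sum>\<^sub>\<infinity>l'\<in>{l}. c l')" for l
    by (rule infsum_cong_neutral) (use assms(1) in \<open>auto dest: injD\<close>)
  then have "((?G \<circ> (\<lambda>l. i l - 1)) has_sum S) UNIV"
    using assms(2) by (simp add: o_def mult.commute)
  moreover have "inj (\<lambda>l. i l - 1)"
    using assms(1) by (auto simp: inj_def)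
  ultimately have "(?G has_sum S) (range (\<lambda>l. i l - 1))"
    by (subst has_sum_reindex)
  moreover have "?G k = 0" if "k \<notin> range (\<lambda>l. i l - 1)" for k
  proof -
    have "i l \<noteq> k + 1" for l
    proof
      assume "i l = k + 1"
      then have "k = i l - 1"
        by simp
      then show False
        using that by blast
    qed
    then show ?thesis
      by simp
  qed
  ultimately show ?thesis
    using has_sum_cong_neutral[of UNIV "range (\<lambda>l. i l - 1)" ?G ?G S] by blast
qed

lemma bij_betw_div_mod:
  fixes n a :: int
  assumes "n > 0"
  shows "bij_betw (\<lambda>(k, j). k + n * j) ({a..<a + n} \<times> UNIV) UNIV"
proof (rule bij_betwI[of _ _ _ "\<lambda>x. (a + (x - a) mod n, (x - a) div n)"])
  show "(\<lambda>x. (a + (x - a) mod n, (x - a) div n)) \<in> UNIV \<rightarrow> {a..<a + n} \<times> UNIV"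
    using assms by auto
  show "(\<lambda>(k, j). k + n * j) (a + (x - a) mod n, (x - a) div n) = x" for x
    by (simp add: algebra_simps)
  fix b assume "b \<in> {a..<a + n} \<times> (UNIV :: int set)"
  moreover obtain k j where "b = (k, j)"
    by (cases b)
  ultimately have b: "b = (k, j)" "a \<le> k" "k < a + n"
    by simp_all
  have eq: "k + n * j - a = (k - a) + n * j"
    by simp
  have "(k - a) mod n = k - a" "(k - a) div n = 0"
    using b by (auto intro: mod_pos_pos_trivial div_pos_pos_trivial)
  then have "(k + n * j - a) mod n = k - a" "(k + n * j - a) div n = j"
    unfolding eq using assms by simp_all
  then show "(a + ((case b of (k, j) \<Rightarrow> k + n * j) - a) mod n, ((case b of (k, j) \<Rightarrow> k + n * j) - a) div n) = b"
    using b by simp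
qed simp

section \<open>Symmetries of the coefficients and division of Laurent series\<close>

context theta_quotient
begin

lemma eps_square: "\<epsilon> * \<epsilon> = 1"
  using eps by auto

text \<open>The map negates K and, because p2 = 2P, also a + P, so the square is unchanged. The sign
  is (-\<epsilon>)^p2, which \<open>eps_p2\<close> evaluates.\<close>

lemma hecke_row_reflect: "hecke_row (- 1 - \<kappa>) (- p2 - a) = - \<epsilon> * hecke_row \<kappa> a"
proof -
  have "(- \<epsilon>) powi (- p2 - a) = - \<epsilon> * (- \<epsilon>) powi a"
    using powi_sign_diff[OF neg_eps, of "- p2" a] powi_sign_minus[OF neg_eps, of p2] eps_p2 by simp
  moreover have "(of_int (- p2 - a) + P - (of_int (- 1 - \<kappa>) + 1 / 2) / (2 * m))\<^sup>2 = (a + P - (\<kappa> + 1 / 2) / (2 * m))\<^sup>2"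
  proof -
    have "of_int (- p2 - a) + P - (of_int (- 1 - \<kappa>) + 1 / 2) / (2 * m) = - (a + P - (\<kappa> + 1 / 2) / (2 * m))"
      using m_pos by (simp add: P field_simps)
    then show ?thesis
      by (simp only: power2_minus)
  qed
  ultimately show ?thesis
    unfolding hecke_row_def by simp
qed

text \<open>The rows between the lower limits 1 - p2 and 0, as an oriented sum: for p2 = 0 it is
  minus the row 0. Both index sets are stable under a -> -p2 - a, as \<open>row_sum_reflect\<close>
  requires.\<close>

definition row_sum :: "int \<Rightarrow> complex" where
  "row_sum \<kappa> = bracket_sum {- p2<..<0} {0..- p2} (hecke_row \<kappa>)"

lemma hecke_bracket: "hecke \<kappa> (1 - p2) = hecke \<kappa> 0 + row_sum \<kappa>"
proof (cases "p2 = 0")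
  case True
  then have "row_sum \<kappa> = - hecke_row \<kappa> 0"
    unfolding row_sum_def bracket_sum_def by simp
  then show ?thesis
    using hecke_rec[of \<kappa> 0] unfolding True by simp
next
  case False
  have sum: "hecke \<kappa> (- int n) = hecke \<kappa> 0 + (\<Sum>r\<in>{- int n..<0}. hecke_row \<kappa> r)" for n
  proof (induction n)
    case (Suc n)
    have "{- int (Suc n)..<0} = insert (- int (Suc n)) {- int n..<0}"
      by auto
    then show ?case
      using Suc hecke_rec[of \<kappa> "- int (Suc n)"] by simp
  qed simp
  have "- int (nat (p2 - 1)) = 1 - p2" "{1 - p2..<0} = {- p2<..<0}" "{0..- p2} = {}"
    using False p2 by auto
  then show ?thesis
    using sum[of "nat (p2 - 1)"] by (simp add: bracket_sum_def row_sum_def)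
qed

lemma row_sum_reflect: "row_sum (- 1 - \<kappa>) = - \<epsilon> * row_sum \<kappa>"
proof -
  have "infsum (hecke_row (- 1 - \<kappa>)) A = - \<epsilon> * infsum (hecke_row \<kappa>) A" if "\<And>r. r \<in> A \<Longrightarrow> - p2 - r \<in> A" for A
  proof -
    have "infsum (hecke_row (- 1 - \<kappa>)) A = (\<Sum>\<^sub>\<infinity>r\<in>A. - \<epsilon> * hecke_row \<kappa> r)"
      by (rule infsum_reindex_bij_witness[of _ "\<lambda>r. - p2 - r" "\<lambda>r. - p2 - r"])
        (use that hecke_row_reflect[of \<kappa> "- p2 - _"] in auto)
    then show ?thesis
      by (simp only: infsum_cmult_right')
  qed
  from this[of "{- p2<..<0}"] this[of "{0..- p2}"] show ?thesis
    unfolding row_sum_def bracket_sum_def by (simp add: algebra_simps)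
qed

text \<open>Coefficient of the whole quotient with its Gaussian factor removed. The second summand
  is the contribution of the theta with characteristic -P, expressed at the reflected index by
  \<open>hecke_gker_reflect\<close>, where the limit 1 - p2 arises.\<close>

definition quot_coeff :: "int \<Rightarrow> complex" where
  "quot_coeff \<kappa> = hecke \<kappa> 0 - \<epsilon> * hecke (- 1 - \<kappa>) (1 - p2)"

lemma quot_coeff_altdef: "quot_coeff \<kappa> = hecke \<kappa> 0 - \<epsilon> * (hecke (- 1 - \<kappa>) 0 + row_sum (- 1 - \<kappa>))"
  by (simp add: quot_coeff_def hecke_bracket)

text \<open>Written with lower limits 0, the two halves are exchanged up to the factor -\<epsilon>;
  the leftover row sums cancel by \<open>row_sum_reflect\<close>.\<close>

lemma quot_coeff_reflect: "quot_coeff (- 1 - \<kappa>) = - \<epsilon> * quot_coeff \<kappa>"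
proof -
  have "quot_coeff (- 1 - \<kappa>) + \<epsilon> * quot_coeff \<kappa>
      = (1 - \<epsilon> * \<epsilon>) * (hecke (- 1 - \<kappa>) 0) - \<epsilon> * (row_sum \<kappa> + \<epsilon> * row_sum (- 1 - \<kappa>))"
    unfolding quot_coeff_altdef by (simp add: algebra_simps)
  also have "\<epsilon> * row_sum (- 1 - \<kappa>) = - row_sum \<kappa>"
    unfolding row_sum_reflect using eps_square by (simp add: mult.assoc[symmetric])
  finally show ?thesis
    using eps_square by (simp add: add_eq_0_iff)
qed

text \<open>Neither half is periodic: the shift by 2m adds the row -1 to the first and removes the
  row 1 - p2 at the reflected index from the second. \<open>hecke_row_reflect\<close> identifies the
  two, and they cancel. Analytically, the numerator vanishes at the zeros of
  \<open>theta0\<close>.\<close>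

lemma quot_coeff_periodic: "quot_coeff (\<kappa> + (2 * M - 1)) = - \<epsilon> * quot_coeff \<kappa>"
proof -
  let ?n = "2 * M - 1"
  have "- 1 - (\<kappa> + ?n) + ?n = - 1 - \<kappa>" "2 - p2 - 1 = 1 - p2"
    by simp_all
  then have "hecke (- 1 - \<kappa>) (2 - p2) = - \<epsilon> * hecke (- 1 - (\<kappa> + ?n)) (1 - p2)"
    using hecke_periodic[of "- 1 - (\<kappa> + ?n)" "2 - p2"] by (simp only:)
  then have "hecke (- 1 - (\<kappa> + ?n)) (1 - p2) = - \<epsilon> * hecke (- 1 - \<kappa>) (2 - p2)"
    using eps_square by (simp add: mult.assoc[symmetric])
  moreover have "hecke (- 1 - \<kappa>) (1 - p2) = - \<epsilon> * hecke_row \<kappa> (-1) + hecke (- 1 - \<kappa>) (2 - p2)"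
    using hecke_rec[of "- 1 - \<kappa>" "1 - p2"] hecke_row_reflect[of \<kappa> "-1"] by simp
  moreover have "hecke \<kappa> (-1) = hecke_row \<kappa> (-1) + hecke \<kappa> 0"
    using hecke_rec[of \<kappa> "-1"] by simp
  ultimately have "quot_coeff (\<kappa> + ?n) = - \<epsilon> * (hecke_row \<kappa> (-1) + hecke \<kappa> 0
      - \<epsilon> * (hecke (- 1 - \<kappa>) (1 - p2) + \<epsilon> * hecke_row \<kappa> (-1)))"
    unfolding quot_coeff_def using hecke_periodic[of \<kappa> 0] by (simp add: algebra_simps)
  also have "\<dots> = - \<epsilon> * (quot_coeff \<kappa> + (1 - \<epsilon> * \<epsilon>) * hecke_row \<kappa> (-1))"
    unfolding quot_coeff_def by (simp add: algebra_simps)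
  finally show ?thesis
    using eps_square by simp
qed

lemma quot_coeff_periodic_powi: "quot_coeff (\<kappa> + (2 * M - 1) * j) = (- \<epsilon>) powi j * quot_coeff \<kappa>"
proof (induction j rule: int_induct[of _ 0])
  case (step1 j)
  have "\<kappa> + (2 * M - 1) * (j + 1) = \<kappa> + (2 * M - 1) * j + (2 * M - 1)"
    by (simp add: algebra_simps)
  then show ?case
    unfolding powi_sign_add[OF neg_eps] by (simp only: quot_coeff_periodic step1) (simp add: mult_ac)
next
  case (step2 j)
  have "\<kappa> + (2 * M - 1) * j = \<kappa> + (2 * M - 1) * (j - 1) + (2 * M - 1)"
    by (simp add: algebra_simps)
  then have "(- \<epsilon>) powi j * quot_coeff \<kappa> = - \<epsilon> * quot_coeff (\<kappa> + (2 * M - 1) * (j - 1))"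
    using step2 quot_coeff_periodic by metis
  then have "\<epsilon> * ((- \<epsilon>) powi j * quot_coeff \<kappa>) = - (\<epsilon> * \<epsilon>) * quot_coeff (\<kappa> + (2 * M - 1) * (j - 1))"
    by simp
  then show ?case
    unfolding powi_sign_diff[OF neg_eps] by (simp add: eps_square mult_ac)
qed simp

text \<open>Periodicity up to sign reduces the norm to one period, and the sum over a period bounds
  each member.\<close>

lemma quot_coeff_bounded: obtains B where "\<And>\<kappa>. norm (quot_coeff \<kappa>) \<le> B"
proof -
  have n: "2 * M - 1 > 0"
    using M by simp
  have "norm (quot_coeff \<kappa>) \<le> (\<Sum>k\<in>{0..<2 * M - 1}. norm (quot_coeff k))" for \<kappa>
  proof -
    have "quot_coeff \<kappa> = (- \<epsilon>) powi (\<kappa> div (2 * M - 1)) * quot_coeff (\<kappa> mod (2 * M - 1))"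
      by (simp flip: quot_coeff_periodic_powi)
    then have "norm (quot_coeff \<kappa>) = norm (quot_coeff (\<kappa> mod (2 * M - 1)))"
      by (simp add: norm_mult norm_powi_sign[OF neg_eps])
    also have "\<dots> \<le> (\<Sum>k\<in>{0..<2 * M - 1}. norm (quot_coeff k))"
      by (rule member_le_sum) (use n in auto)
    finally show ?thesis .
  qed
  then show ?thesis
    by (rule that)
qed

text \<open>Coefficient of -\<eta>^3 / \<open>theta0\<close> at the exponent s + 1/2 - P, valid in
  an annulus. As only convolutions with decaying sequences occur, the annulus never has to be
  named.\<close>

definition gker :: "int \<Rightarrow> complex" where
  "gker s = qpow \<tau> (P * (s + 1 / 2) - P\<^sup>2 / 2) * ptheta \<tau> 0 s"

text \<open>For fixed l the sum over s is the theta convolution with L = k - i l, hence a delta. The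
  sums may be exchanged because, apart from a bounded partial theta, l enters only through
  \<open>c l\<close> and the power q^(-P i l) of \<open>gker\<close>, which is the
  assumption.\<close>

lemma laurent_division:
  fixes c :: "int \<Rightarrow> complex" and i :: "int \<Rightarrow> int" and k :: int
  defines "t \<equiv> \<lambda>s::int. (-1) powi s * qpow \<tau> ((s + P + 1 / 2)\<^sup>2 / 2)"
  assumes "(\<lambda>l. c l * qpow \<tau> (- P * i l)) summable_on UNIV"
  shows "((\<lambda>s. t s * (\<Sum>\<^sub>\<infinity>l. c l * gker (k - s - i l))) has_sum
    (- (dedekind_eta \<tau> ^ 3) * (\<Sum>\<^sub>\<infinity>l. if i l = k + 1 then c l else 0))) UNIV"
proof -
  let ?\<eta> = "- (dedekind_eta \<tau> ^ 3)"
  define d where "d l = c l * qpow \<tau> (- P * i l)" for l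
  define Q where "Q = qpow \<tau> (P * (k + 1)) * qpow \<tau> (1 / 8)"
  define F where "F = (\<lambda>(l, s). d l * pterm \<tau> 0 s * ptheta \<tau> 0 (k - i l - s))"
  have term_eq: "t s * (c l * gker (k - s - i l)) = Q * F (l, s)" for s l
  proof -
    have comm: "k - s - i l = k - i l - s"
      by simp
    have exps: "qpow \<tau> ((s + P + 1 / 2)\<^sup>2 / 2) * qpow \<tau> (P * (of_int (k - s - i l) + 1 / 2) - P\<^sup>2 / 2)
        = qpow \<tau> (- P * i l) * Q * qpow \<tau> (of_int s * (of_int s + 1) / 2 + of_int s * of_int 0)"
      unfolding Q_def qpow_add[symmetric]
      by (rule arg_cong[of _ _ "qpow \<tau>"]) (simp add: power2_eq_square field_simps)
    have "t s * (c l * gker (k - s - i l)) = (-1) powi s * c l * ptheta \<tau> 0 (k - i l - s)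
        * (qpow \<tau> ((s + P + 1 / 2)\<^sup>2 / 2) * qpow \<tau> (P * (of_int (k - s - i l) + 1 / 2) - P\<^sup>2 / 2))"
      unfolding t_def gker_def comm by (simp only: mult_ac)
    also have "\<dots> = Q * F (l, s)"
      unfolding exps unfolding F_def d_def pterm_def prod.case by (simp only: mult_ac)
    finally show ?thesis .
  qed
  obtain C where C: "\<And>s. norm (ptheta \<tau> 0 s) \<le> C"
    using ptheta_0_bounded[OF tau] by blast
  have "(\<lambda>x. (case x of (l, s) \<Rightarrow> d l * pterm \<tau> 0 s) * (case x of (l, s) \<Rightarrow> ptheta \<tau> 0 (k - i l - s))) summable_on UNIV \<times> UNIV"
  proof (intro summable_mult_bounded)
    show "(\<lambda>(l, s). d l * pterm \<tau> 0 s) summable_on UNIV \<times> UNIV"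
      using assms(2) unfolding d_def by (intro summable_times summable_pterm[OF tau])
    show "norm (case x of (l, s) \<Rightarrow> ptheta \<tau> 0 (k - i l - s)) \<le> C" for x
      by (cases x) (simp add: C)
  qed
  then have F: "F summable_on UNIV \<times> UNIV"
    by (simp only: F_def case_prod_unfold)
  then have F': "(\<lambda>(s, l). F (l, s)) summable_on UNIV \<times> UNIV"
    by (subst (asm) summable_on_swap)
  have "(\<lambda>s. \<Sum>\<^sub>\<infinity>l. F (l, s)) summable_on UNIV"
    using summable_on_Sigma_banach[of "\<lambda>s l. F (l, s)"] F' by simp
  then have "((\<lambda>s. Q * (\<Sum>\<^sub>\<infinity>l. F (l, s))) has_sum (Q * (\<Sum>\<^sub>\<infinity>s. \<Sum>\<^sub>\<infinity>l. F (l, s)))) UNIV"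
    by (rule has_sum_cmult_right[OF has_sum_infsum])
  also have "(\<Sum>\<^sub>\<infinity>s. \<Sum>\<^sub>\<infinity>l. F (l, s)) = (\<Sum>\<^sub>\<infinity>l. \<Sum>\<^sub>\<infinity>s. F (l, s))"
    by (rule infsum_swap_banach) (use F' in simp)
  also have "Q * \<dots> = (\<Sum>\<^sub>\<infinity>l. Q * (\<Sum>\<^sub>\<infinity>s. F (l, s)))"
    by (simp only: infsum_cmult_right')
  also have "\<dots> = (\<Sum>\<^sub>\<infinity>l. ?\<eta> * (if i l = k + 1 then c l else 0))"
  proof (rule infsum_cong)
    fix l
    have "Q * (\<Sum>\<^sub>\<infinity>s. F (l, s)) = qpow \<tau> (P * (k + 1)) * d l * (qpow \<tau> (1 / 8) * (\<Sum>\<^sub>\<infinity>s. pterm \<tau> 0 s * ptheta \<tau> 0 (k - i l - s)))"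
      unfolding F_def Q_def by (simp add: mult.assoc infsum_cmult_right')
    also have "\<dots> = qpow \<tau> (P * (k + 1)) * d l * (if k - i l = -1 then ?\<eta> else 0)"
      by (simp only: pterm_ptheta_convolution_eta[OF tau])
    also have "\<dots> = ?\<eta> * (if i l = k + 1 then c l else 0)"
    proof (cases "i l = k + 1")
      case True
      then show ?thesis
        by (simp add: d_def qpow_minus)
    qed auto
    finally show "Q * (\<Sum>\<^sub>\<infinity>s. F (l, s)) = ?\<eta> * (if i l = k + 1 then c l else 0)" .
  qed
  also have "\<dots> = ?\<eta> * (\<Sum>\<^sub>\<infinity>l. if i l = k + 1 then c l else 0)"
    by (simp only: infsum_cmult_right')
  finally show ?thesis
    by (simp only: term_eq flip: infsum_cmult_right')
qed

text \<open>The theta function of index 1/2, written with exponents in P + 1/2 + Z: multiplied by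
  the half-odd exponents of the quotient they give the exponents P + Z of the numerator.
  \<open>theta0_theta\<close> brings it to standard form.\<close>

definition theta0 :: "complex \<Rightarrow> complex" where
  "theta0 w = (\<Sum>\<^sub>\<infinity>s::int. (-1) powi s * xpow w (s + P + 1 / 2) * qpow \<tau> ((s + P + 1 / 2)\<^sup>2 / 2))"

definition numer_plus :: "int \<Rightarrow> complex" where
  "numer_plus l = \<epsilon> powi l * qpow \<tau> ((2 * of_int M * of_int l + P)\<^sup>2 / (4 * of_int M))"

text \<open>The sign is the one with which the numerator vanishes at the zeros of
  \<open>theta0\<close>; in \<open>hecke_gker_reflect\<close> it arises from (-1)^(1 - p2). Since
  2Ml - P = (2Ml - p2) + P, the exponents lie in P + Z as for \<open>numer_plus\<close>.\<close>

definition numer_minus :: "int \<Rightarrow> complex" where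
  "numer_minus l = \<epsilon> * (-1) powi p2 * (\<epsilon> powi l * qpow \<tau> ((2 * of_int M * of_int l + - P)\<^sup>2 / (4 * of_int M)))"

lemma numerator_exponent:
  "(2 * of_int M * of_int l + x)\<^sup>2 / (4 * of_int M) = of_int M * (of_int l)\<^sup>2 + x * of_int l + x\<^sup>2 / (4 * of_int M)"
  for x :: real
  using M_pos by (simp add: field_simps power2_eq_square)

lemma summable_numerator:
  "(\<lambda>l. \<epsilon> powi l * qpow \<tau> ((2 * of_int M * of_int l + x)\<^sup>2 / (4 * of_int M)) * qpow \<tau> (- P * of_int (2 * M * l - k))) summable_on UNIV"
  for x :: real
proof -
  have "(\<lambda>l. \<epsilon> powi l * xpow 0 (0 * of_int l + 0) * qpow \<tau> (of_int M * (of_int l)\<^sup>2 + (x - 2 * of_int M * P) * of_int l + (x\<^sup>2 / (4 * of_int M) + P * of_int k))) summable_on UNIV"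
    by (rule summable_theta_like[where D = 1]) (use tau M_pos norm_powi_sign[OF eps] in auto)
  then have "(\<lambda>l. \<epsilon> powi l * qpow \<tau> (of_int M * (of_int l)\<^sup>2 + (x - 2 * of_int M * P) * of_int l + (x\<^sup>2 / (4 * of_int M) + P * of_int k))) summable_on UNIV"
    by (simp add: xpow_def)
  moreover have "(2 * of_int M * of_int l + x)\<^sup>2 / (4 * of_int M) + (- P * of_int (2 * M * l - k))
      = of_int M * (of_int l)\<^sup>2 + (x - 2 * of_int M * P) * of_int l + (x\<^sup>2 / (4 * of_int M) + P * of_int k)" for l
    unfolding numerator_exponent by (simp add: algebra_simps)
  ultimately show ?thesis
    unfolding mult.assoc qpow_add[symmetric] by (simp only: mult.assoc)
qed

lemma summable_numer_plus: "(\<lambda>l. numer_plus l * qpow \<tau> (- P * of_int (2 * M * l))) summable_on UNIV"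
  using summable_numerator[of P 0] by (simp only: numer_plus_def diff_0_right)

lemma summable_numer_minus: "(\<lambda>l. numer_minus l * qpow \<tau> (- P * of_int (2 * M * l - p2))) summable_on UNIV"
  using summable_on_cmult_right[OF summable_numerator[of "- P" p2], of "\<epsilon> * (-1) powi p2"]
  by (simp only: numer_minus_def mult.assoc)

lemma has_sum_numer_plus: "((\<lambda>l. numer_plus l * xpow w (of_int (2 * M * l) + P)) has_sum theta \<epsilon> P M \<tau> w) UNIV"
proof -
  have "((\<lambda>n. \<epsilon> powi n * xpow w (2 * of_int M * of_int n + P) * qpow \<tau> ((2 * of_int M * of_int n + P)\<^sup>2 / (4 * of_int M))) has_sum theta \<epsilon> P M \<tau> w) UNIV"
    unfolding theta_altdef[OF M_pos] by (rule has_sum_infsum, rule theta_summand_summable[OF tau M_pos eps])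
  then show ?thesis
    by (simp add: numer_plus_def mult_ac)
qed

lemma has_sum_numer_minus: "((\<lambda>l. numer_minus l * xpow w (of_int (2 * M * l - p2) + P)) has_sum (\<epsilon> * (-1) powi p2 * theta \<epsilon> (- P) M \<tau> w)) UNIV"
proof -
  have "((\<lambda>n. \<epsilon> * (-1) powi p2 * (\<epsilon> powi n * xpow w (2 * of_int M * of_int n + - P) * qpow \<tau> ((2 * of_int M * of_int n + - P)\<^sup>2 / (4 * of_int M)))) has_sum (\<epsilon> * (-1) powi p2 * theta \<epsilon> (- P) M \<tau> w)) UNIV"
    unfolding theta_altdef[OF M_pos] by (rule has_sum_cmult_right[OF has_sum_infsum[OF theta_summand_summable[OF tau M_pos eps]]])
  moreover have "of_int (2 * M * l - p2) + P = 2 * of_int M * of_int l + - P" for l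
    by (simp add: P)
  ultimately show ?thesis
    by (simp only: numer_minus_def mult_ac)
qed

lemma hecke_gker: "qpow \<tau> ((\<kappa> + 1 / 2)\<^sup>2 / (4 * m)) * hecke \<kappa> 0 = (\<Sum>\<^sub>\<infinity>l. numer_plus l * gker (\<kappa> - 2 * M * l))"
proof -
  let ?q = "qpow \<tau> ((\<kappa> + 1 / 2)\<^sup>2 / (4 * m))"
  have "?q * qpow \<tau> (expo \<kappa> l)
    = qpow \<tau> ((2 * of_int M * of_int l + P)\<^sup>2 / (4 * of_int M)) * qpow \<tau> (P * (of_int (\<kappa> - 2 * M * l) + 1 / 2) - P\<^sup>2 / 2)" for l
  proof -
    have "of_int M * (of_int l + P / (2 * of_int M))\<^sup>2 = (2 * of_int M * of_int l + P)\<^sup>2 / (4 * of_int M)"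
      using M_pos by (simp add: field_simps power2_eq_square)
    then show ?thesis
      unfolding qpow_add[symmetric] expo_def by simp
  qed
  then have "?q * (\<epsilon> powi l * qpow \<tau> (expo \<kappa> l) * ptheta \<tau> 0 (\<kappa> - 2 * M * l))
    = numer_plus l * gker (\<kappa> - 2 * M * l)" for l
    by (simp add: numer_plus_def gker_def)
  then show ?thesis
    unfolding hecke_def by (simp flip: infsum_cmult_right')
qed

text \<open>Translating the lower limit 1 - p2 to 0 changes the parameter of the partial theta to
  the negative of \<kappa> - (2Ml - p2), and \<open>ptheta_0_reflect\<close> removes that minus
  sign. The limit 1 - p2 is made for this.\<close>

lemma hecke_gker_reflect:
  "qpow \<tau> ((\<kappa> + 1 / 2)\<^sup>2 / (4 * m)) * (- \<epsilon> * hecke (- 1 - \<kappa>) (1 - p2)) = (\<Sum>\<^sub>\<infinity>l. numer_minus l * gker (\<kappa> - (2 * M * l - p2)))"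
proof -
  let ?q = "qpow \<tau> ((\<kappa> + 1 / 2)\<^sup>2 / (4 * m))"
  have step: "?q * (- \<epsilon>) * (\<epsilon> powi (- l) * qpow \<tau> (expo (- 1 - \<kappa>) (- l)) * ptheta \<tau> (1 - p2) (- 1 - \<kappa> - 2 * M * (- l)))
    = numer_minus l * gker (\<kappa> - (2 * M * l - p2))" for l
  proof -
    define s where "s = - 1 - \<kappa> - 2 * M * (- l)"
    define \<sigma> where "\<sigma> = \<kappa> - (2 * M * l - p2)"
    have "s + (1 - p2) = - \<sigma>"
      by (simp add: s_def \<sigma>_def)
    then have pt: "ptheta \<tau> (1 - p2) s = pterm \<tau> s (1 - p2) * (qpow \<tau> \<sigma> * ptheta \<tau> 0 \<sigma>)"
      using ptheta_translate[OF tau, of "1 - p2" s] ptheta_0_reflect[OF tau, of "- \<sigma>"] by simp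
    have sign: "- \<epsilon> * (-1) powi (1 - p2) = \<epsilon> * (-1) powi p2"
      by (simp add: power_int_diff power_int_minus_left)
    have e: "of_int M * (of_int (- l) + P / (2 * of_int M))\<^sup>2 = (2 * of_int M * of_int l + - P)\<^sup>2 / (4 * of_int M)"
      using M_pos by (simp add: field_simps power2_eq_square)
    have K: "(of_int (- 1 - \<kappa>) + 1 / 2)\<^sup>2 / (4 * m) = (\<kappa> + 1 / 2)\<^sup>2 / (4 * m)"
      by (simp add: power2_eq_square algebra_simps)
    have "(\<kappa> + 1 / 2)\<^sup>2 / (4 * m) + (expo (- 1 - \<kappa>) (- l) + (of_int (1 - p2) * (of_int (1 - p2) + 1) / 2 + of_int (1 - p2) * of_int s + \<sigma>))
      = (2 * of_int M * of_int l + - P)\<^sup>2 / (4 * of_int M) + (P * (of_int \<sigma> + 1 / 2) - P\<^sup>2 / 2)"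
      unfolding expo_def e K by (simp add: s_def \<sigma>_def P power2_eq_square field_simps)
    then have "?q * (qpow \<tau> (expo (- 1 - \<kappa>) (- l)) * (qpow \<tau> (of_int (1 - p2) * (of_int (1 - p2) + 1) / 2 + of_int (1 - p2) * of_int s) * qpow \<tau> \<sigma>))
      = qpow \<tau> ((2 * of_int M * of_int l + - P)\<^sup>2 / (4 * of_int M)) * qpow \<tau> (P * (of_int \<sigma> + 1 / 2) - P\<^sup>2 / 2)"
      by (simp only: flip: qpow_add)
    note exps = this
    have "?q * (- \<epsilon>) * (\<epsilon> powi (- l) * qpow \<tau> (expo (- 1 - \<kappa>) (- l)) * ptheta \<tau> (1 - p2) s)
      = (- \<epsilon> * (-1) powi (1 - p2)) * \<epsilon> powi (- l) * ptheta \<tau> 0 \<sigma> * (?q * (qpow \<tau> (expo (- 1 - \<kappa>) (- l)) * (qpow \<tau> (of_int (1 - p2) * (of_int (1 - p2) + 1) / 2 + of_int (1 - p2) * of_int s) * qpow \<tau> \<sigma>)))"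
      unfolding pt pterm_def by (simp only: mult_ac)
    also have "\<dots> = numer_minus l * gker \<sigma>"
      unfolding exps sign powi_sign_minus[OF eps] numer_minus_def gker_def by (simp only: mult_ac)
    finally show ?thesis
      by (simp only: s_def \<sigma>_def)
  qed
  have "hecke (- 1 - \<kappa>) (1 - p2) = (\<Sum>\<^sub>\<infinity>l. \<epsilon> powi (- l) * qpow \<tau> (expo (- 1 - \<kappa>) (- l)) * ptheta \<tau> (1 - p2) (- 1 - \<kappa> - 2 * M * (- l)))"
    unfolding hecke_def by (rule infsum_reindex_bij_witness[of _ uminus uminus]) auto
  then have "?q * (- \<epsilon> * hecke (- 1 - \<kappa>) (1 - p2))
    = ?q * (- \<epsilon>)
      * (\<Sum>\<^sub>\<infinity>l. \<epsilon> powi (- l) * qpow \<tau> (expo (- 1 - \<kappa>) (- l)) * ptheta \<tau> (1 - p2) (- 1 - \<kappa> - 2 * M * (- l)))"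
    by (simp only: mult.assoc)
  then show ?thesis
    by (simp only: step flip: infsum_cmult_right')
qed

lemma theta0_summand_summable: "(\<lambda>s::int. (-1) powi s * xpow w (s + P + 1 / 2) * qpow \<tau> ((s + P + 1 / 2)\<^sup>2 / 2)) summable_on UNIV"
proof -
  have "(\<lambda>s. (-1) powi s * xpow w (1 * of_int s + (P + 1 / 2)) * qpow \<tau> (1 / 2 * (of_int s)\<^sup>2 + (P + 1 / 2) * of_int s + (P + 1 / 2)\<^sup>2 / 2)) summable_on UNIV"
    by (rule summable_theta_like[where D = 1]) (use tau in \<open>auto simp: norm_power_int\<close>)
  moreover have "1 / 2 * (of_int s)\<^sup>2 + (P + 1 / 2) * of_int s + (P + 1 / 2)\<^sup>2 / 2 = (s + P + 1 / 2)\<^sup>2 / 2" for s :: int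
    by (simp add: power2_eq_square field_simps)
  moreover have "1 * of_int s + (P + 1 / 2) = s + P + 1 / 2" for s :: int
    by simp
  ultimately show ?thesis
    by (simp only:)
qed

definition quot_term :: "complex \<Rightarrow> int \<Rightarrow> complex" where
  "quot_term w \<kappa> = qpow \<tau> ((\<kappa> + 1 / 2)\<^sup>2 / (4 * m)) * quot_coeff \<kappa> * xpow w (\<kappa> + 1 / 2)"

text \<open>A bounded coefficient times the Gaussian q^(K^2/(4m)); this is the point where
  periodicity yields convergence for every w.\<close>

lemma quot_term_summable: "quot_term w summable_on UNIV"
proof -
  obtain B where B: "\<And>\<kappa>. norm (quot_coeff \<kappa>) \<le> B"
    using quot_coeff_bounded by blast
  have "(\<lambda>\<kappa>. quot_coeff \<kappa> * xpow w (1 * of_int \<kappa> + 1 / 2) * qpow \<tau> (1 / (4 * m) * (of_int \<kappa>)\<^sup>2 + 1 / (4 * m) * of_int \<kappa> + 1 / (16 * m))) summable_on UNIV"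
    by (rule summable_theta_like[where D = B]) (use tau m_pos B in auto)
  moreover have "1 / (4 * m) * (of_int \<kappa>)\<^sup>2 + 1 / (4 * m) * of_int \<kappa> + 1 / (16 * m) = (\<kappa> + 1 / 2)\<^sup>2 / (4 * m)" for \<kappa> :: int
    using m_pos by (simp add: power2_eq_square field_simps)
  ultimately show ?thesis
    unfolding quot_term_def by (simp add: mult_ac)
qed

text \<open>Grouping the product by the exponent k + 1 + P leaves deltas at k + 1 = 2Ml and k + 1 =
  2Ml - p2, which resum to the two numerator thetas.\<close>

lemma theta0_quotient_series:
  "theta0 w * infsum (quot_term w) UNIV
    = - (dedekind_eta \<tau> ^ 3) * (theta \<epsilon> P M \<tau> w + \<epsilon> * (-1) powi p2 * theta \<epsilon> (- P) M \<tau> w)"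
proof -
  let ?\<eta> = "- (dedekind_eta \<tau> ^ 3)"
  define t where "t s = (-1) powi s * qpow \<tau> ((s + P + 1 / 2)\<^sup>2 / 2)" for s :: int
  let ?d = "\<lambda>c i k. \<Sum>\<^sub>\<infinity>l. if i l = k + 1 then c l else (0 :: complex)"
  let ?i1 = "\<lambda>l. 2 * M * l" and ?i2 = "\<lambda>l. 2 * M * l - p2"
  have quot_coeff: "qpow \<tau> ((\<kappa> + 1 / 2)\<^sup>2 / (4 * m)) * quot_coeff \<kappa>
      = (\<Sum>\<^sub>\<infinity>l. numer_plus l * gker (\<kappa> - ?i1 l)) + (\<Sum>\<^sub>\<infinity>l. numer_minus l * gker (\<kappa> - ?i2 l))" for \<kappa>
    unfolding hecke_gker[symmetric] hecke_gker_reflect[symmetric] quot_coeff_def by (simp add: algebra_simps)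
  have conv: "(\<Sum>\<^sub>\<infinity>s. t s * (qpow \<tau> ((of_int (k - s) + 1 / 2)\<^sup>2 / (4 * m)) * quot_coeff (k - s)))
      = ?\<eta> * ?d numer_plus ?i1 k + ?\<eta> * ?d numer_minus ?i2 k" for k
    unfolding quot_coeff distrib_left t_def
    by (rule infsumI, rule has_sum_add; rule laurent_division) (rule summable_numer_plus summable_numer_minus)+
  have "theta0 w * infsum (quot_term w) UNIV
    = (\<Sum>\<^sub>\<infinity>k. \<Sum>\<^sub>\<infinity>s. (-1) powi s * xpow w (s + P + 1 / 2) * qpow \<tau> ((s + P + 1 / 2)\<^sup>2 / 2) * quot_term w (k - s))"
    unfolding theta0_def by (rule infsum_laurent_product[OF theta0_summand_summable quot_term_summable])
  also have "\<dots> = (\<Sum>\<^sub>\<infinity>k. ?\<eta> * (xpow w (of_int (k + 1) + P) * ?d numer_plus ?i1 k + xpow w (of_int (k + 1) + P) * ?d numer_minus ?i2 k))"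
  proof (rule infsum_cong)
    fix k
    have "(-1) powi s * xpow w (s + P + 1 / 2) * qpow \<tau> ((s + P + 1 / 2)\<^sup>2 / 2) * quot_term w (k - s)
      = xpow w (of_int (k + 1) + P) * (t s * (qpow \<tau> ((of_int (k - s) + 1 / 2)\<^sup>2 / (4 * m)) * quot_coeff (k - s)))" for s
    proof -
      have "xpow w (of_int (k + 1) + P) = xpow w (s + P + 1 / 2) * xpow w (of_int (k - s) + 1 / 2)"
        unfolding xpow_add[symmetric] by (rule arg_cong[of _ _ "xpow w"]) simp
      then show ?thesis
        unfolding quot_term_def t_def by (simp only: mult_ac)
    qed
    then have "(\<Sum>\<^sub>\<infinity>s. (-1) powi s * xpow w (s + P + 1 / 2) * qpow \<tau> ((s + P + 1 / 2)\<^sup>2 / 2) * quot_term w (k - s))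
      = xpow w (of_int (k + 1) + P) * (\<Sum>\<^sub>\<infinity>s. t s * (qpow \<tau> ((of_int (k - s) + 1 / 2)\<^sup>2 / (4 * m)) * quot_coeff (k - s)))"
      by (simp only: infsum_cmult_right')
    then show "(\<Sum>\<^sub>\<infinity>s. (-1) powi s * xpow w (s + P + 1 / 2) * qpow \<tau> ((s + P + 1 / 2)\<^sup>2 / 2) * quot_term w (k - s))
      = ?\<eta> * (xpow w (of_int (k + 1) + P) * ?d numer_plus ?i1 k + xpow w (of_int (k + 1) + P) * ?d numer_minus ?i2 k)"
      unfolding conv by (simp only: algebra_simps)
  qed
  also have "\<dots> = ?\<eta> * (\<Sum>\<^sub>\<infinity>k. xpow w (of_int (k + 1) + P) * ?d numer_plus ?i1 k + xpow w (of_int (k + 1) + P) * ?d numer_minus ?i2 k)"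
    by (simp only: infsum_cmult_right')
  also have "(\<Sum>\<^sub>\<infinity>k. xpow w (of_int (k + 1) + P) * ?d numer_plus ?i1 k + xpow w (of_int (k + 1) + P) * ?d numer_minus ?i2 k)
    = theta \<epsilon> P M \<tau> w + \<epsilon> * (-1) powi p2 * theta \<epsilon> (- P) M \<tau> w"
  proof (rule infsumI, rule has_sum_add)
    have "inj ?i1" "inj ?i2"
      using M by (auto simp: inj_def)
    then show "((\<lambda>k. xpow w (of_int (k + 1) + P) * ?d numer_plus ?i1 k) has_sum theta \<epsilon> P M \<tau> w) UNIV"
      "((\<lambda>k. xpow w (of_int (k + 1) + P) * ?d numer_minus ?i2 k) has_sum \<epsilon> * (-1) powi p2 * theta \<epsilon> (- P) M \<tau> w) UNIV"
      using infsum_delta_reindex[of ?i1 numer_plus "\<lambda>x. xpow w (of_int x + P)"] has_sum_numer_plus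
        infsum_delta_reindex[of ?i2 numer_minus "\<lambda>x. xpow w (of_int x + P)"] has_sum_numer_minus by blast+
  qed
  finally show ?thesis .
qed

text \<open>Residues modulo 2m are represented by K = 1 - m, ..., m. There K and -K pair up by
  reflection, and K = m stays alone.\<close>

lemma quot_term_sum:
  "infsum (quot_term w) UNIV = (\<Sum>k\<in>{0..<M - 1}. quot_coeff k *
      (theta (- \<epsilon>) (k + 1 / 2) m \<tau> w - \<epsilon> * theta (- \<epsilon>) (- (k + 1 / 2)) m \<tau> w))
    + quot_coeff (M - 1) * theta (- \<epsilon>) m m \<tau> w"
proof -
  let ?n = "2 * M - 1"
  let ?F = "\<lambda>k::int. quot_coeff k * theta (- \<epsilon>) (k + 1 / 2) m \<tau> w"
  have n: "?n > 0" "real_of_int ?n = 2 * m"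
    using M by (simp_all add: m)
  have bij: "bij_betw (\<lambda>(k, j). k + ?n * j) ({1 - M..<1 - M + ?n} \<times> UNIV) UNIV"
    by (rule bij_betw_div_mod[OF n(1)])
  have "infsum (quot_term w) UNIV = (\<Sum>\<^sub>\<infinity>(k, j)\<in>{1 - M..<1 - M + ?n} \<times> UNIV. quot_term w (k + ?n * j))"
    using infsum_reindex_bij_betw[OF bij, of "quot_term w"] by (simp add: case_prod_unfold)
  also have "\<dots> = (\<Sum>\<^sub>\<infinity>k\<in>{1 - M..<1 - M + ?n}. \<Sum>\<^sub>\<infinity>j. quot_term w (k + ?n * j))"
    using summable_on_reindex_bij_betw[OF bij, of "quot_term w"] quot_term_summable[of w]
    by (intro infsum_Sigma'_banach[symmetric]) (simp add: case_prod_unfold)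
  also have "\<dots> = (\<Sum>k\<in>{1 - M..<1 - M + ?n}. ?F k)"
  proof (subst infsum_finite, simp, rule sum.cong)
    fix k
    have "quot_term w (k + ?n * j) = quot_coeff k * ((- \<epsilon>) powi j * xpow w (2 * m * of_int j + (k + 1 / 2)) * qpow \<tau> ((2 * m * of_int j + (k + 1 / 2))\<^sup>2 / (4 * m)))" for j
    proof -
      have "real_of_int (k + ?n * j) + 1 / 2 = 2 * m * of_int j + (k + 1 / 2)"
        using n(2) by (simp only: of_int_add of_int_mult)
      then show ?thesis
        unfolding quot_term_def quot_coeff_periodic_powi by (simp only: mult_ac)
    qed
    then show "(\<Sum>\<^sub>\<infinity>j. quot_term w (k + ?n * j)) = ?F k"
      by (simp only: theta_altdef[OF m_pos] infsum_cmult_right')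
  qed simp
  also have "\<dots> = sum ?F {0..<M - 1} + sum ?F {1 - M..<0} + ?F (M - 1)"
  proof -
    have "{1 - M..<1 - M + ?n} = insert (M - 1) ({0..<M - 1} \<union> {1 - M..<0})"
      using M by auto
    then show ?thesis
      by (simp add: sum.union_disjoint ivl_disj_int)
  qed
  also have "sum ?F {1 - M..<0} = (\<Sum>k\<in>{0..<M - 1}. ?F (- 1 - k))"
    by (rule sum.reindex_bij_witness[of _ "\<lambda>k. - 1 - k" "\<lambda>k. - 1 - k"]) auto
  also have "\<dots> = (\<Sum>k\<in>{0..<M - 1}. - \<epsilon> * quot_coeff k * theta (- \<epsilon>) (- (k + 1 / 2)) m \<tau> w)"
  proof (rule sum.cong)
    fix k :: int
    have "real_of_int (- 1 - k) + 1 / 2 = - (k + 1 / 2)"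
      by simp
    then show "?F (- 1 - k) = - \<epsilon> * quot_coeff k * theta (- \<epsilon>) (- (k + 1 / 2)) m \<tau> w"
      by (simp only: quot_coeff_reflect)
  qed simp
  also have "?F (M - 1) = quot_coeff (M - 1) * theta (- \<epsilon>) m m \<tau> w"
    by (simp add: m)
  finally show ?thesis
    by (simp add: algebra_simps flip: sum.distrib sum_subtractf)
qed

theorem theta0_quotient:
  "theta0 w * ((\<Sum>k\<in>{0..<M - 1}. quot_coeff k *
      (theta (- \<epsilon>) (k + 1 / 2) m \<tau> w - \<epsilon> * theta (- \<epsilon>) (- (k + 1 / 2)) m \<tau> w))
    + quot_coeff (M - 1) * theta (- \<epsilon>) m m \<tau> w)
    = - (dedekind_eta \<tau> ^ 3) * (theta \<epsilon> P M \<tau> w + \<epsilon> * (-1) powi p2 * theta \<epsilon> (- P) M \<tau> w)"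
  using theta0_quotient_series[of w] by (simp only: quot_term_sum)

end

section \<open>Double sums over cones\<close>

lemma summable_comparison_complex:
  fixes f g :: "'a \<Rightarrow> complex"
  assumes "g summable_on A" "\<And>x. x \<in> A \<Longrightarrow> norm (f x) \<le> norm (g x)"
  shows "f summable_on A"
  using assms Infinite_Sum.abs_summable_on_comparison_test[of g A f]
  by (simp only: summable_on_iff_abs_summable_on_complex[of f] summable_on_iff_abs_summable_on_complex[of g])

context theta_quotient
begin

text \<open>The summand of \<open>hecke\<close> in the coordinates j = r - l and r, in which its
  quadratic form is diagonal.\<close>

definition hecke_term :: "real \<Rightarrow> int \<Rightarrow> int \<Rightarrow> complex" where
  "hecke_term K j r = \<epsilon> powi j * (- \<epsilon>) powi r
    * qpow \<tau> (of_int M * (of_int j + 2 * m * P / (2 * of_int M))\<^sup>2 - m * (r + P - K / (2 * m))\<^sup>2)"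

lemma hecke_term_eq:
  "\<epsilon> powi l * qpow \<tau> (expo \<kappa> l) * pterm \<tau> (\<kappa> - 2 * M * l) r = hecke_term (\<kappa> + 1 / 2) (r - l) r"
  unfolding hecke_term_pterm hecke_term_def
  by (simp only: qpow_add diff_conv_add_uminus mult_minus_left mult_ac)

text \<open>The only coupling of l and r in the exponent is -2Mlr. Where (l + c) r \<le> 0 it is at
  least 2Mcr, so a product of two one-variable series is a majorant.\<close>

lemma summable_quadrant:
  assumes "\<And>l r. l \<in> A \<Longrightarrow> r \<in> B \<Longrightarrow> (l + c) * r \<le> 0"
  shows "(\<lambda>(l, r). \<epsilon> powi l * qpow \<tau> (expo \<kappa> l) * pterm \<tau> (\<kappa> - 2 * M * l) r) summable_on A \<times> B"
proof (rule summable_comparison_complex)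
  have "(\<lambda>l. \<epsilon> powi l * qpow \<tau> (expo \<kappa> l)) summable_on A"
    using summable_row[of \<kappa> 0] by (simp add: pterm_def)
  moreover have "(\<lambda>r. 1 * xpow 0 (0 * of_int r + 0) * qpow \<tau> (1 / 2 * (of_int r)\<^sup>2 + (\<kappa> + 1 / 2 + 2 * M * c) * of_int r + 0)) summable_on B"
    by (rule summable_theta_like[where D = 1]) (use tau in auto)
  ultimately show "(\<lambda>(l, r). (\<epsilon> powi l * qpow \<tau> (expo \<kappa> l)) * (1 * xpow 0 (0 * of_int r + 0) * qpow \<tau> (1 / 2 * (of_int r)\<^sup>2 + (\<kappa> + 1 / 2 + 2 * M * c) * of_int r + 0))) summable_on A \<times> B"
    by (rule summable_times)
  fix x assume "x \<in> A \<times> B"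
  then obtain l r where x: "x = (l, r)" "l \<in> A" "r \<in> B"
    by blast
  have "M * ((l + c) * r) \<le> 0"
    using assms[OF x(2,3)] M by (simp add: mult_nonneg_nonpos)
  then have "real_of_int (M * ((l + c) * r)) \<le> 0"
    by linarith
  then have "1 / 2 * (of_int r)\<^sup>2 + (\<kappa> + 1 / 2 + 2 * M * c) * of_int r
      \<le> of_int r * (of_int r + 1) / 2 + of_int r * of_int (\<kappa> - 2 * M * l)"
    by (simp add: power2_eq_square algebra_simps) 
  then have "norm (pterm \<tau> (\<kappa> - 2 * M * l) r) \<le> norm (qpow \<tau> (1 / 2 * (of_int r)\<^sup>2 + (\<kappa> + 1 / 2 + 2 * M * c) * of_int r))"
    unfolding pterm_def norm_mult norm_qpow using tau by (simp add: norm_power_int)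
  then show "norm (case x of (l, r) \<Rightarrow> \<epsilon> powi l * qpow \<tau> (expo \<kappa> l) * pterm \<tau> (\<kappa> - 2 * M * l) r)
    \<le> norm (case x of (l, r) \<Rightarrow> (\<epsilon> powi l * qpow \<tau> (expo \<kappa> l)) * (1 * xpow 0 (0 * of_int r + 0) * qpow \<tau> (1 / 2 * (of_int r)\<^sup>2 + (\<kappa> + 1 / 2 + 2 * M * c) * of_int r + 0)))"
    by (simp add: x norm_mult xpow_def mult_left_mono)
qed

lemma cone_sum:
  assumes "\<And>l r. l \<in> A \<Longrightarrow> r \<in> B \<Longrightarrow> (l + c) * r \<le> 0"
  shows "(\<lambda>(j, r). hecke_term (\<kappa> + 1 / 2) j r) summable_on {(j, r). r - j \<in> A \<and> r \<in> B}"
    and "(\<Sum>\<^sub>\<infinity>l\<in>A. \<epsilon> powi l * qpow \<tau> (expo \<kappa> l) * infsum (pterm \<tau> (\<kappa> - 2 * M * l)) B)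
      = (\<Sum>\<^sub>\<infinity>(j, r)\<in>{(j, r). r - j \<in> A \<and> r \<in> B}. hecke_term (\<kappa> + 1 / 2) j r)"
proof -
  let ?f = "\<lambda>(l, r). \<epsilon> powi l * qpow \<tau> (expo \<kappa> l) * pterm \<tau> (\<kappa> - 2 * M * l) r"
  let ?S = "{(j, r). r - j \<in> A \<and> r \<in> B}"
  have summ: "?f summable_on A \<times> B"
    using assms by (rule summable_quadrant)
  have bij: "bij_betw (\<lambda>(l, r). (r - l, r)) (A \<times> B) ?S"
    by (rule bij_betwI[of _ _ _ "\<lambda>(j, r). (r - j, r)"]) auto
  have comp: "(\<lambda>x. (\<lambda>(j, r). hecke_term (\<kappa> + 1 / 2) j r) ((\<lambda>(l, r). (r - l, r)) x)) = ?f"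
    by (auto simp: hecke_term_eq)
  show "(\<lambda>(j, r). hecke_term (\<kappa> + 1 / 2) j r) summable_on ?S"
    using summable_on_reindex_bij_betw[OF bij, of "\<lambda>(j, r). hecke_term (\<kappa> + 1 / 2) j r"] summ
    unfolding comp by blast
  have "(\<Sum>\<^sub>\<infinity>l\<in>A. \<epsilon> powi l * qpow \<tau> (expo \<kappa> l) * infsum (pterm \<tau> (\<kappa> - 2 * M * l)) B) = infsum ?f (A \<times> B)"
    using infsum_Sigma'_banach[of "\<lambda>l r. \<epsilon> powi l * qpow \<tau> (expo \<kappa> l) * pterm \<tau> (\<kappa> - 2 * M * l) r" A "\<lambda>_. B"] summ
    by (simp only: infsum_cmult_right')
  then show "(\<Sum>\<^sub>\<infinity>l\<in>A. \<epsilon> powi l * qpow \<tau> (expo \<kappa> l) * infsum (pterm \<tau> (\<kappa> - 2 * M * l)) B)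
      = (\<Sum>\<^sub>\<infinity>(j, r)\<in>?S. hecke_term (\<kappa> + 1 / 2) j r)"
    using infsum_reindex_bij_betw[OF bij, of "\<lambda>(j, r). hecke_term (\<kappa> + 1 / 2) j r"]
    unfolding comp by simp
qed

text \<open>The lines \<open>j - r = const\<close> carry zero sums, so the cone may be cut at any such line.\<close>

lemma hecke_double_sum:
  shows "hecke \<kappa> 0 = bracket_sum {(j, r). 0 \<le> r \<and> c \<le> j - r} {(j, r). j - r < c \<and> r < 0}
      (\<lambda>(j, r). hecke_term (\<kappa> + 1 / 2) j r)"
    and "(\<lambda>(j, r). hecke_term (\<kappa> + 1 / 2) j r) summable_on {(j, r). 0 \<le> r \<and> c \<le> j - r}"
    and "(\<lambda>(j, r). hecke_term (\<kappa> + 1 / 2) j r) summable_on {(j, r). j - r < c \<and> r < 0}"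
proof -
  let ?a = "\<lambda>l. \<epsilon> powi l * qpow \<tau> (expo \<kappa> l)"
  have le: "(l + c) * r \<le> 0" if "l \<in> {..- c}" "r \<in> {0..}" for l r
    using that by (auto simp: mult_nonpos_nonneg)
  have gt: "(l + c) * r \<le> 0" if "l \<in> {- c<..}" "r \<in> {..<0}" for l r
    using that by (auto simp: mult_nonneg_nonpos)
  have sets: "{(j, r). r - j \<in> {..- c} \<and> r \<in> {0..}} = {(j, r). 0 \<le> r \<and> c \<le> j - r}"
    "{(j, r). r - j \<in> {- c<..} \<and> r \<in> {..<0}} = {(j, r). j - r < c \<and> r < 0}"
    by auto
  show "(\<lambda>(j, r). hecke_term (\<kappa> + 1 / 2) j r) summable_on {(j, r). 0 \<le> r \<and> c \<le> j - r}"
    "(\<lambda>(j, r). hecke_term (\<kappa> + 1 / 2) j r) summable_on {(j, r). j - r < c \<and> r < 0}"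
    using cone_sum(1)[of "{..- c}" "{0..}" c \<kappa>, OF le] cone_sum(1)[of "{- c<..}" "{..<0}" c \<kappa>, OF gt]
    unfolding sets by blast+
  have "hecke \<kappa> 0 = (\<Sum>\<^sub>\<infinity>l\<in>{..- c} \<union> {- c<..}. ?a l * ptheta \<tau> 0 (\<kappa> - 2 * M * l))"
  proof -
    have "{..- c} \<union> {- c<..} = UNIV"
      by auto
    then show ?thesis
      by (simp only: hecke_def)
  qed
  also have "\<dots> = (\<Sum>\<^sub>\<infinity>l\<in>{..- c}. ?a l * ptheta \<tau> 0 (\<kappa> - 2 * M * l)) + (\<Sum>\<^sub>\<infinity>l\<in>{- c<..}. ?a l * ptheta \<tau> 0 (\<kappa> - 2 * M * l))"
    by (rule infsum_Un_disjoint[OF summable_hecke summable_hecke]) auto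
  also have "(\<Sum>\<^sub>\<infinity>l\<in>{- c<..}. ?a l * ptheta \<tau> 0 (\<kappa> - 2 * M * l)) = (\<Sum>\<^sub>\<infinity>l\<in>{- c<..}. - (?a l * infsum (pterm \<tau> (\<kappa> - 2 * M * l)) {..<0}))"
    by (simp add: infsum_pterm_lessThan[OF tau])
  also have "\<dots> = - (\<Sum>\<^sub>\<infinity>l\<in>{- c<..}. ?a l * infsum (pterm \<tau> (\<kappa> - 2 * M * l)) {..<0})"
    by (rule infsum_uminus)
  finally show "hecke \<kappa> 0 = bracket_sum {(j, r). 0 \<le> r \<and> c \<le> j - r} {(j, r). j - r < c \<and> r < 0}
      (\<lambda>(j, r). hecke_term (\<kappa> + 1 / 2) j r)"
    using cone_sum(2)[of "{..- c}" "{0..}" c \<kappa>, OF le] cone_sum(2)[of "{- c<..}" "{..<0}" c \<kappa>, OF gt]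
    unfolding sets bracket_sum_def ptheta_def by (simp only: diff_conv_add_uminus)
qed

text \<open>The indices M - 1 and -M belong to K = m and K = -m, which differ by one period. Both
  halves therefore reduce to the same \<open>hecke\<close> value, up to one row.\<close>

lemma quot_coeff_last: "quot_coeff (M - 1) = - \<epsilon> * (2 * hecke (- M) 0 + hecke_row (- M) (-1) + row_sum (- M))"
proof -
  have "hecke (M - 1) 0 = - \<epsilon> * hecke (- M) (-1)"
    using hecke_periodic[of "- M" 0] by simp
  moreover have "hecke (- M) (-1) = hecke_row (- M) (-1) + hecke (- M) 0"
    using hecke_rec[of "- M" "-1"] by simp
  moreover have "- 1 - (M - 1) = - M"
    by simp
  ultimately show ?thesis
    unfolding quot_coeff_altdef by (simp add: algebra_simps)
qed

end

section \<open>Finite sums over half-odd k inside the brackets\<close>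

lemma infsum_sum_complex:
  fixes f :: "'a \<Rightarrow> 'b \<Rightarrow> complex"
  assumes "finite K" "\<And>k. k \<in> K \<Longrightarrow> f k summable_on A"
  shows "(\<Sum>\<^sub>\<infinity>x\<in>A. \<Sum>k\<in>K. f k x * d k) = (\<Sum>k\<in>K. infsum (f k) A * d k)"
proof -
  have "((\<lambda>x. \<Sum>k\<in>K'. f k x * d k) has_sum (\<Sum>k\<in>K'. infsum (f k) A * d k)) A" if "K' \<subseteq> K" for K'
    using finite_subset[OF that assms(1)] that
  proof (induction K' rule: finite_induct)
    case (insert k K')
    then have "((\<lambda>x. f k x * d k + (\<Sum>k\<in>K'. f k x * d k)) has_sum (infsum (f k) A * d k + (\<Sum>k\<in>K'. infsum (f k) A * d k))) A"
      by (intro has_sum_add has_sum_cmult_left has_sum_infsum) (use assms(2) in auto)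
    then show ?case
      using insert by simp
  qed simp
  then show ?thesis
    by (intro infsumI) auto
qed

lemma bracket_sum_sum:
  fixes f :: "'a \<Rightarrow> 'b \<Rightarrow> complex"
  assumes "finite K" "\<And>k. k \<in> K \<Longrightarrow> f k summable_on A" "\<And>k. k \<in> K \<Longrightarrow> f k summable_on B"
  shows "bracket_sum A B (\<lambda>x. \<Sum>k\<in>K. f k x * d k) = (\<Sum>k\<in>K. bracket_sum A B (f k) * d k)"
  using assms by (simp add: bracket_sum_def infsum_sum_complex left_diff_distrib sum_subtractf)

lemma bracket_sum_cmult: "bracket_sum A B (\<lambda>x. c * f x) = c * bracket_sum A B f"
  by (simp add: bracket_sum_def infsum_cmult_right' right_diff_distrib)

lemma half_odd_ints_cases: "k \<in> half_odd_ints \<Longrightarrow> \<exists>n::int. k = of_int n + 1 / 2"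
proof -
  assume "k \<in> half_odd_ints"
  then obtain n :: int where n: "k = of_int n / 2" "odd n"
    by (auto simp: half_odd_ints_def)
  then obtain l where "n = 2 * l + 1"
    by (elim oddE)
  then show ?thesis
    using n by (intro exI[of _ l]) simp
qed

lemma half_odd_ints_sum:
  fixes N :: int
  assumes "\<And>k::int. P (k + 1 / 2) \<longleftrightarrow> 0 \<le> k \<and> k < N"
  shows "(\<Sum>k\<in>{k \<in> half_odd_ints. P k}. F k) = (\<Sum>k\<in>{0..<N}. F (of_int k + 1 / 2))"
proof -
  have "{k \<in> half_odd_ints. P k} = (\<lambda>k. of_int k + 1 / 2) ` {0..<N}"
  proof (intro equalityI subsetI)
    fix x assume x: "x \<in> {k \<in> half_odd_ints. P k}"
    then obtain k :: int where "x = of_int k + 1 / 2"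
      using half_odd_ints_cases by blast
    then show "x \<in> (\<lambda>k. of_int k + 1 / 2) ` {0..<N}"
      using x assms by auto
  next
    fix x :: real assume "x \<in> (\<lambda>k. of_int k + 1 / 2) ` {0..<N}"
    then obtain k :: int where k: "x = of_int k + 1 / 2" "0 \<le> k" "k < N"
      by auto
    then have "x = of_int (2 * k + 1) / 2" "odd (2 * k + 1)"
      by simp_all
    then have "x \<in> half_odd_ints"
      unfolding half_odd_ints_def by blast
    then show "x \<in> {k \<in> half_odd_ints. P k}"
      using k assms by auto
  qed
  moreover have "inj_on (\<lambda>k. real_of_int k + 1 / 2) {0..<N}"
    by (auto simp: inj_on_def)
  ultimately show ?thesis
    by (simp add: sum.reindex)
qed

context theta_quotient
begin

lemma half_odd_sum_le: "(\<Sum>k\<in>{k \<in> half_odd_ints. 0 < k \<and> k \<le> m}. F k) = (\<Sum>k\<in>{0..<M}. F (of_int k + 1 / 2))"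
  by (rule half_odd_ints_sum) (auto simp: m)

lemma half_odd_sum_less: "(\<Sum>k\<in>{k \<in> half_odd_ints. 0 < k \<and> k < m}. F k) = (\<Sum>k\<in>{0..<M - 1}. F (of_int k + 1 / 2))"
  by (rule half_odd_ints_sum) (auto simp: m)

text \<open>The cut c = 1 of \<open>hecke_double_sum\<close> gives the strict cone r < j; -k is the
  value of K for the index -1 - \<kappa>.\<close>

lemma bracket_strict:
  "bracket_sum {(j, r). 0 \<le> r \<and> r < j} {(j, r). j \<le> r \<and> r < 0}
      (\<lambda>(j, r). \<Sum>k\<in>{k \<in> half_odd_ints. 0 < k \<and> k \<le> m}. hecke_term (- k) j r * d k)
    = (\<Sum>k\<in>{0..<M}. hecke (- 1 - k) 0 * d (k + 1 / 2))"
proof -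
  have sets: "{(j::int, r). 0 \<le> r \<and> 1 \<le> j - r} = {(j, r). 0 \<le> r \<and> r < j}"
      "{(j::int, r). j - r < 1 \<and> r < 0} = {(j, r). j \<le> r \<and> r < 0}"
    by auto
  have K: "real_of_int (- 1 - k) + 1 / 2 = - (of_int k + 1 / 2)" for k
    by simp
  have "bracket_sum {(j, r). 0 \<le> r \<and> r < j} {(j, r). j \<le> r \<and> r < 0}
      (\<lambda>(j, r). \<Sum>k\<in>{k \<in> half_odd_ints. 0 < k \<and> k \<le> m}. hecke_term (- k) j r * d k)
    = bracket_sum {(j, r). 0 \<le> r \<and> r < j} {(j, r). j \<le> r \<and> r < 0}
      (\<lambda>x. \<Sum>k\<in>{0..<M}. (case x of (j, r) \<Rightarrow> hecke_term (- (of_int k + 1 / 2)) j r) * d (of_int k + 1 / 2))"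
    unfolding half_odd_sum_le by (simp add: case_prod_unfold)
  also have "\<dots> = (\<Sum>k\<in>{0..<M}. hecke (- 1 - k) 0 * d (k + 1 / 2))"
    using hecke_double_sum[of "- 1 - _" 1] unfolding sets K by (subst bracket_sum_sum) auto
  finally show ?thesis .
qed

text \<open>Here the cut is c = 0, whose cone is r \<le> j.\<close>

lemma bracket_weak:
  "bracket_sum {(j, r). 0 \<le> r \<and> r \<le> j} {(j, r). j < r \<and> r < 0}
      (\<lambda>(j, r). \<Sum>k\<in>{k \<in> half_odd_ints. 0 < k \<and> k < m}. hecke_term k j r * d k)
    = (\<Sum>k\<in>{0..<M - 1}. hecke k 0 * d (k + 1 / 2))"
proof -
  have sets: "{(j::int, r). 0 \<le> r \<and> 0 \<le> j - r} = {(j, r). 0 \<le> r \<and> r \<le> j}"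
      "{(j::int, r). j - r < 0 \<and> r < 0} = {(j, r). j < r \<and> r < 0}"
    by auto
  have "bracket_sum {(j, r). 0 \<le> r \<and> r \<le> j} {(j, r). j < r \<and> r < 0}
      (\<lambda>(j, r). \<Sum>k\<in>{k \<in> half_odd_ints. 0 < k \<and> k < m}. hecke_term k j r * d k)
    = bracket_sum {(j, r). 0 \<le> r \<and> r \<le> j} {(j, r). j < r \<and> r < 0}
      (\<lambda>x. \<Sum>k\<in>{0..<M - 1}. (case x of (j, r) \<Rightarrow> hecke_term (of_int k + 1 / 2) j r) * d (of_int k + 1 / 2))"
    unfolding half_odd_sum_less by (simp add: case_prod_unfold)
  also have "\<dots> = (\<Sum>k\<in>{0..<M - 1}. hecke k 0 * d (k + 1 / 2))"
    using hecke_double_sum[of _ 0] unfolding sets by (subst bracket_sum_sum) auto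
  finally show ?thesis .
qed

text \<open>A row at the reflected index without its theta value; the reflection accounts for +K
  where \<open>hecke_row\<close> has a minus sign.\<close>

definition row_coeff :: "real \<Rightarrow> int \<Rightarrow> complex" where
  "row_coeff K a = (- \<epsilon>) powi a * qpow \<tau> (- m * (a + P + K / (2 * m))\<^sup>2)"

lemma hecke_row_eq: "hecke_row (- 1 - k) a = theta \<epsilon> (2 * m * P) M \<tau> 0 * row_coeff (k + 1 / 2) a"
proof -
  have "a + P - (of_int (- 1 - k) + 1 / 2) / (2 * m) = a + P + (k + 1 / 2) / (2 * m)"
    using m_pos by (simp add: field_simps)
  then show ?thesis
    by (simp only: hecke_row_def row_coeff_def)
qed

text \<open>The terms with \<open>k = m\<close> of both cones coincide up to a shift of \<open>r\<close>; this is why only the first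
  of the two brackets has a summand with \<open>k = m\<close>, and where the single hecke_row \<open>r = -1\<close> comes from.\<close>

lemma quot_coeff_expansion:
  "(\<Sum>k\<in>{0..<M - 1}. quot_coeff k * d (k + 1 / 2)) + quot_coeff (M - 1) * (d m / 2)
    = - \<epsilon> * bracket_sum {(j, r). 0 \<le> r \<and> r < j} {(j, r). j \<le> r \<and> r < 0}
      (\<lambda>(j, r). \<Sum>k\<in>{k \<in> half_odd_ints. 0 < k \<and> k \<le> m}. hecke_term (- k) j r * d k)
    + bracket_sum {(j, r). 0 \<le> r \<and> r \<le> j} {(j, r). j < r \<and> r < 0}
      (\<lambda>(j, r). \<Sum>k\<in>{k \<in> half_odd_ints. 0 < k \<and> k < m}. hecke_term k j r * d k)
    - \<epsilon> * theta \<epsilon> (2 * m * P) M \<tau> 0 * (\<Sum>k\<in>{k \<in> half_odd_ints. 0 < k \<and> k < m}.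
        bracket_sum {- p2<..<0} {0..- p2} (row_coeff k) * d k)
    - \<epsilon> * theta \<epsilon> (2 * m * P) M \<tau> 0
        * (row_coeff m (-1) + bracket_sum {- p2<..<0} {0..- p2} (row_coeff m)) * (d m / 2)"
proof -
  let ?T = "theta \<epsilon> (2 * m * P) M \<tau> 0"
  let ?B = "\<lambda>K. bracket_sum {- p2<..<0} {0..- p2} (row_coeff K)"
  have rs: "row_sum (- 1 - k) = ?T * ?B (k + 1 / 2)" for k
    unfolding row_sum_def hecke_row_eq[abs_def] by (rule bracket_sum_cmult)
  have m': "of_int (M - 1) + 1 / 2 = m" and M': "- 1 - (M - 1) = - M"
    by (simp_all add: m)
  obtain e where e: "d m = 2 * e"
    by (metis mult.commute nonzero_eq_divide_eq zero_neq_numeral)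
  have last: "quot_coeff (M - 1) = - \<epsilon> * (2 * hecke (- M) 0 + ?T * row_coeff m (-1) + ?T * ?B m)"
    using quot_coeff_last rs[of "M - 1"] hecke_row_eq[of "M - 1" "-1"] unfolding m' M' by simp
  have first: "(\<Sum>k\<in>{0..<M}. hecke (- 1 - k) 0 * d (k + 1 / 2))
      = (\<Sum>k\<in>{0..<M - 1}. hecke (- 1 - k) 0 * d (k + 1 / 2)) + hecke (- M) 0 * d m"
  proof -
    have "{0..<M} = insert (M - 1) {0..<M - 1}"
      using M by auto
    then have "(\<Sum>k\<in>{0..<M}. hecke (- 1 - k) 0 * d (k + 1 / 2))
      = (\<Sum>k\<in>{0..<M - 1}. hecke (- 1 - k) 0 * d (k + 1 / 2)) + hecke (- 1 - (M - 1)) 0 * d (of_int (M - 1) + 1 / 2)"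
      by (simp add: add.commute)
    then show ?thesis
      unfolding m' M' .
  qed
  have "(\<Sum>k\<in>{0..<M - 1}. quot_coeff k * d (k + 1 / 2))
      = (\<Sum>k\<in>{0..<M - 1}. hecke k 0 * d (k + 1 / 2)) - \<epsilon> * (\<Sum>k\<in>{0..<M - 1}. hecke (- 1 - k) 0 * d (k + 1 / 2))
        - \<epsilon> * ?T * (\<Sum>k\<in>{0..<M - 1}. ?B (k + 1 / 2) * d (k + 1 / 2))"
    unfolding quot_coeff_altdef rs by (simp add: sum_distrib_left sum_subtractf algebra_simps sum.distrib)
  then show ?thesis
    unfolding bracket_strict bracket_weak unfolding half_odd_sum_less last first e
    by (simp add: algebra_simps)
qed

end

section \<open>Translation of theta functions by z -> z + 1\<close>

lemma xpow_add_one: "xpow (z + 1) u = xpow z u * xpow 1 u"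
  by (simp add: xpow_def algebra_simps flip: exp_add)

lemma xpow_1_of_int: "xpow 1 (of_int n) = (-1) powi n"
proof -
  have "xpow 1 (of_int n) = exp (of_int n * (of_real pi * \<i>))"
    by (simp add: xpow_def mult_ac)
  also have "\<dots> = exp (of_real pi * \<i>) powi n"
    by (simp only: exp_power_int)
  finally show ?thesis
    by (simp add: exp_pi_i)
qed

lemma xpow_1_half: "xpow 1 (1 / 2) = \<i>"
  by (simp add: xpow_def exp_eq_polar cis.ctr complex_eq_iff flip: cis_conv_exp)

text \<open>Consecutive exponents differ by N = 2 \<open>Mr\<close>, so each step multiplies by
  (-1)^N: the sign of the theta function changes precisely when N is odd.\<close>

lemma theta_add_one:
  assumes "Mr > 0" "2 * Mr = of_int N"
  shows "theta e k Mr \<tau> (z + 1) = xpow 1 k * theta (e * (-1) powi N) k Mr \<tau> z"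
proof -
  have "xpow 1 (of_int N * of_int n + k) = xpow 1 k * ((-1) powi N) powi n" for n :: int
    using xpow_1_of_int[of "N * n"] by (simp add: xpow_add power_int_mult)
  then have "e powi n * xpow (z + 1) (2 * Mr * of_int n + k) * qpow \<tau> ((2 * Mr * of_int n + k)\<^sup>2 / (4 * Mr))
    = xpow 1 k * ((e * (-1) powi N) powi n * xpow z (2 * Mr * of_int n + k) * qpow \<tau> ((2 * Mr * of_int n + k)\<^sup>2 / (4 * Mr)))" for n
    unfolding assms(2) xpow_add_one by (simp add: power_int_mult_distrib)
  then show ?thesis
    unfolding theta_altdef[OF assms(1)] by (simp only: infsum_cmult_right')
qed

section \<open>The function E\<close>

lemma E_fun_minus: "E_fun (- x) = - E_fun x"
proof -
  have "(LBINT t=ereal 0..ereal (- x). exp (- pi * t\<^sup>2)) = (LBINT t=ereal x..ereal 0. exp (- pi * t\<^sup>2))"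
    by (subst interval_integral_reflect) simp
  also have "\<dots> = - (LBINT t=ereal 0..ereal x. exp (- pi * t\<^sup>2))"
    by (rule interval_integral_endpoints_reverse)
  finally show ?thesis
    by (simp add: E_fun_def)
qed

lemma E_fun_0 [simp]: "E_fun 0 = 0"
  by (simp add: E_fun_def)

lemma E_fun_deriv:
  assumes "a < x" "x < b" "a < 0" "0 < b"
  shows "(E_fun has_real_derivative 2 * exp (- pi * x\<^sup>2)) (at x)"
proof -
  have "((\<lambda>u. LBINT t=ereal 0..ereal u. exp (- pi * t\<^sup>2)) has_vector_derivative exp (- pi * x\<^sup>2)) (at x within {a..b})"
    by (rule interval_integral_FTC2) (use assms in \<open>auto intro!: continuous_intros\<close>)
  moreover have "at x within {a..b} = at x"
    using assms by (intro at_within_interior) auto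
  ultimately have "((\<lambda>u. LBINT t=ereal 0..ereal u. exp (- pi * t\<^sup>2)) has_real_derivative exp (- pi * x\<^sup>2)) (at x)"
    by (simp add: has_real_derivative_iff_has_vector_derivative)
  then show ?thesis
    unfolding E_fun_def[abs_def] by (rule DERIV_cmult)
qed

lemma E_fun_has_derivative: "(E_fun has_real_derivative 2 * exp (- pi * x\<^sup>2)) (at x)"
  by (rule E_fun_deriv[of "- \<bar>x\<bar> - 1" _ "\<bar>x\<bar> + 1"]) auto

lemma E_fun_tendsto_1: "(E_fun \<longlongrightarrow> 1) at_top"
proof -
  let ?f = "\<lambda>t::real. exp (- pi * t\<^sup>2)"
  define v where "v = (\<integral>t. indicator {0..} t *\<^sub>R ?f t \<partial>lborel)"
  \<comment> \<open>Variance 1/(2\<pi>) makes the normalising constant of the density equal to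
    1.\<close>
  have nd: "?f = normal_density 0 (1 / sqrt (2 * pi))"
    by (auto simp: normal_density_def power_divide real_sqrt_divide real_sqrt_mult field_simps)
  have f: "integrable lborel ?f" "integral\<^sup>L lborel ?f = 1"
    unfolding nd by simp_all
  have half: "integrable lborel (\<lambda>t. indicator {0..} t *\<^sub>R ?f t)"
    using integrable_mult_indicator[OF _ f(1), of "{0..}"] by simp
  then have "has_bochner_integral lborel (\<lambda>t. indicator {0..} t *\<^sub>R ?f t) v"
    unfolding v_def by (rule has_bochner_integral_integrable)
  then have "has_bochner_integral lborel ?f (2 *\<^sub>R v)"
    by (rule has_bochner_integral_even_function) simp
  then have "2 * v = 1"
    using f(2) has_bochner_integral_integral_eq by fastforce
  have "((\<lambda>y. \<integral>t. indicator {..y} t *\<^sub>R (indicator {0..} t *\<^sub>R ?f t) \<partial>lborel) \<longlongrightarrow> v) at_top"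
    unfolding v_def by (rule tendsto_integral_at_top) (use half in auto)
  then have "((\<lambda>y. 2 * (\<integral>t. indicator {..y} t *\<^sub>R (indicator {0..} t *\<^sub>R ?f t) \<partial>lborel)) \<longlongrightarrow> 2 * v) at_top"
    by (intro tendsto_intros)
  moreover have "eventually (\<lambda>y. 2 * (\<integral>t. indicator {..y} t *\<^sub>R (indicator {0..} t *\<^sub>R ?f t) \<partial>lborel) = E_fun y) at_top"
    using eventually_ge_at_top[of 0]
  proof eventually_elim
    case (elim y)
    have "(LBINT t=ereal 0..ereal y. ?f t) = (\<integral>t. indicator {0..y} t *\<^sub>R ?f t \<partial>lborel)"
      using elim by (simp add: interval_integral_Icc set_lebesgue_integral_def)
    also have "\<dots> = (\<integral>t. indicator {..y} t *\<^sub>R (indicator {0..} t *\<^sub>R ?f t) \<partial>lborel)"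
      by (rule Bochner_Integration.integral_cong) (auto split: split_indicator)
    finally show ?case
      by (simp add: E_fun_def)
  qed
  ultimately show ?thesis
    unfolding \<open>2 * v = 1\<close> by (rule Lim_transform_eventually)
qed

lemma E_fun_upper: "E_fun x \<le> 1"
proof (rule tendsto_lowerbound[OF E_fun_tendsto_1])
  show "eventually (\<lambda>y. E_fun x \<le> E_fun y) at_top"
    using eventually_ge_at_top[of x]
    by eventually_elim (rule DERIV_nonneg_imp_nondecreasing, assumption, use E_fun_has_derivative in \<open>blast intro: less_imp_le exp_gt_zero mult_pos_pos zero_less_numeral\<close>)
qed simp

text \<open>The difference of the two sides increases on \<open>[0, 1/\<pi>]\<close>, decreases afterwards, and vanishes at
  \<open>0\<close> and at infinity.\<close>

lemma E_fun_lower: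
  assumes "x \<ge> 0"
  shows "1 - E_fun x \<le> exp (- pi * x\<^sup>2)"
proof -
  define G where "G x = exp (- pi * x\<^sup>2) - 1 + E_fun x" for x
  have G': "(G has_real_derivative 2 * exp (- pi * x\<^sup>2) * (1 - pi * x)) (at x)" for x
    unfolding G_def[abs_def] by (auto intro!: derivative_eq_intros E_fun_has_derivative simp: algebra_simps)
  have lim: "(G \<longlongrightarrow> 0) at_top"
  proof -
    have "((\<lambda>x. exp (- pi * x\<^sup>2)) \<longlongrightarrow> 0) at_top"
      by real_asymp
    then show ?thesis
      unfolding G_def[abs_def]
      using tendsto_add[OF tendsto_diff[OF _ tendsto_const[of 1]] E_fun_tendsto_1, of "\<lambda>x. exp (- pi * x\<^sup>2)" 0] by simp
  qed
  have "G x \<ge> 0"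
  proof (cases "x \<le> 1 / pi")
    case True
    have "G 0 \<le> G x"
    proof (rule DERIV_nonneg_imp_nondecreasing[OF assms])
      fix t assume "0 \<le> t" "t \<le> x"
      then have "pi * t \<le> pi * x"
        by simp
      also have "pi * x \<le> 1"
        using True by (simp add: field_simps)
      finally have "0 \<le> 1 - pi * t"
        by simp
      then show "\<exists>y. DERIV G t :> y \<and> 0 \<le> y"
        using G'[of t] by (intro exI conjI) auto
    qed
    then show ?thesis
      by (simp add: G_def)
  next
    case False
    show ?thesis
    proof (rule tendsto_upperbound[OF lim])
      show "eventually (\<lambda>y. G y \<le> G x) at_top"
        using eventually_ge_at_top[of x]
      proof eventually_elim
        case (elim y)
        show ?case
        proof (rule DERIV_nonpos_imp_nonincreasing[OF elim])
          fix t assume "x \<le> t" "t \<le> y"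
          have "1 \<le> pi * x"
            using False by (simp add: field_simps)
          also have "pi * x \<le> pi * t"
            using \<open>x \<le> t\<close> by simp
          finally have "1 - pi * t \<le> 0"
            by simp
          then show "\<exists>y. DERIV G t :> y \<and> y \<le> 0"
            using G'[of t] by (intro exI conjI) (auto simp: mult_nonneg_nonpos)
        qed
      qed
    qed simp
  qed
  then show ?thesis
    by (simp add: G_def)
qed

text \<open>When sign and argument agree, the bracket in \<open>R_fun\<close> is a Gaussian tail;
  this decay makes the series for R converge.\<close>

lemma E_fun_sgn_bound:
  assumes "s = 1 \<and> x \<ge> 0 \<or> s = -1 \<and> x \<le> 0"
  shows "\<bar>s - E_fun x\<bar> \<le> exp (- pi * x\<^sup>2)"
  using assms E_fun_lower[of x] E_fun_upper[of x] E_fun_lower[of "- x"] E_fun_upper[of "- x"]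
  by (auto simp: E_fun_minus)

section \<open>The Appell sums and their completion at half periods\<close>

text \<open>Under j -> -j the denominators become 1 - y and 1 - 1/y, while the numerators differ by
  the factor -1/y; the sign is e^(-\<pi>i), from s = 1/2 and z2 - z1 = 1.\<close>

lemma Phi_eq_0: "Phi (-1) m (1 / 2) \<tau> (z / 2 - 1 / 2) (z / 2 + 1 / 2) 0 = 0"
proof -
  let ?z1 = "z / 2 - 1 / 2" and ?z2 = "z / 2 + 1 / 2"
  let ?n1 = "\<lambda>j::int. exp (2 * of_real pi * \<i> * of_real m * of_int j * (?z1 + ?z2) + 2 * of_real pi * \<i> * of_real (1 / 2) * ?z1)
    * qpow \<tau> (m * (of_int j)\<^sup>2 + 1 / 2 * of_int j)"
  let ?n2 = "\<lambda>j::int. exp (- 2 * of_real pi * \<i> * of_real m * of_int j * (?z1 + ?z2) - 2 * of_real pi * \<i> * of_real (1 / 2) * ?z2)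
    * qpow \<tau> (m * (of_int j)\<^sup>2 + 1 / 2 * of_int j)"
  let ?y = "\<lambda>j::int. exp (2 * of_real pi * \<i> * ?z1) * qpow \<tau> (of_int j)"
  have "(\<Sum>\<^sub>\<infinity>j::int. (-1) powi j * ?n1 j / (1 - exp (2 * of_real pi * \<i> * ?z1) * qpow \<tau> (of_int j)))
    = (\<Sum>\<^sub>\<infinity>j::int. (-1) powi j * ?n2 j / (1 - exp (- 2 * of_real pi * \<i> * ?z2) * qpow \<tau> (of_int j)))"
  proof (rule infsum_reindex_bij_witness[of _ uminus uminus])
    fix j :: int
    define y where "y = ?y j"
    have y_nz: "y \<noteq> 0"
      by (simp add: y_def)
    have "exp (2 * of_real pi * \<i> * ?z1) * exp (- 2 * of_real pi * \<i> * ?z2) = 1"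
      by (simp add: field_simps flip: exp_add) (simp add: exp_minus exp_two_pi_i')
    then have inv: "exp (- 2 * of_real pi * \<i> * ?z2) * qpow \<tau> (of_int (- j)) = 1 / y"
      unfolding y_def by (simp add: qpow_minus field_simps)
    define N1 where "N1 = ?n1 j"
    have "?n2 (- j) * y = - N1"
    proof -
      have a: "exp (- 2 * of_real pi * \<i> * of_real m * of_int (- j) * (?z1 + ?z2) - 2 * of_real pi * \<i> * of_real (1 / 2) * ?z2)
          * exp (2 * of_real pi * \<i> * ?z1)
        = exp (2 * of_real pi * \<i> * of_real m * of_int j * (?z1 + ?z2) + 2 * of_real pi * \<i> * of_real (1 / 2) * ?z1) * exp (- (of_real pi * \<i>))"
        (is "?A * ?e = ?B * _")
        unfolding exp_add[symmetric] by (rule arg_cong[of _ _ exp]) (simp add: field_simps)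
      have b: "qpow \<tau> (m * (of_int (- j))\<^sup>2 + 1 / 2 * of_int (- j)) * qpow \<tau> (of_int j) = qpow \<tau> (m * (of_int j)\<^sup>2 + 1 / 2 * of_int j)"
        (is "?Q * ?r = ?R")
        by (rule qpow_mult) simp
      have "?A * ?Q * (?e * ?r) = (?A * ?e) * (?Q * ?r)"
        by (simp only: mult_ac)
      also have "\<dots> = - (?B * ?R)"
        unfolding a b by (simp add: exp_minus)
      finally show ?thesis
        unfolding N1_def y_def .
    qed
    then have N2: "?n2 (- j) = - N1 / y"
      by (simp only: nonzero_eq_divide_eq[OF y_nz])
    \<comment> \<open>At y = 1 both sides are divisions by zero, hence both are 0.\<close>
    have "- N1 / y / (1 - 1 / y) = N1 / (1 - y)"
    proof (cases "y = 1")
      case False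
      then show ?thesis
        using y_nz by (simp add: field_simps)
    qed simp
    note frac = this
    have sign: "(-1) powi (- j) = ((-1) powi j :: complex)"
      by (rule powi_sign_minus) simp
    show "(-1) powi (- j) * ?n2 (- j) / (1 - exp (- 2 * of_real pi * \<i> * ?z2) * qpow \<tau> (of_int (- j)))
      = (-1) powi j * ?n1 j / (1 - exp (2 * of_real pi * \<i> * ?z1) * qpow \<tau> (of_int j))"
      unfolding N2 inv N1_def[symmetric] y_def[symmetric] sign
      by (simp only: frac flip: times_divide_eq_right)
  qed auto
  then show ?thesis
    unfolding Phi_def Phi1_def Phi2_def by (simp only:) simp
qed

text \<open>Since \<open>|y q\<^sup>j|\<close> tends to \<open>0\<close> and to infinity at the two ends, only finitely many factors come near \<open>0\<close>.\<close>

lemma denominator_bounded: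
  assumes tau: "Im \<tau> > 0" and y: "y \<noteq> 0" "\<And>j::int. y * qpow \<tau> (of_int j) \<noteq> 1"
  obtains C where "\<And>j::int. norm (inverse (1 - y * qpow \<tau> (of_int j))) \<le> C"
proof -
  let ?d = "\<lambda>j::int. inverse (1 - y * qpow \<tau> (of_int j))"
  define c where "c = 2 * pi * Im \<tau>"
  have c: "c > 0"
    using tau by (simp add: c_def)
  define b where "b = ln (norm y)"
  have norm: "norm (y * qpow \<tau> (of_int j)) = exp (b - c * of_int j)" for j :: int
    using y(1) by (simp add: norm_mult norm_qpow b_def c_def exp_diff exp_minus field_simps)
  define S where "S = {j::int. \<bar>b - c * of_int j\<bar> < 1}"
  have "S \<subseteq> {\<lfloor>(b - 1) / c\<rfloor>..\<lceil>(b + 1) / c\<rceil>}"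
  proof
    fix j assume "j \<in> S"
    then have "(b - 1) / c \<le> of_int j" "of_int j \<le> (b + 1) / c"
      using c by (auto simp: S_def field_simps abs_less_iff)
    then show "j \<in> {\<lfloor>(b - 1) / c\<rfloor>..\<lceil>(b + 1) / c\<rceil>}"
      by (simp add: floor_le_iff le_ceiling_iff)
  qed
  then have fin: "finite S"
    by (rule finite_subset) simp
  have far: "norm (?d j) \<le> 2" if "j \<notin> S" for j
  proof -
    have e: "2 \<le> exp (1 :: real)"
      using exp_ge_add_one_self[of 1] by simp
    have "1 / 2 \<le> norm (1 - y * qpow \<tau> (of_int j))"
    proof (cases "b - c * of_int j \<ge> 1")
      case True
      then have "2 \<le> norm (y * qpow \<tau> (of_int j))"
        unfolding norm using e by (intro order.trans[OF e]) simp
      then show ?thesis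
        using norm_triangle_ineq2[of "y * qpow \<tau> (of_int j)" 1] by (simp add: norm_minus_commute)
    next
      case False
      then have "b - c * of_int j \<le> - 1"
        using that by (auto simp: S_def)
      then have "norm (y * qpow \<tau> (of_int j)) \<le> exp (- 1)"
        unfolding norm by simp
      also have "exp (- 1) \<le> (1 / 2 :: real)"
        using e by (simp add: exp_minus field_simps)
      finally show ?thesis
        using norm_triangle_ineq2[of 1 "y * qpow \<tau> (of_int j)"] by simp
    qed
    then have "inverse (norm (1 - y * qpow \<tau> (of_int j))) \<le> inverse (1 / 2)"
      by (intro le_imp_inverse_le) auto
    then show ?thesis
      by (simp add: norm_inverse)
  qed
  define C where "C = 2 + (\<Sum>j\<in>S. norm (?d j))"
  have "norm (?d j) \<le> C" for j
  proof (cases "j \<in> S")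
    case True
    then have "norm (?d j) \<le> (\<Sum>j\<in>S. norm (?d j))"
      using fin by (intro member_le_sum) auto
    then show ?thesis
      by (simp add: C_def)
  next
    case False
    then show ?thesis
      using far[OF False] by (simp add: C_def sum_nonneg add_increasing2)
  qed
  then show ?thesis
    by (rule that)
qed

text \<open>The two arguments of parts 1 (\<open>\<delta> = 1\<close>) and 2 (\<open>\<delta> = 0\<close>); \<open>\<sigma> = (-1)\<^sup>\<delta>\<close>.\<close>

locale half_period =
  fixes \<tau> z \<sigma> :: complex and \<delta> :: nat and M :: int and m :: real
  assumes tau: "Im \<tau> > 0"
    and delta: "\<delta> = 0 \<or> \<delta> = 1"
    and sigma: "\<sigma> = (-1) ^ \<delta>"
    and M: "M \<ge> 1"
    and m: "m = of_int M - 1 / 2"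
begin

lemma sigma_square: "\<sigma> * \<sigma> = 1" "\<sigma> \<noteq> 0"
  using sigma delta by auto

lemma m_pos: "m > 0"
  using M by (simp add: m)

definition z1 :: complex where "z1 = z / 2 + \<tau> / 2 - of_nat \<delta> / 2"
definition z2 :: complex where "z2 = z / 2 - \<tau> / 2 + of_nat \<delta> / 2"

text \<open>The quantity y subtracted from 1 in the j-th denominator of \<open>Phi1\<close>; a pole
  occurs where it equals 1.\<close>

definition phi_pole :: "int \<Rightarrow> complex" where
  "phi_pole j = \<sigma> * xpow z 1 * qpow \<tau> (of_int j + 1 / 2)"

text \<open>Appears twice: as the coefficient of the theta function of characteristic k in the
  finite form of \<open>Phi\<close>, and as the exponential in \<open>R_fun\<close> at n = k. This
  coincidence is what makes the completion cancel.\<close>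

definition weight :: "real \<Rightarrow> complex" where
  "weight k = exp (- (of_real pi * \<i> * of_nat \<delta> * of_real k)) * qpow \<tau> (k / 2 - k\<^sup>2 / (4 * m))"

definition phi_num :: "int \<Rightarrow> complex" where
  "phi_num j = (-1) powi j * exp (- (of_real pi * \<i> * of_nat \<delta> / 2)) * (xpow z (2 * m * of_int j + 1 / 2) * qpow \<tau> (m * (of_int j)\<^sup>2 + of_int j / 2 + 1 / 4))"

lemma exp_delta: "exp (of_real pi * \<i> * of_nat \<delta>) = \<sigma>" "exp (- (of_real pi * \<i> * of_nat \<delta>)) = \<sigma>"
  using delta sigma by (auto simp: exp_minus)

lemma exp_z1: "exp (2 * of_real pi * \<i> * z1) * qpow \<tau> (of_int j) = phi_pole j"
proof -
  have "exp (2 * of_real pi * \<i> * z1) * qpow \<tau> (of_int j) = exp (- (of_real pi * \<i> * of_nat \<delta>)) * (xpow z 1 * qpow \<tau> (of_int j + 1 / 2))"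
    unfolding z1_def xpow_def qpow_def exp_add[symmetric] by (rule arg_cong[of _ _ exp]) (simp add: field_simps)
  then show ?thesis
    by (simp add: exp_delta phi_pole_def)
qed

lemma exp_z2: "exp (- 2 * of_real pi * \<i> * z2) * qpow \<tau> (of_int (- 1 - j)) = 1 / phi_pole j"
proof -
  have "exp (- 2 * of_real pi * \<i> * z2) * qpow \<tau> (of_int (- 1 - j)) * (xpow z 1 * qpow \<tau> (of_int j + 1 / 2)) = exp (- (of_real pi * \<i> * of_nat \<delta>))"
    unfolding z2_def xpow_def qpow_def exp_add[symmetric] by (rule arg_cong[of _ _ exp]) (simp add: field_simps)
  then have "exp (- 2 * of_real pi * \<i> * z2) * qpow \<tau> (of_int (- 1 - j)) * phi_pole j = \<sigma> * \<sigma>"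
    unfolding phi_pole_def exp_delta by (simp only: mult_ac)
  moreover have "phi_pole j \<noteq> 0"
    using sigma_square by (simp add: phi_pole_def)
  ultimately show ?thesis
    using sigma_square by (simp only: nonzero_eq_divide_eq not_False_eq_True)
qed

lemma Phi1_num: "exp (2 * of_real pi * \<i> * of_real m * of_int j * (z1 + z2) + 2 * of_real pi * \<i> * of_real (1 / 2) * z1)
    * qpow \<tau> (m * (of_int j)\<^sup>2 + 1 / 2 * of_int j) * (-1) powi j = phi_num j"
proof -
  have "exp (2 * of_real pi * \<i> * of_real m * of_int j * (z1 + z2) + 2 * of_real pi * \<i> * of_real (1 / 2) * z1)
    * qpow \<tau> (m * (of_int j)\<^sup>2 + 1 / 2 * of_int j)
    = exp (- (of_real pi * \<i> * of_nat \<delta> / 2)) * (xpow z (2 * m * of_int j + 1 / 2) * qpow \<tau> (m * (of_int j)\<^sup>2 + of_int j / 2 + 1 / 4))"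
    unfolding z1_def z2_def xpow_def qpow_def exp_add[symmetric] by (rule arg_cong[of _ _ exp]) (simp add: field_simps)
  then show ?thesis
    unfolding phi_num_def by (simp only: mult_ac)
qed

lemma phi_pole_power: "phi_pole j ^ n = \<sigma> ^ n * (xpow z (of_nat n) * qpow \<tau> (of_nat n * (of_int j + 1 / 2)))"
proof -
  have "xpow z 1 ^ n = xpow z (of_nat n)"
    by (simp add: xpow_def mult_ac flip: exp_of_nat_mult)
  then show ?thesis
    by (simp add: phi_pole_def power_mult_distrib qpow_power mult_ac)
qed

text \<open>The reflection j -> -1 - j fits the half-integral shift of q in \<open>phi_pole\<close>
  and brings both series over the same denominators; the numerators then differ by y^(2m). As 2m is
  odd, \<sigma>^(2m) = \<sigma>.\<close>

lemma Phi2_num: "exp (- 2 * of_real pi * \<i> * of_real m * of_int (- 1 - j) * (z1 + z2) - 2 * of_real pi * \<i> * of_real (1 / 2) * z2)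
    * qpow \<tau> (m * (of_int (- 1 - j))\<^sup>2 + 1 / 2 * of_int (- 1 - j)) * (-1) powi (- 1 - j) * phi_pole j
    = - phi_num j * phi_pole j ^ nat (2 * M - 1)"
proof -
  have n: "real (nat (2 * M - 1)) = 2 * m" "odd (nat (2 * M - 1))"
    using M by (auto simp: m even_nat_iff)
  then have "\<sigma> ^ nat (2 * M - 1) = \<sigma>"
    using delta sigma by auto
  note sigma_n = this
  have exps: "exp (- 2 * of_real pi * \<i> * of_real m * of_int (- 1 - j) * (z1 + z2) - 2 * of_real pi * \<i> * of_real (1 / 2) * z2)
      * qpow \<tau> (m * (of_int (- 1 - j))\<^sup>2 + 1 / 2 * of_int (- 1 - j)) * (xpow z 1 * qpow \<tau> (of_int j + 1 / 2))
    = exp (- (of_real pi * \<i> * of_nat \<delta> / 2)) * (xpow z (2 * m * of_int j + 1 / 2) * qpow \<tau> (m * (of_int j)\<^sup>2 + of_int j / 2 + 1 / 4))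
      * (xpow z (2 * m) * qpow \<tau> (2 * m * (of_int j + 1 / 2)))" (is "?E * ?x = ?N * ?Y")
    unfolding z1_def z2_def xpow_def qpow_def exp_add[symmetric]
    by (rule arg_cong[of _ _ exp]) (simp add: field_simps power2_eq_square)
  have neg: "(-1) powi (- 1 - j) = - ((-1) powi j :: complex)"
    by (simp add: power_int_diff power_int_minus_left)
  have "?E * (-1) powi (- 1 - j) * phi_pole j = - ((-1) powi j) * \<sigma> * (?E * ?x)"
    unfolding neg phi_pole_def by (simp only: mult_ac mult_minus_left mult_minus_right)
  also have "\<dots> = - ((-1) powi j) * \<sigma> * (?N * ?Y)"
    by (simp only: exps)
  also have "\<dots> = - phi_num j * phi_pole j ^ nat (2 * M - 1)"
    unfolding phi_pole_power n(1) sigma_n phi_num_def by (simp only: mult_ac mult_minus_left mult_minus_right)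
  finally show ?thesis .
qed

lemma phi_num_pole: "phi_num j * phi_pole j ^ i = weight (i + 1 / 2)
  * ((-1) powi j * xpow z (2 * m * of_int j + (i + 1 / 2)) * qpow \<tau> ((2 * m * of_int j + (i + 1 / 2))\<^sup>2 / (4 * m)))"
proof -
  have "\<sigma> ^ i = exp (of_nat i * (- (of_real pi * \<i> * of_nat \<delta>)))"
    unfolding exp_of_nat_mult exp_delta ..
  note sigma_i = this
  have phase: "exp (- (of_real pi * \<i> * of_nat \<delta> / 2)) * \<sigma> ^ i = exp (- (of_real pi * \<i> * of_nat \<delta> * of_real (i + 1 / 2)))"
    unfolding sigma_i exp_add[symmetric] by (rule arg_cong[of _ _ exp]) (simp add: field_simps)
  have xs: "xpow z (2 * m * of_int j + 1 / 2) * xpow z (of_nat i) = xpow z (2 * m * of_int j + (i + 1 / 2))"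
    unfolding xpow_add[symmetric] by (simp add: add_ac)
  have qs: "qpow \<tau> (m * (of_int j)\<^sup>2 + of_int j / 2 + 1 / 4) * qpow \<tau> (of_nat i * (of_int j + 1 / 2))
      = qpow \<tau> ((i + 1 / 2) / 2 - (i + 1 / 2)\<^sup>2 / (4 * m)) * qpow \<tau> ((2 * m * of_int j + (i + 1 / 2))\<^sup>2 / (4 * m))"
    unfolding qpow_add[symmetric] using m_pos
    by (intro arg_cong[of _ _ "qpow \<tau>"]) (simp add: field_simps power2_eq_square)
  have "phi_num j * phi_pole j ^ i = (-1) powi j * (exp (- (of_real pi * \<i> * of_nat \<delta> / 2)) * \<sigma> ^ i)
      * (xpow z (2 * m * of_int j + 1 / 2) * xpow z (of_nat i))
      * (qpow \<tau> (m * (of_int j)\<^sup>2 + of_int j / 2 + 1 / 4) * qpow \<tau> (of_nat i * (of_int j + 1 / 2)))"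
    unfolding phi_num_def phi_pole_power by (simp only: mult_ac)
  then show ?thesis
    unfolding phase xs qs weight_def by (simp only: mult_ac)
qed

lemma summable_phi_num_pole: "(\<lambda>j. phi_num j * phi_pole j ^ i) summable_on S"
  unfolding phi_num_pole by (intro summable_on_cmult_right theta_summand_summable tau m_pos) simp

lemma Phi_closed_form:
  assumes "\<And>j. phi_pole j \<noteq> 1"
  shows "Phi (-1) m (1 / 2) \<tau> z1 z2 0 = (\<Sum>i<nat (2 * M - 1). weight (i + 1 / 2) * theta (-1) (i + 1 / 2) m \<tau> z)"
proof -
  let ?n = "nat (2 * M - 1)"
  have nz: "phi_pole j \<noteq> 0" for j
    using sigma_square by (simp add: phi_pole_def)
  \<comment> \<open>Both series must converge separately before their difference can be taken
    termwise; bounded inverses of the denominators give this.\<close>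
  obtain C where C: "\<And>j. norm (inverse (1 - phi_pole j)) \<le> C"
    using denominator_bounded[of \<tau> "exp (2 * of_real pi * \<i> * z1)"] tau assms unfolding exp_z1 by auto
  have summ: "(\<lambda>j. phi_num j * phi_pole j ^ i * inverse (1 - phi_pole j)) summable_on UNIV" for i
    by (rule summable_mult_bounded[OF summable_phi_num_pole C])
  have "Phi1 (-1) m (1 / 2) \<tau> z1 z2 0 = (\<Sum>\<^sub>\<infinity>j. phi_num j * phi_pole j ^ 0 * inverse (1 - phi_pole j))"
  proof -
    have "(-1) powi j * (exp (2 * of_real pi * \<i> * of_real m * of_int j * (z1 + z2) + 2 * of_real pi * \<i> * of_real (1 / 2) * z1)
        * qpow \<tau> (m * (of_int j)\<^sup>2 + 1 / 2 * of_int j)) / (1 - exp (2 * of_real pi * \<i> * z1) * qpow \<tau> (of_int j))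
      = phi_num j * phi_pole j ^ 0 * inverse (1 - phi_pole j)" for j
      unfolding exp_z1 Phi1_num[symmetric] divide_inverse by (simp only: mult_ac power_0 mult_1_left mult_1_right)
    then show ?thesis
      unfolding Phi1_def by (simp only: mult_zero_right exp_zero mult_1_left)
  qed
  moreover have "Phi2 (-1) m (1 / 2) \<tau> z1 z2 0 = (\<Sum>\<^sub>\<infinity>j. phi_num j * phi_pole j ^ ?n * inverse (1 - phi_pole j))"
  proof -
    let ?N = "\<lambda>j. exp (- 2 * of_real pi * \<i> * of_real m * of_int j * (z1 + z2) - 2 * of_real pi * \<i> * of_real (1 / 2) * z2)
        * qpow \<tau> (m * (of_int j)\<^sup>2 + 1 / 2 * of_int j)"
    have "(\<Sum>\<^sub>\<infinity>j. phi_num j * phi_pole j ^ ?n * inverse (1 - phi_pole j))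
      = (\<Sum>\<^sub>\<infinity>j::int. (-1) powi j * ?N j / (1 - exp (- 2 * of_real pi * \<i> * z2) * qpow \<tau> (of_int j)))"
    proof (rule infsum_reindex_bij_witness[of _ "\<lambda>j. - 1 - j" "\<lambda>j. - 1 - j"])
      fix j :: int
      have "?N (- 1 - j) * (-1) powi (- 1 - j) * phi_pole j = - phi_num j * phi_pole j ^ ?n"
        by (rule Phi2_num)
      then have N: "(-1) powi (- 1 - j) * ?N (- 1 - j) = - phi_num j * phi_pole j ^ ?n / phi_pole j"
        using nz[of j] by (simp only: nonzero_eq_divide_eq not_False_eq_True) (simp only: mult_ac)
      show "(-1) powi (- 1 - j) * ?N (- 1 - j) / (1 - exp (- 2 * of_real pi * \<i> * z2) * qpow \<tau> (of_int (- 1 - j)))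
        = phi_num j * phi_pole j ^ ?n * inverse (1 - phi_pole j)"
        unfolding N exp_z2 using nz[of j] assms[of j] by (simp add: field_simps)
    qed auto
    then show ?thesis
      unfolding Phi2_def by (simp only: mult_zero_right exp_zero mult_1_left)
  qed
  ultimately have "Phi (-1) m (1 / 2) \<tau> z1 z2 0
      = (\<Sum>\<^sub>\<infinity>j. phi_num j * phi_pole j ^ 0 * inverse (1 - phi_pole j)) + - (\<Sum>\<^sub>\<infinity>j. phi_num j * phi_pole j ^ ?n * inverse (1 - phi_pole j))"
    unfolding Phi_def by simp
  also have "\<dots> = (\<Sum>\<^sub>\<infinity>j. phi_num j * phi_pole j ^ 0 * inverse (1 - phi_pole j) + - (phi_num j * phi_pole j ^ ?n * inverse (1 - phi_pole j)))"
    unfolding infsum_uminus[symmetric] by (rule infsum_add[symmetric, OF summ summable_on_uminus[THEN iffD2, OF summ]])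
  also have "\<dots> = (\<Sum>\<^sub>\<infinity>j. \<Sum>i<?n. phi_num j * phi_pole j ^ i * 1)"
  proof (rule infsum_cong)
    fix j
    have "(1 - phi_pole j) * (\<Sum>i<?n. phi_pole j ^ i) = 1 - phi_pole j ^ ?n"
      by (rule one_diff_power_eq[symmetric])
    then have "(1 - phi_pole j ^ ?n) * inverse (1 - phi_pole j) = (\<Sum>i<?n. phi_pole j ^ i)"
      using assms[of j] by (simp add: field_simps)
    moreover have "phi_num j * phi_pole j ^ 0 * inverse (1 - phi_pole j) + - (phi_num j * phi_pole j ^ ?n * inverse (1 - phi_pole j))
      = phi_num j * ((1 - phi_pole j ^ ?n) * inverse (1 - phi_pole j))"
      by (simp add: algebra_simps)
    ultimately show "phi_num j * phi_pole j ^ 0 * inverse (1 - phi_pole j) + - (phi_num j * phi_pole j ^ ?n * inverse (1 - phi_pole j)) = (\<Sum>i<?n. phi_num j * phi_pole j ^ i * 1)"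
      by (simp add: sum_distrib_left)
  qed
  also have "\<dots> = (\<Sum>i<?n. (\<Sum>\<^sub>\<infinity>j. phi_num j * phi_pole j ^ i) * 1)"
    by (rule infsum_sum_complex) (auto intro: summable_phi_num_pole)
  also have "\<dots> = (\<Sum>i<?n. weight (i + 1 / 2) * theta (-1) (i + 1 / 2) m \<tau> z)"
    unfolding phi_num_pole infsum_cmult_right' theta_altdef[OF m_pos] by simp
  finally show ?thesis .
qed

lemma two_m: "2 * m = of_int (2 * M - 1)"
  by (simp add: m)

text \<open>Summand of \<open>R_fun\<close> at \<open>n = k + 2 m l\<close>; the line \<open>Im w / Im \<tau> = 1/2\<close> makes the argument of
  \<open>E_fun\<close> odd about \<open>n = m\<close>.\<close>

definition rterm :: "real \<Rightarrow> int \<Rightarrow> complex" where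
  "rterm k l = (-1) powi l * of_real (sgn (2 * m * (of_int l + 1) - 1 / 2)
     - E_fun ((k + 2 * m * of_int l - m) * sqrt (Im \<tau> / m))) * weight (k + 2 * m * of_int l)"

lemma R_fun_rterm:
  fixes \<kappa> :: int
  defines "k \<equiv> of_int \<kappa> + 1 / 2"
  shows "R_fun (-1) k m \<tau> ((z1 - z2) / 2) = (\<Sum>\<^sub>\<infinity>l. rterm k l)"
  unfolding R_fun_def
proof (rule infsum_reindex_bij_witness[of _ "\<lambda>l. k + 2 * m * of_int l" "\<lambda>n. \<lfloor>(n - k) / (2 * m)\<rfloor>"])
  fix n assume "n \<in> {n \<in> half_ints. \<exists>l::int. n - k = 2 * m * of_int l}"
  then obtain l :: int where l: "n - k = 2 * m * of_int l"
    by blast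
  then have n: "n = k + 2 * m * of_int l" and fl: "\<lfloor>(n - k) / (2 * m)\<rfloor> = l"
    using m_pos by auto
  then show "k + 2 * m * of_int \<lfloor>(n - k) / (2 * m)\<rfloor> = n"
    by simp
  have Im: "Im ((z1 - z2) / 2) / Im \<tau> = 1 / 2"
    using tau by (simp add: z1_def z2_def)
  have "exp (- (of_real pi * \<i> * \<tau> / of_real (2 * m)) * of_real (n\<^sup>2) + 2 * of_real pi * \<i> * of_real n * ((z1 - z2) / 2)) = weight n"
    unfolding weight_def qpow_def exp_add[symmetric] z1_def z2_def using m_pos
    by (intro arg_cong[of _ _ exp]) (simp add: field_simps power2_eq_square)
  moreover have "sgn (n - 1 / 2 - k + 2 * m) = sgn (2 * m * (of_int l + 1) - 1 / 2)"
    unfolding n by (rule arg_cong[of _ _ sgn]) (simp add: algebra_simps)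
  ultimately show "rterm k \<lfloor>(n - k) / (2 * m)\<rfloor> = (-1) powi \<lfloor>(n - k) / (2 * m)\<rfloor>
      * of_real (sgn (n - 1 / 2 - k + 2 * m) - E_fun ((n - 2 * m * (Im ((z1 - z2) / 2) / Im \<tau>)) * sqrt (Im \<tau> / m)))
      * exp (- (of_real pi * \<i> * \<tau> / of_real (2 * m)) * of_real (n\<^sup>2) + 2 * of_real pi * \<i> * of_real n * ((z1 - z2) / 2))"
    unfolding fl Im rterm_def n by simp
next
  fix l :: int
  show "\<lfloor>(k + 2 * m * of_int l - k) / (2 * m)\<rfloor> = l"
    using m_pos by simp
  have "k + 2 * m * of_int l = of_int (2 * \<kappa> + 1 + 2 * (2 * M - 1) * l) / 2"
    unfolding two_m k_def by (simp add: field_simps)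
  then have "k + 2 * m * of_int l \<in> half_ints"
    unfolding half_ints_def by blast
  then show "k + 2 * m * of_int l \<in> {n \<in> half_ints. \<exists>l::int. n - k = 2 * m * of_int l}"
    by auto
qed auto

lemma norm_weight: "norm (weight n) = exp (- (2 * pi * Im \<tau> * (n / 2 - n\<^sup>2 / (4 * m))))"
  by (simp add: weight_def norm_mult norm_qpow)

text \<open>The shift by 1/2 only decides l = -1, where 2m(l + 1) = 0; at l = 0 it is harmless since
  2m \<ge> 1.\<close>

lemma sgn_step: "sgn (2 * m * (of_int l + 1) - 1 / 2) = (if l \<ge> 0 then 1 else -1 :: real)"
proof (cases "l \<ge> 0")
  case True
  then have "0 \<le> real_of_int ((2 * M - 1) * l)"
    using M by simp
  then have "1 \<le> 2 * m * (of_int l + 1)"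
    unfolding two_m using M by (simp add: distrib_left)
  then show ?thesis
    using True by simp
next
  case False
  then have "2 * m * (of_int l + 1) \<le> 0"
    using m_pos by (intro mult_nonneg_nonpos) auto
  then show ?thesis
    using False by simp
qed

text \<open>With n = k + 2ml, \<open>weight\<close> grows like exp(\<pi> Im \<tau> n^2 / (2m)), but
  the bracket decays like exp(-\<pi> Im \<tau> (n - m)^2 / m), which has twice the rate.\<close>

lemma summable_rterm:
  assumes "0 < k" "k < 2 * m"
  shows "rterm k summable_on UNIV"
proof -
  have "rterm k summable_on - {0}"
  proof (rule summable_gaussian[where c = "2 * pi * m * Im \<tau>" and b = "- (2 * pi * Im \<tau> * (k - m))"
        and K = "exp (- (pi * Im \<tau> * (k\<^sup>2 / (2 * m) - k + m)))"])
    show "2 * pi * m * Im \<tau> > 0"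
      using m_pos tau by simp
    fix l :: int assume "l \<in> - {0}"
    then have l: "l \<ge> 1 \<or> l \<le> -1"
      by auto
    let ?n = "k + 2 * m * of_int l"
    let ?x = "(?n - m) * sqrt (Im \<tau> / m)"
    have "sgn (2 * m * (of_int l + 1) - 1 / 2) = 1 \<and> ?x \<ge> 0 \<or> sgn (2 * m * (of_int l + 1) - 1 / 2) = -1 \<and> ?x \<le> (0::real)"
      using l
    proof
      assume "l \<ge> 1"
      then have "m * 1 \<le> m * of_int l"
        using m_pos by (intro mult_left_mono) auto
      then have "0 \<le> ?n - m"
        using assms m_pos by linarith
      then show ?thesis
        unfolding sgn_step using \<open>l \<ge> 1\<close> tau m_pos by simp
    next
      assume "l \<le> -1"
      then have "m * of_int l \<le> m * (-1)"
        using m_pos by (intro mult_left_mono) auto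
      then have "?n - m \<le> 0"
        using assms m_pos by linarith
      then show ?thesis
        unfolding sgn_step using \<open>l \<le> -1\<close> tau m_pos by (simp add: mult_nonpos_nonneg)
    qed
    then have "norm (rterm k l) \<le> exp (- pi * ?x\<^sup>2) * norm (weight ?n)"
      unfolding rterm_def norm_mult norm_of_real
      by (intro mult_right_mono) (use E_fun_sgn_bound in \<open>auto simp: norm_power_int\<close>)
    also have "\<dots> = exp (- (pi * Im \<tau> * (k\<^sup>2 / (2 * m) - k + m))) * exp (- (2 * pi * m * Im \<tau>) * (of_int l)\<^sup>2 + - (2 * pi * Im \<tau> * (k - m)) * of_int l)"
    proof -
      have "(sqrt (Im \<tau> / m))\<^sup>2 = Im \<tau> / m"
        using tau m_pos by (intro real_sqrt_pow2) simp
      then have sq: "?x\<^sup>2 = (?n - m)\<^sup>2 * (Im \<tau> / m)"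
        by (simp only: power_mult_distrib)
      show ?thesis
        unfolding norm_weight exp_add[symmetric] sq using m_pos
        by (intro arg_cong[of _ _ exp]) (simp add: field_simps power2_eq_square)
    qed
    finally show "norm (rterm k l) \<le> exp (- (pi * Im \<tau> * (k\<^sup>2 / (2 * m) - k + m))) * exp (- (2 * pi * m * Im \<tau>) * (of_int l)\<^sup>2 + - (2 * pi * Im \<tau> * (k - m)) * of_int l)" .
  qed
  then have "rterm k summable_on insert 0 (- {0})"
    by (simp add: summable_on_insert_iff)
  then show ?thesis
    by (simp add: insert_UNIV Compl_eq_Diff_UNIV)
qed

text \<open>The exponent k/2 - k^2/(4m) is symmetric about k = m, and the phase changes by
  e^(2\<pi>i\<delta>(k - m)), which is 1 because k - m is an integer.\<close>

lemma weight_reflect: "weight (2 * m - (of_int \<kappa> + 1 / 2)) = weight (of_int \<kappa> + 1 / 2)"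
proof -
  let ?k = "real_of_int \<kappa> + 1 / 2"
  have "exp (- (of_real pi * \<i> * of_nat \<delta> * of_real (2 * m - ?k))) = exp (- (of_real pi * \<i> * of_nat \<delta> * of_real ?k))
      * exp (2 * of_int (\<delta> * (\<kappa> + 1 - M)) * of_real pi * \<i>)"
    unfolding exp_add[symmetric] m by (rule arg_cong[of _ _ exp]) (simp add: field_simps)
  also have "exp (2 * of_int (\<delta> * (\<kappa> + 1 - M)) * of_real pi * \<i>) = 1"
    using exp_integer_2pi[of "of_int (\<delta> * (\<kappa> + 1 - M))"] by (simp add: mult_ac)
  finally show ?thesis
    unfolding weight_def using m_pos by (simp add: field_simps power2_eq_square)
qed

lemma R_fun_pair:
  fixes \<kappa> :: int
  assumes "\<kappa> \<ge> 0" "\<kappa> < 2 * M - 1"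
  shows "R_fun (-1) (of_int \<kappa> + 1 / 2) m \<tau> ((z1 - z2) / 2) + R_fun (-1) (of_int (2 * M - 2 - \<kappa>) + 1 / 2) m \<tau> ((z1 - z2) / 2)
    = 2 * weight (of_int \<kappa> + 1 / 2)"
proof -
  define k where "k = real_of_int \<kappa> + 1 / 2"
  have k': "real_of_int (2 * M - 2 - \<kappa>) + 1 / 2 = 2 * m - k"
    by (simp add: k_def m)
  have "real_of_int \<kappa> + 1 \<le> of_int (2 * M - 1)"
    using assms(2) by linarith
  then have k: "0 < k" "k < 2 * m"
    using assms(1) unfolding two_m by (simp_all add: k_def)
  have refl: "rterm (2 * m - k) (- l) = (-1) powi l * of_real (sgn (2 * m * (of_int (- l) + 1) - 1 / 2)
      + E_fun ((k + 2 * m * of_int l - m) * sqrt (Im \<tau> / m))) * weight (k + 2 * m * of_int l)" for l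
  proof -
    have n: "k + 2 * m * of_int l = of_int (\<kappa> + (2 * M - 1) * l) + 1 / 2"
      unfolding two_m k_def by simp
    have "2 * m - k + 2 * m * of_int (- l) = 2 * m - (k + 2 * m * of_int l)"
      by simp
    then have "weight (2 * m - k + 2 * m * of_int (- l)) = weight (k + 2 * m * of_int l)"
      unfolding n by (simp only: weight_reflect)
    moreover have "(2 * m - k + 2 * m * of_int (- l) - m) * sqrt (Im \<tau> / m) = - ((k + 2 * m * of_int l - m) * sqrt (Im \<tau> / m))"
      by (simp add: algebra_simps)
    ultimately show ?thesis
      unfolding rterm_def by (simp add: E_fun_minus powi_sign_minus)
  qed
  have "(\<Sum>\<^sub>\<infinity>l. rterm (2 * m - k) l) = (\<Sum>\<^sub>\<infinity>l. rterm (2 * m - k) (- l))"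
    by (rule infsum_reindex_bij_witness[of _ uminus uminus]) auto
  moreover have "(\<lambda>l. rterm (2 * m - k) (- l)) summable_on UNIV"
    using summable_rterm[of "2 * m - k"] k
    by (subst summable_on_reindex_bij_witness[of _ uminus uminus UNIV "rterm (2 * m - k)"]) auto
  ultimately have "(\<Sum>\<^sub>\<infinity>l. rterm k l) + (\<Sum>\<^sub>\<infinity>l. rterm (2 * m - k) l) = (\<Sum>\<^sub>\<infinity>l. rterm k l + rterm (2 * m - k) (- l))"
    using summable_rterm[OF k] by (simp add: infsum_add)
  \<comment> \<open>The values of \<open>E_fun\<close> cancel for every l. The signs at l and -l are
    opposite unless l = 0, where both are 1.\<close>
  also have "\<dots> = (\<Sum>\<^sub>\<infinity>l\<in>{0}. rterm k l + rterm (2 * m - k) (- l))"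
  proof (rule infsum_cong_neutral)
    fix l :: int assume "l \<in> UNIV - {0}"
    then show "rterm k l + rterm (2 * m - k) (- l) = 0"
      unfolding refl unfolding rterm_def sgn_step by (auto simp: algebra_simps)
  qed auto
  also have "\<dots> = 2 * weight k"
  proof -
    have "sgn (m * 2 - 1 / 2) = 1"
      using sgn_step[of 0] by (simp add: mult.commute)
    then show ?thesis
      using refl[of 0] by (simp add: rterm_def algebra_simps)
  qed
  finally show ?thesis
    unfolding k' R_fun_rterm k_def[symmetric] 
    using R_fun_rterm[of \<kappa>] R_fun_rterm[of "2 * M - 2 - \<kappa>"] unfolding k' k_def[symmetric] by simp
qed

lemma theta_reflect: "theta (-1) (2 * m - k) m \<tau> w = - theta (-1) (- k) m \<tau> w"
proof -
  have "theta (-1) (2 * m - k) m \<tau> w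
    = (\<Sum>\<^sub>\<infinity>n. - ((-1) powi n * xpow w (2 * m * of_int n + - k) * qpow \<tau> ((2 * m * of_int n + - k)\<^sup>2 / (4 * m))))"
    unfolding theta_altdef[OF m_pos]
  proof (rule infsum_reindex_bij_witness[of _ "\<lambda>n. n - 1" "\<lambda>n. n + 1"])
    fix n :: int
    have shift: "2 * m * of_int (n + 1) + - k = 2 * m * of_int n + (2 * m - k)"
      by (simp add: algebra_simps)
    show "- ((-1) powi (n + 1) * xpow w (2 * m * of_int (n + 1) + - k) * qpow \<tau> ((2 * m * of_int (n + 1) + - k)\<^sup>2 / (4 * m)))
      = (-1) powi n * xpow w (2 * m * of_int n + (2 * m - k)) * qpow \<tau> ((2 * m * of_int n + (2 * m - k))\<^sup>2 / (4 * m))"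
      unfolding shift by (simp add: power_int_add)
  qed auto
  then show ?thesis
    unfolding theta_altdef[OF m_pos] by (simp only: infsum_uminus)
qed

text \<open>The non-holomorphic completion cancels the finite theta sum \<open>\<Phi>\<close> at half periods.\<close>

lemma Phi_tilde_eq_0:
  assumes "\<And>j. phi_pole j \<noteq> 1"
  shows "Phi_tilde (-1) m (1 / 2) \<tau> z1 z2 0 = 0"
proof -
  let ?I = "{0..<2 * M - 1}"
  let ?k = "\<lambda>\<kappa>::int. real_of_int \<kappa> + 1 / 2"
  let ?R = "\<lambda>\<kappa>. R_fun (-1) (?k \<kappa>) m \<tau> ((z1 - z2) / 2)"
  let ?D = "\<lambda>\<kappa>. theta_diff (-1) (?k \<kappa>) m \<tau> z"
  let ?\<rho> = "\<lambda>\<kappa>. 2 * M - 2 - \<kappa>"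
  have rho: "?k (?\<rho> \<kappa>) = 2 * m - ?k \<kappa>" for \<kappa>
    by (simp add: m)
  have th: "theta (-1) (?k (?\<rho> \<kappa>)) m \<tau> z = - theta (-1) (- ?k \<kappa>) m \<tau> z" "theta (-1) (- ?k (?\<rho> \<kappa>)) m \<tau> z = - theta (-1) (?k \<kappa>) m \<tau> z" for \<kappa>
    using theta_reflect[of "?k \<kappa>" z] theta_reflect[of "?k (?\<rho> \<kappa>)" z] unfolding rho by simp_all
  have D: "?D (?\<rho> \<kappa>) = ?D \<kappa>" for \<kappa>
    unfolding theta_diff_def th by simp
  have reidx: "(\<Sum>\<kappa>\<in>?I. f \<kappa>) = (\<Sum>\<kappa>\<in>?I. f (?\<rho> \<kappa>))" for f :: "int \<Rightarrow> complex"
    by (rule sum.reindex_bij_witness[of _ ?\<rho> ?\<rho>]) auto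
  have "{k. k - 1 / 2 \<in> \<int> \<and> 1 / 2 \<le> k \<and> k < 1 / 2 + 2 * m} = ?k ` ?I"
  proof (intro equalityI subsetI)
    fix k assume k: "k \<in> {k. k - 1 / 2 \<in> \<int> \<and> 1 / 2 \<le> k \<and> k < 1 / 2 + 2 * m}"
    then obtain \<kappa> :: int where "k - 1 / 2 = of_int \<kappa>"
      by (auto elim: Ints_cases)
    then have "k = ?k \<kappa>"
      by simp
    moreover have "\<kappa> \<in> ?I"
      using k unfolding two_m \<open>k = ?k \<kappa>\<close> by auto
    ultimately show "k \<in> ?k ` ?I"
      by blast
  next
    fix k assume "k \<in> ?k ` ?I"
    then obtain \<kappa> where k: "k = ?k \<kappa>" "0 \<le> \<kappa>" "\<kappa> < 2 * M - 1"
      by auto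
    then have "of_int \<kappa> < real_of_int (2 * M - 1)"
      by linarith
    then show "k \<in> {k. k - 1 / 2 \<in> \<int> \<and> 1 / 2 \<le> k \<and> k < 1 / 2 + 2 * m}"
      using k unfolding two_m by simp
  qed
  moreover have "inj_on ?k ?I"
    by (auto simp: inj_on_def)
  moreover have "z1 + z2 = z"
    by (simp add: z1_def z2_def)
  ultimately have "Phi_add (-1) m (1 / 2) \<tau> z1 z2 0 = - (1 / 2) * (\<Sum>\<kappa>\<in>?I. ?R \<kappa> * ?D \<kappa>)"
    unfolding Phi_add_def by (simp add: sum.reindex)
  also have "(\<Sum>\<kappa>\<in>?I. ?R \<kappa> * ?D \<kappa>) = (\<Sum>\<kappa>\<in>?I. weight (?k \<kappa>) * ?D \<kappa>)"
  proof -
    \<comment> \<open>Adding the reflected copy makes the R-functions occur in the pairs of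
      \<open>R_fun_pair\<close>.\<close>
    have "2 * (\<Sum>\<kappa>\<in>?I. ?R \<kappa> * ?D \<kappa>) = (\<Sum>\<kappa>\<in>?I. ?R \<kappa> * ?D \<kappa>) + (\<Sum>\<kappa>\<in>?I. ?R (?\<rho> \<kappa>) * ?D (?\<rho> \<kappa>))"
      using reidx[of "\<lambda>\<kappa>. ?R \<kappa> * ?D \<kappa>"] by simp
    also have "\<dots> = (\<Sum>\<kappa>\<in>?I. (?R \<kappa> + ?R (?\<rho> \<kappa>)) * ?D \<kappa>)"
      unfolding D by (simp only: distrib_right sum.distrib)
    also have "\<dots> = (\<Sum>\<kappa>\<in>?I. 2 * (weight (?k \<kappa>) * ?D \<kappa>))"
      by (rule sum.cong) (use R_fun_pair in auto)
    finally show ?thesis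
      by (simp flip: sum_distrib_left)
  qed
  also have "\<dots> = 2 * (\<Sum>\<kappa>\<in>?I. weight (?k \<kappa>) * theta (-1) (?k \<kappa>) m \<tau> z)"
  proof -
    \<comment> \<open>Reflection turns the part with -k into minus the part with k. The resulting
      factor 2 cancels the 1/2 of \<open>Phi_add\<close>.\<close>
    have "(\<Sum>\<kappa>\<in>?I. weight (?k \<kappa>) * theta (-1) (- ?k \<kappa>) m \<tau> z) = (\<Sum>\<kappa>\<in>?I. weight (?k (?\<rho> \<kappa>)) * theta (-1) (- ?k (?\<rho> \<kappa>)) m \<tau> z)"
      by (rule reidx)
    also have "\<dots> = - (\<Sum>\<kappa>\<in>?I. weight (?k \<kappa>) * theta (-1) (?k \<kappa>) m \<tau> z)"
      unfolding th unfolding rho weight_reflect by (simp add: sum_negf)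
    finally show ?thesis
      unfolding theta_diff_def right_diff_distrib sum_subtractf by simp
  qed
  also have "(\<Sum>\<kappa>\<in>?I. weight (?k \<kappa>) * theta (-1) (?k \<kappa>) m \<tau> z) = Phi (-1) m (1 / 2) \<tau> z1 z2 0"
    unfolding Phi_closed_form[OF assms]
    by (rule sum.reindex_bij_witness[of _ int nat]) auto
  finally show ?thesis
    unfolding Phi_tilde_def by simp
qed

end

text \<open>At a pole the theta series becomes a full sum of \<open>pterm\<close> with parameter -j
  - 1, which vanishes. Read backwards, a nonzero denominator in the identities keeps z away from the
  poles of \<open>Phi\<close>.\<close>

lemma theta_zero:
  assumes "Im \<tau> > 0" "\<sigma> = 1 \<or> \<sigma> = -1" "\<sigma> * xpow z 1 * qpow \<tau> (of_int j + 1 / 2) = 1"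
  shows "theta (- \<sigma>) 0 (1 / 2) \<tau> z = 0"
proof -
  have x: "xpow z (of_int n) = \<sigma> powi n * qpow \<tau> (- (of_int n * (of_int j + 1 / 2)))" for n
  proof -
    have "xpow z 1 = \<sigma> * (\<sigma> * xpow z 1 * qpow \<tau> (of_int j + 1 / 2)) * inverse (qpow \<tau> (of_int j + 1 / 2))"
      using assms(2) by auto
    then have "xpow z 1 = \<sigma> * qpow \<tau> (- (of_int j + 1 / 2))"
      unfolding assms(3) qpow_minus by simp
    moreover have "xpow z (of_int n) = xpow z 1 powi n"
      by (simp add: xpow_def exp_power_int mult_ac)
    moreover have "qpow \<tau> u powi n = qpow \<tau> (of_int n * u)" for u
      by (simp add: qpow_def exp_power_int mult_ac)
    ultimately show ?thesis
      by (simp only: power_int_mult_distrib mult_minus_right)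
  qed
  have "(- \<sigma>) powi n * xpow z (2 * (1 / 2) * of_int n + 0) * qpow \<tau> ((2 * (1 / 2) * of_int n + 0)\<^sup>2 / (4 * (1 / 2))) = pterm \<tau> (- j - 1) n" for n
  proof -
    have "(- \<sigma>) powi n * \<sigma> powi n = (-1) powi n"
      using assms(2) by (auto simp flip: power_int_mult_distrib)
    moreover have "qpow \<tau> (- (of_int n * (of_int j + 1 / 2))) * qpow \<tau> ((of_int n)\<^sup>2 / 2) = qpow \<tau> (of_int n * (of_int n + 1) / 2 + of_int n * of_int (- j - 1))"
      by (rule qpow_mult) (simp add: power2_eq_square field_simps)
    ultimately show ?thesis
      by (simp add: x pterm_def mult.assoc[symmetric])
  qed
  then show ?thesis
    unfolding theta_altdef[of "1 / 2", simplified] using infsum_pterm_UNIV[OF assms(1)] by simp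
qed

section \<open>The three identities\<close>

lemma xpow_1_half_odd: "xpow 1 (of_int n + 1 / 2) = (-1) powi n * \<i>"
  by (simp add: xpow_add xpow_1_of_int xpow_1_half)

text \<open>For half-odd k the factor e^(\<pi>ik) is i or -i, hence odd in k. It turns sums over k
  and -k at z + 1 into the differences of the theorem.\<close>

lemma xpow_1_minus_half_odd: "xpow 1 (- (of_int n + 1 / 2)) = - xpow 1 (of_int n + 1 / 2)"
proof -
  have "- (of_int n + 1 / 2) = of_int (- n - 1) + (1 / 2 :: real)"
    by simp
  moreover have "(-1) powi (- n - 1) = - ((-1) powi n :: complex)"
    by (simp add: power_int_diff power_int_minus_left)
  ultimately show ?thesis
    by (simp only: xpow_1_half_odd) simp
qed

lemma xpow_1: "xpow 1 k = exp (of_real pi * \<i> * of_real k)"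
  by (simp add: xpow_def)

context theta_quotient
begin

lemma theta0_theta:
  assumes "P + 1 / 2 = of_int N + k"
  shows "theta0 w = (-1) powi N * theta (-1) k (1 / 2) \<tau> w"
proof -
  have "theta0 w = (\<Sum>\<^sub>\<infinity>n::int. (-1) powi N * ((-1) powi n * xpow w (2 * (1 / 2) * of_int n + k) * qpow \<tau> ((2 * (1 / 2) * of_int n + k)\<^sup>2 / (4 * (1 / 2)))))"
    unfolding theta0_def
  proof (rule infsum_reindex_bij_witness[of _ "\<lambda>n. n - N" "\<lambda>s. s + N"])
    fix s :: int
    have exponent: "s + P + 1 / 2 = 2 * (1 / 2) * of_int (s + N) + k"
      using assms by simp
    have "(-1) powi N * (-1) powi (s + N) = ((-1) powi s :: complex)"
      by (simp add: power_int_add power_int_minus_left)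
    then show "(-1) powi N * ((-1) powi (s + N) * xpow w (2 * (1 / 2) * of_int (s + N) + k) * qpow \<tau> ((2 * (1 / 2) * of_int (s + N) + k)\<^sup>2 / (4 * (1 / 2))))
      = (-1) powi s * xpow w (s + P + 1 / 2) * qpow \<tau> ((s + P + 1 / 2)\<^sup>2 / 2)"
      unfolding exponent by (simp add: mult.assoc[symmetric])
  qed auto
  then show ?thesis
    unfolding theta_altdef[of "1 / 2", simplified] by (simp add: infsum_cmult_right')
qed

text \<open>The form - (-1) is that of -\<epsilon> in the instances with \<epsilon> = -1, so that
  the equation rewrites them literally.\<close>

lemma theta_m_add_one: "theta (- (-1)) k m \<tau> (z + 1) = xpow 1 k * theta (-1) k m \<tau> z"
  using theta_add_one[of m "2 * M - 1" 1 k \<tau> z] m_pos by (simp add: m power_int_minus_left)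

lemma theta_M_add_one: "theta (-1) k M \<tau> (z + 1) = xpow 1 k * theta (-1) k M \<tau> z"
  using theta_add_one[of M "2 * M" "-1" k \<tau> z] M_pos by (simp add: power_int_minus_left)

lemma theta_m_m: "theta_diff (-1) m m \<tau> z = 2 * theta (-1) m m \<tau> z"
proof -
  \<comment> \<open>An auxiliary instance that provides \<open>theta_reflect\<close>, used at k =
    m.\<close>
  interpret half_period \<tau> z 1 0 M m
    by unfold_locales (use tau M m in auto)
  show ?thesis
    using theta_reflect[of m z] by (simp add: theta_diff_def)
qed

lemma exponent_strict: "of_int M * (of_int j + 2 * m * P / (2 * of_int M))\<^sup>2 - m * (r + P - K / (2 * m))\<^sup>2
  = (m + 1 / 2) * (of_int j + 2 * m * P / (2 * m + 1))\<^sup>2 - m * (r + P + (- K) / (2 * m))\<^sup>2"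
proof -
  have "of_int M = m + 1 / 2" "2 * of_int M = 2 * m + 1"
    by (simp_all add: m)
  then show ?thesis
    by (simp only: minus_divide_left[symmetric] diff_conv_add_uminus)
qed

lemma bracket_row:
  assumes "p2 \<ge> 1"
  shows "bracket_sum {- p2<..<0} {0..- p2} f = (\<Sum>a\<in>{- p2<..<0}. f a)"
  using assms by (simp add: bracket_sum_def)

end

context
  fixes m :: real and M :: int and p :: nat and \<tau> z :: complex
  assumes tau: "Im \<tau> > 0" and M: "M \<ge> 1" and m: "m = of_int M - 1 / 2"
begin

text \<open>Here P = p + 1/2, \<epsilon> = -1 and w = z + 1. The left side is 0, so the claim is
  that the theta quotient equals -X, the expansion of X supplying all other terms.\<close>

lemma quotient_identity_minus_half:
  assumes nz: "theta 1 0 (1 / 2) \<tau> z \<noteq> 0" and \<alpha>: "\<alpha> = m * (2 * real p + 1) / (2 * m + 1)"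
  shows "qpow \<tau> (- m / 4) * theta (-1) ((2 * real p + 1) * m) (m + 1 / 2) \<tau> 0
          * Phi_tilde (-1) m (1 / 2) \<tau> (z / 2 + \<tau> / 2 - 1 / 2) (z / 2 - \<tau> / 2 + 1 / 2) 0
        = - \<i> * dedekind_eta \<tau> ^ 3
            * (theta_diff (-1) (real p + 1 / 2) (m + 1 / 2) \<tau> z / theta 1 0 (1 / 2) \<tau> z)
          + bracket_sum {(j, r). 0 \<le> r \<and> r < j} {(j, r). j \<le> r \<and> r < 0}
            (\<lambda>(j::int, r::int). \<Sum>k \<in> {k \<in> half_odd_ints. 0 < k \<and> k \<le> m}.
               (-1) powi j * exp (of_real pi * \<i> * of_real k)
               * qpow \<tau> ((m + 1 / 2) * (of_int j + \<alpha>)\<^sup>2 - m * (of_int r + real p + (m + k) / (2 * m))\<^sup>2)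
               * theta_diff (-1) k m \<tau> z)
          + bracket_sum {(j, r). 0 \<le> r \<and> r \<le> j} {(j, r). j < r \<and> r < 0}
            (\<lambda>(j::int, r::int). \<Sum>k \<in> {k \<in> half_odd_ints. 0 < k \<and> k < m}.
               (-1) powi j * exp (of_real pi * \<i> * of_real k)
               * qpow \<tau> ((m + 1 / 2) * (of_int j + \<alpha>)\<^sup>2 - m * (of_int r + real p + (m - k) / (2 * m))\<^sup>2)
               * theta_diff (-1) k m \<tau> z)
          + theta (-1) ((2 * real p + 1) * m) (m + 1 / 2) \<tau> 0
            * (\<Sum>r \<in> {- int p<..int p}. \<Sum>k \<in> {k \<in> half_odd_ints. 0 < k \<and> k < m}.
                 exp (of_real pi * \<i> * of_real k) * qpow \<tau> (- m * (of_int r + (k - m) / (2 * m))\<^sup>2)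
                 * theta_diff (-1) k m \<tau> z)
          + exp (of_real pi * \<i> * of_real m) * theta (-1) ((2 * real p + 1) * m) (m + 1 / 2) \<tau> 0
            * (\<Sum>r \<in> {- int p..int p}. qpow \<tau> (- m * (of_int r)\<^sup>2) * theta (-1) m m \<tau> z)"
    (is "_ = ?Q + bracket_sum ?A1 ?B1 ?f1 + bracket_sum ?A2 ?B2 ?f2 + ?T * ?S3 + ?e * ?T * ?S4")
proof -
  let ?D = "theta_diff (-1) (real p + 1 / 2) (m + 1 / 2) \<tau> z"
  let ?b = "bracket_sum {- (2 * int p + 1)<..<0} {0..- (2 * int p + 1)} :: (int \<Rightarrow> complex) \<Rightarrow> complex"
  let ?K = "{k \<in> half_odd_ints. 0 < k \<and> k < m}"
  let ?\<theta> = "theta 1 0 (1 / 2) \<tau> z"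
  have mpos: "m > 0"
    using M by (simp add: m)
  interpret H: half_period \<tau> z "-1" 1 M m
    by unfold_locales (use tau M m in auto)
  interpret Q: theta_quotient \<tau> "-1" M "2 * int p + 1" m "real p + 1 / 2"
    by unfold_locales (use tau M m in auto)
  have "H.phi_pole j \<noteq> 1" for j
    using theta_zero[OF tau, of "-1" z j] nz unfolding H.phi_pole_def by auto
  then have lhs: "Phi_tilde (-1) m (1 / 2) \<tau> (z / 2 + \<tau> / 2 - 1 / 2) (z / 2 - \<tau> / 2 + 1 / 2) 0 = 0"
    using H.Phi_tilde_eq_0 unfolding H.z1_def H.z2_def by simp
  have Mm: "real_of_int M = m + 1 / 2"
    by (simp add: m)
  define d where "d k = exp (of_real pi * \<i> * of_real k) * theta_diff (-1) k m \<tau> z" for k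
  define X where "X = (\<Sum>k\<in>{0..<M - 1}. Q.quot_coeff k * d (k + 1 / 2)) + Q.quot_coeff (M - 1) * (d m / 2)"
  have dm: "d m / 2 = ?e * theta (-1) m m \<tau> z"
    by (simp add: d_def Q.theta_m_m)
  have "Q.theta0 (z + 1) * X = - (dedekind_eta \<tau> ^ 3) * ((-1) ^ p * \<i> * ?D)"
  proof -
    have pair: "theta (- (-1)) (of_int k + 1 / 2) m \<tau> (z + 1) - (-1) * theta (- (-1)) (- (of_int k + 1 / 2)) m \<tau> (z + 1) = d (of_int k + 1 / 2)" for k
      unfolding Q.theta_m_add_one xpow_1_minus_half_odd d_def theta_diff_def xpow_1[symmetric] by (simp add: algebra_simps)
    have last: "theta (- (-1)) m m \<tau> (z + 1) = d m / 2"
      unfolding Q.theta_m_add_one xpow_1 dm ..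
    have numerator: "theta (-1) (real p + 1 / 2) M \<tau> (z + 1) + (-1) * (-1) powi (2 * int p + 1) * theta (-1) (- (real p + 1 / 2)) M \<tau> (z + 1)
      = (-1) ^ p * \<i> * ?D"
      using xpow_1_half_odd[of "int p"] xpow_1_minus_half_odd[of "int p"]
      unfolding Q.theta_M_add_one unfolding Mm theta_diff_def by (simp add: power_int_add algebra_simps)
    show ?thesis
      using Q.theta0_quotient[of "z + 1"] unfolding X_def pair last numerator .
  qed
  moreover have "Q.theta0 (z + 1) = - ((-1) ^ p) * ?\<theta>"
    using Q.theta0_theta[of "int p + 1" 0 "z + 1"] theta_add_one[of "1 / 2" 1 "-1" 0 \<tau> z]
    by (simp add: power_int_add xpow_def)
  ultimately have "(-1) ^ p * (?\<theta> * X) = (-1) ^ p * (\<i> * dedekind_eta \<tau> ^ 3 * ?D)"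
    by (simp add: algebra_simps)
  then have "?\<theta> * X = \<i> * dedekind_eta \<tau> ^ 3 * ?D"
    by simp
  then have quot: "?Q = - X"
    using nz by (simp add: field_simps)
  have T: "theta (-1) (2 * m * (real p + 1 / 2)) M \<tau> 0 = ?T"
    unfolding Mm by (rule arg_cong[of _ _ "\<lambda>k. theta (-1) k (m + 1 / 2) \<tau> 0"]) (simp add: algebra_simps)
  have \<alpha>': "2 * m * (real p + 1 / 2) / (2 * m + 1) = \<alpha>"
    unfolding \<alpha> by (simp add: algebra_simps)
  have hterm: "Q.hecke_term K j r = (-1) powi j * qpow \<tau> ((m + 1 / 2) * (of_int j + \<alpha>)\<^sup>2 - m * (of_int r + real p + (m + - K) / (2 * m))\<^sup>2)" for K j r
  proof -
    have "of_int r + (real p + 1 / 2) + - K / (2 * m) = of_int r + real p + (m + - K) / (2 * m)"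
      using mpos by (simp add: field_simps)
    note expo = this
    show ?thesis
      unfolding Q.hecke_term_def Q.exponent_strict \<alpha>' expo by simp
  qed
  have f1: "?f1 = (\<lambda>(j, r). \<Sum>k\<in>{k \<in> half_odd_ints. 0 < k \<and> k \<le> m}. Q.hecke_term (- k) j r * d k)"
    unfolding hterm d_def by (simp add: mult_ac)
  have f2: "?f2 = (\<lambda>(j, r). \<Sum>k\<in>?K. Q.hecke_term k j r * d k)"
    unfolding hterm d_def by (simp add: mult_ac)
  have row: "?b (Q.row_coeff k)
      = (\<Sum>r\<in>{- int p<..int p}. qpow \<tau> (- m * (of_int r + (k - m) / (2 * m))\<^sup>2))" for k
  proof -
    have expo: "of_int a + (real p + 1 / 2) + k / (2 * m) = of_int (a + int p + 1) + (k - m) / (2 * m)" for a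
      using mpos by (simp add: field_simps)
    have "Q.row_coeff k a = qpow \<tau> (- m * (of_int (a + int p + 1) + (k - m) / (2 * m))\<^sup>2)" for a
      unfolding Q.row_coeff_def expo by simp
    then show ?thesis
      by (subst Q.bracket_row, simp)
        (rule sum.reindex_bij_witness[of _ "\<lambda>r. r - int p - 1" "\<lambda>a. a + int p + 1"], auto)
  qed
  have S3: "?S3 = (\<Sum>k\<in>?K. ?b (Q.row_coeff k) * d k)"
    unfolding row sum_distrib_right by (subst sum.swap) (simp add: d_def mult_ac)
  have S4: "?e * ?S4 = (Q.row_coeff m (-1) + ?b (Q.row_coeff m)) * (d m / 2)"
  proof -
    \<comment> \<open>The rows between the limits give -p < r \<le> p under r = a + p + 1. The
      additional row a = -1 has exponent -m p^2 and fills the place r = -p.\<close>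
    have "{- int p..int p} = insert (- int p) {- int p<..int p}"
      by auto
    then have "(\<Sum>r\<in>{- int p..int p}. qpow \<tau> (- m * (of_int r)\<^sup>2)) = qpow \<tau> (- m * (of_int (- int p))\<^sup>2) + (\<Sum>r\<in>{- int p<..int p}. qpow \<tau> (- m * (of_int r)\<^sup>2))"
      by simp
    also have "qpow \<tau> (- m * (of_int (- int p))\<^sup>2) = Q.row_coeff m (-1)"
      unfolding Q.row_coeff_def using mpos by simp
    finally have split: "(\<Sum>r\<in>{- int p..int p}. qpow \<tau> (- m * (of_int r)\<^sup>2)) = Q.row_coeff m (-1) + (\<Sum>r\<in>{- int p<..int p}. qpow \<tau> (- m * (of_int r)\<^sup>2))" .
    have rowm: "?b (Q.row_coeff m) = (\<Sum>r\<in>{- int p<..int p}. qpow \<tau> (- m * (of_int r)\<^sup>2))"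
      using row[of m] by simp
    show ?thesis
      unfolding dm rowm sum_distrib_right[symmetric] split by (simp only: mult_ac)
  qed
  have "X = bracket_sum ?A1 ?B1 ?f1 + bracket_sum ?A2 ?B2 ?f2 + ?T * ?S3 + ?T * (?e * ?S4)"
    unfolding X_def Q.quot_coeff_expansion f1 f2 S3 S4 T by simp
  then show ?thesis
    unfolding lhs quot by (simp add: mult_ac)
qed

text \<open>Here P = p + 1/2 and \<epsilon> = 1, evaluated at w = z itself: the thetas of index m
  already have sign (-).\<close>

lemma quotient_identity_plus_half:
  assumes nz: "theta (-1) 0 (1 / 2) \<tau> z \<noteq> 0" and \<alpha>: "\<alpha> = m * (2 * real p + 1) / (2 * m + 1)"
  shows "qpow \<tau> (- m / 4) * theta 1 ((2 * real p + 1) * m) (m + 1 / 2) \<tau> 0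
          * Phi_tilde (-1) m (1 / 2) \<tau> (z / 2 + \<tau> / 2) (z / 2 - \<tau> / 2) 0
        = dedekind_eta \<tau> ^ 3
            * (theta_diff 1 (real p + 1 / 2) (m + 1 / 2) \<tau> z / theta (-1) 0 (1 / 2) \<tau> z)
          + (-1) ^ p * bracket_sum {(j, r). 0 \<le> r \<and> r < j} {(j, r). j \<le> r \<and> r < 0}
            (\<lambda>(j::int, r::int). \<Sum>k \<in> {k \<in> half_odd_ints. 0 < k \<and> k \<le> m}.
               (-1) powi r
               * qpow \<tau> ((m + 1 / 2) * (of_int j + \<alpha>)\<^sup>2 - m * (of_int r + real p + (m + k) / (2 * m))\<^sup>2)
               * theta_diff (-1) k m \<tau> z)
          - (-1) ^ p * bracket_sum {(j, r). 0 \<le> r \<and> r \<le> j} {(j, r). j < r \<and> r < 0}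
            (\<lambda>(j::int, r::int). \<Sum>k \<in> {k \<in> half_odd_ints. 0 < k \<and> k < m}.
               (-1) powi r
               * qpow \<tau> ((m + 1 / 2) * (of_int j + \<alpha>)\<^sup>2 - m * (of_int r + real p + (m - k) / (2 * m))\<^sup>2)
               * theta_diff (-1) k m \<tau> z)
          - theta 1 ((2 * real p + 1) * m) (m + 1 / 2) \<tau> 0
            * (\<Sum>r \<in> {- int p<..int p}. \<Sum>k \<in> {k \<in> half_odd_ints. 0 < k \<and> k < m}.
                 (-1) powi r * qpow \<tau> (- m * (of_int r + (k - m) / (2 * m))\<^sup>2)
                 * theta_diff (-1) k m \<tau> z)
          - theta 1 ((2 * real p + 1) * m) (m + 1 / 2) \<tau> 0
            * (\<Sum>r \<in> {- int p..int p}. (-1) powi r * qpow \<tau> (- m * (of_int r)\<^sup>2) * theta (-1) m m \<tau> z)"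
    (is "_ = ?Q + ?s * bracket_sum ?A1 ?B1 ?f1 - ?s * bracket_sum ?A2 ?B2 ?f2 - ?T * ?S3 - ?T * ?S4")
proof -
  let ?D = "theta_diff 1 (real p + 1 / 2) (m + 1 / 2) \<tau> z"
  let ?b = "bracket_sum {- (2 * int p + 1)<..<0} {0..- (2 * int p + 1)} :: (int \<Rightarrow> complex) \<Rightarrow> complex"
  let ?K = "{k \<in> half_odd_ints. 0 < k \<and> k < m}"
  let ?\<theta> = "theta (-1) 0 (1 / 2) \<tau> z"
  have mpos: "m > 0"
    using M by (simp add: m)
  interpret H: half_period \<tau> z 1 0 M m
    by unfold_locales (use tau M m in auto)
  interpret Q: theta_quotient \<tau> 1 M "2 * int p + 1" m "real p + 1 / 2"
    by unfold_locales (use tau M m in \<open>auto simp: power_int_minus_left\<close>)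
  have "H.phi_pole j \<noteq> 1" for j
    using theta_zero[OF tau, of 1 z j] nz unfolding H.phi_pole_def by auto
  then have lhs: "Phi_tilde (-1) m (1 / 2) \<tau> (z / 2 + \<tau> / 2) (z / 2 - \<tau> / 2) 0 = 0"
    using H.Phi_tilde_eq_0 unfolding H.z1_def H.z2_def by simp
  have Mm: "real_of_int M = m + 1 / 2"
    by (simp add: m)
  define d where "d k = theta_diff (-1) k m \<tau> z" for k
  define X where "X = (\<Sum>k\<in>{0..<M - 1}. Q.quot_coeff k * d (k + 1 / 2)) + Q.quot_coeff (M - 1) * (d m / 2)"
  have dm: "d m / 2 = theta (-1) m m \<tau> z"
    by (simp add: d_def Q.theta_m_m)
  have "Q.theta0 z * X = - (dedekind_eta \<tau> ^ 3) * ?D"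
    using Q.theta0_quotient[of z] unfolding X_def dm unfolding d_def theta_diff_def Mm
    by (simp add: power_int_add)
  moreover have "Q.theta0 z = - ?s * ?\<theta>"
    using Q.theta0_theta[of "int p + 1" 0 z] by (simp add: power_int_add)
  ultimately have "?s * (?\<theta> * X) = dedekind_eta \<tau> ^ 3 * ?D"
    by (simp add: algebra_simps)
  then have quot: "?Q = ?s * X"
    using nz by (simp add: field_simps)
  have T: "theta 1 (2 * m * (real p + 1 / 2)) M \<tau> 0 = ?T"
    unfolding Mm by (rule arg_cong[of _ _ "\<lambda>k. theta 1 k (m + 1 / 2) \<tau> 0"]) (simp add: algebra_simps)
  have \<alpha>': "2 * m * (real p + 1 / 2) / (2 * m + 1) = \<alpha>"
    unfolding \<alpha> by (simp add: algebra_simps)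
  have hterm: "Q.hecke_term K j r = (-1) powi r * qpow \<tau> ((m + 1 / 2) * (of_int j + \<alpha>)\<^sup>2 - m * (of_int r + real p + (m + - K) / (2 * m))\<^sup>2)" for K j r
  proof -
    have "of_int r + (real p + 1 / 2) + - K / (2 * m) = of_int r + real p + (m + - K) / (2 * m)"
      using mpos by (simp add: field_simps)
    note expo = this
    show ?thesis
      unfolding Q.hecke_term_def Q.exponent_strict \<alpha>' expo by simp
  qed
  have f1: "?f1 = (\<lambda>(j, r). \<Sum>k\<in>{k \<in> half_odd_ints. 0 < k \<and> k \<le> m}. Q.hecke_term (- k) j r * d k)"
    unfolding hterm d_def by (simp add: mult_ac)
  have f2: "?f2 = (\<lambda>(j, r). \<Sum>k\<in>?K. Q.hecke_term k j r * d k)"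
    unfolding hterm d_def by (simp add: mult_ac)
  \<comment> \<open>The index change r = a + p + 1 in the rows produces the factor -(-1)^p.\<close>
  have sign: "(-1) powi a = - ?s * (-1) powi (a + int p + 1)" for a
    by (simp add: power_int_add mult.left_commute)
  have row: "?b (Q.row_coeff k)
      = (\<Sum>r\<in>{- int p<..int p}. - ?s * ((-1) powi r * qpow \<tau> (- m * (of_int r + (k - m) / (2 * m))\<^sup>2)))" for k
  proof -
    have expo: "of_int a + (real p + 1 / 2) + k / (2 * m) = of_int (a + int p + 1) + (k - m) / (2 * m)" for a
      using mpos by (simp add: field_simps)
    have "Q.row_coeff k a = - ?s * ((-1) powi (a + int p + 1) * qpow \<tau> (- m * (of_int (a + int p + 1) + (k - m) / (2 * m))\<^sup>2))" for a
      unfolding Q.row_coeff_def sign[of a] expo by simp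
    then show ?thesis
      by (subst Q.bracket_row, simp)
        (rule sum.reindex_bij_witness[of _ "\<lambda>r. r - int p - 1" "\<lambda>a. a + int p + 1"], auto)
  qed
  have S3: "(\<Sum>k\<in>?K. ?b (Q.row_coeff k) * d k) = - ?s * ?S3"
    unfolding row sum_distrib_right sum_distrib_left by (subst sum.swap) (simp add: d_def mult_ac)
  have S4: "(Q.row_coeff m (-1) + ?b (Q.row_coeff m)) * (d m / 2) = - ?s * ?S4"
  proof -
    have "{- int p..int p} = insert (- int p) {- int p<..int p}"
      by auto
    then have "(\<Sum>r\<in>{- int p..int p}. (-1) powi r * qpow \<tau> (- m * (of_int r)\<^sup>2)) = (-1) powi (- int p) * qpow \<tau> (- m * (of_int (- int p))\<^sup>2) + (\<Sum>r\<in>{- int p<..int p}. (-1) powi r * qpow \<tau> (- m * (of_int r)\<^sup>2))"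
      by simp
    note split = this
    have last: "Q.row_coeff m (-1) = - ?s * ((-1) powi (- int p) * qpow \<tau> (- m * (of_int (- int p))\<^sup>2))"
      unfolding Q.row_coeff_def using mpos by (simp add: power_int_minus_left mult.assoc[symmetric])
    have rowm: "?b (Q.row_coeff m) = - ?s * (\<Sum>r\<in>{- int p<..int p}. (-1) powi r * qpow \<tau> (- m * (of_int r)\<^sup>2))"
      unfolding row sum_distrib_left by simp
    show ?thesis
      unfolding dm rowm last sum_distrib_right[symmetric] split by (simp only: algebra_simps)
  qed
  have X: "X = - bracket_sum ?A1 ?B1 ?f1 + bracket_sum ?A2 ?B2 ?f2 - ?T * (- ?s * ?S3) - ?T * (- ?s * ?S4)"
    unfolding X_def Q.quot_coeff_expansion S3[symmetric] S4[symmetric] f1 f2 T by (simp add: mult.assoc)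
  \<comment> \<open>Stated for arbitrary values, so that the cancellation of (-1)^p (-1)^p does not
    touch the long sums.\<close>
  have signs: "0 = ?s * x + ?s * b1 - ?s * b2 - t * s3 - t * s4"
    if "x = - b1 + b2 - t * (- ?s * s3) - t * (- ?s * s4)" for x b1 b2 t s3 s4 :: complex
  proof -
    have "?s * x + ?s * b1 - ?s * b2 = (?s * ?s) * (t * s3 + t * s4)"
      unfolding that by (simp only: algebra_simps) simp
    then show ?thesis
      by (simp flip: power_mult_distrib)
  qed
  show ?thesis
    unfolding lhs quot mult_zero_right by (rule signs[OF X])
qed

text \<open>Here P = p, \<epsilon> = -1 and w = z + 1; P + 1/2 is now half-odd, so
  \<open>theta0\<close> becomes (-1)^p i times the theta function of characteristic 1/2.\<close>

lemma quotient_identity_minus_int: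
  assumes nz: "theta 1 (1 / 2) (1 / 2) \<tau> z \<noteq> 0" and \<beta>: "\<beta> = 2 * m * real p / (2 * m + 1)"
  shows "theta (-1) (2 * real p * m) (m + 1 / 2) \<tau> 0
          * Phi (-1) m (1 / 2) \<tau> (z / 2 - 1 / 2) (z / 2 + 1 / 2) 0
        = - \<i> * dedekind_eta \<tau> ^ 3
            * (theta_diff (-1) (real p) (m + 1 / 2) \<tau> z / theta 1 (1 / 2) (1 / 2) \<tau> z)
          + bracket_sum {(j, r). 0 \<le> r \<and> r < j} {(j, r). j \<le> r \<and> r < 0}
            (\<lambda>(j::int, r::int). \<Sum>k \<in> {k \<in> half_odd_ints. 0 < k \<and> k \<le> m}.
               (-1) powi j * exp (of_real pi * \<i> * of_real k)
               * qpow \<tau> ((m + 1 / 2) * (of_int j + \<beta>)\<^sup>2 - m * (of_int r + real p + k / (2 * m))\<^sup>2)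
               * theta_diff (-1) k m \<tau> z)
          + bracket_sum {(j, r). 0 \<le> r \<and> r \<le> j} {(j, r). j < r \<and> r < 0}
            (\<lambda>(j::int, r::int). \<Sum>k \<in> {k \<in> half_odd_ints. 0 < k \<and> k < m}.
               (-1) powi j * exp (of_real pi * \<i> * of_real k)
               * qpow \<tau> ((m + 1 / 2) * (of_int j + \<beta>)\<^sup>2 - m * (of_int r + real p - k / (2 * m))\<^sup>2)
               * theta_diff (-1) k m \<tau> z)
          + theta (-1) (2 * real p * m) (m + 1 / 2) \<tau> 0
            * bracket_sum {- int p<..<int p} {int p..- int p}
                (\<lambda>r. \<Sum>k \<in> {k \<in> half_odd_ints. 0 < k \<and> k < m}.
                   exp (of_real pi * \<i> * of_real k) * qpow \<tau> (- ((2 * m * of_int r + k)\<^sup>2 / (4 * m)))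
                   * theta_diff (-1) k m \<tau> z)
          + 2 * exp (of_real pi * \<i> * of_real m) * theta (-1) (2 * real p * m) (m + 1 / 2) \<tau> 0
            * (\<Sum>r = 0..<int p. qpow \<tau> (- (m / 4) * (2 * of_int r + 1)\<^sup>2) * theta (-1) m m \<tau> z)"
    (is "_ = ?Q + bracket_sum ?A1 ?B1 ?f1 + bracket_sum ?A2 ?B2 ?f2 + ?T * ?S3 + 2 * ?e * ?T * ?S4")
proof -
  let ?D = "theta_diff (-1) (real p) (m + 1 / 2) \<tau> z"
  let ?b = "bracket_sum {- (2 * int p)<..<0} {0..- (2 * int p)} :: (int \<Rightarrow> complex) \<Rightarrow> complex"
  let ?b' = "bracket_sum {- int p<..<int p} {int p..- int p} :: (int \<Rightarrow> complex) \<Rightarrow> complex"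
  let ?K = "{k \<in> half_odd_ints. 0 < k \<and> k < m}"
  let ?\<theta> = "theta 1 (1 / 2) (1 / 2) \<tau> z"
  have mpos: "m > 0"
    using M by (simp add: m)
  interpret Q: theta_quotient \<tau> "-1" M "2 * int p" m "real p"
    by unfold_locales (use tau M m in auto)
  have Mm: "real_of_int M = m + 1 / 2"
    by (simp add: m)
  define d where "d k = exp (of_real pi * \<i> * of_real k) * theta_diff (-1) k m \<tau> z" for k
  define X where "X = (\<Sum>k\<in>{0..<M - 1}. Q.quot_coeff k * d (k + 1 / 2)) + Q.quot_coeff (M - 1) * (d m / 2)"
  have dm: "d m / 2 = ?e * theta (-1) m m \<tau> z"
    by (simp add: d_def Q.theta_m_m)
  have "Q.theta0 (z + 1) * X = - (dedekind_eta \<tau> ^ 3) * ((-1) ^ p * ?D)"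
  proof -
    have pair: "theta (- (-1)) (of_int k + 1 / 2) m \<tau> (z + 1) - (-1) * theta (- (-1)) (- (of_int k + 1 / 2)) m \<tau> (z + 1) = d (of_int k + 1 / 2)" for k
      unfolding Q.theta_m_add_one xpow_1_minus_half_odd d_def theta_diff_def xpow_1[symmetric] by (simp add: algebra_simps)
    have last: "theta (- (-1)) m m \<tau> (z + 1) = d m / 2"
      unfolding Q.theta_m_add_one xpow_1 dm ..
    have numerator: "theta (-1) (real p) M \<tau> (z + 1) + (-1) * (-1) powi (2 * int p) * theta (-1) (- real p) M \<tau> (z + 1)
      = (-1) ^ p * ?D"
      using xpow_1_of_int[of "int p"] xpow_1_of_int[of "- int p"]
      unfolding Q.theta_M_add_one unfolding Mm theta_diff_def by (simp add: power_int_minus_left algebra_simps)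
    show ?thesis
      using Q.theta0_quotient[of "z + 1"] unfolding X_def pair last numerator .
  qed
  moreover have "Q.theta0 (z + 1) = (-1) ^ p * (\<i> * ?\<theta>)"
    using Q.theta0_theta[of "int p" "1 / 2" "z + 1"] theta_add_one[of "1 / 2" 1 "-1" "1 / 2" \<tau> z]
    by (simp add: xpow_1_half)
  ultimately have "(-1) ^ p * (\<i> * (?\<theta> * X)) = (-1) ^ p * (- (dedekind_eta \<tau> ^ 3) * ?D)"
    by (simp add: algebra_simps)
  then have "\<i> * (?\<theta> * X) = - (dedekind_eta \<tau> ^ 3) * ?D"
    unfolding mult_cancel_left by simp
  then have "\<i> * (\<i> * (?\<theta> * X)) = \<i> * (- (dedekind_eta \<tau> ^ 3) * ?D)"
    by simp
  then have "?\<theta> * X = \<i> * dedekind_eta \<tau> ^ 3 * ?D"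
    by (simp add: mult.assoc[symmetric])
  then have quot: "?Q = - X"
    using nz by (simp add: field_simps)
  have T: "theta (-1) (2 * m * real p) M \<tau> 0 = ?T"
    unfolding Mm by (simp add: mult_ac)
  have hterm: "Q.hecke_term K j r = (-1) powi j * qpow \<tau> ((m + 1 / 2) * (of_int j + \<beta>)\<^sup>2 - m * (of_int r + real p + - K / (2 * m))\<^sup>2)" for K j r
    unfolding Q.hecke_term_def Q.exponent_strict \<beta> by simp
  have f1: "?f1 = (\<lambda>(j, r). \<Sum>k\<in>{k \<in> half_odd_ints. 0 < k \<and> k \<le> m}. Q.hecke_term (- k) j r * d k)"
    unfolding hterm d_def by (simp add: mult_ac)
  have f2: "?f2 = (\<lambda>(j, r). \<Sum>k\<in>?K. Q.hecke_term k j r * d k)"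
    unfolding hterm d_def by (simp add: mult_ac)
  have square: "m * (of_int r + k / (2 * m))\<^sup>2 = (2 * m * of_int r + k)\<^sup>2 / (4 * m)" for r :: int and k
    using mpos by (simp add: field_simps power2_eq_square)
  have row: "?b (Q.row_coeff k)
      = ?b' (\<lambda>r. qpow \<tau> (- ((2 * m * of_int r + k)\<^sup>2 / (4 * m))))" for k
  proof -
    have "Q.row_coeff k a = qpow \<tau> (- ((2 * m * of_int (a + int p) + k)\<^sup>2 / (4 * m)))" for a
      unfolding Q.row_coeff_def square[symmetric] by simp
    then show ?thesis
      unfolding bracket_sum_def
      by (intro arg_cong2[of _ _ _ _ "(-)"] infsum_reindex_bij_witness[of _ "\<lambda>r. r - int p" "\<lambda>a. a + int p"]) auto
  qed
  have S3: "?S3 = (\<Sum>k\<in>?K. ?b (Q.row_coeff k) * d k)"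
  proof -
    have "finite ?K"
    proof (rule finite_subset)
      show "?K \<subseteq> (\<lambda>k. of_int k + 1 / 2) ` {0..<M}"
      proof
        fix k assume k: "k \<in> ?K"
        then obtain n :: int where n: "k = of_int n + 1 / 2"
          using half_odd_ints_cases by blast
        then have "n \<in> {0..<M}"
          using k by (simp add: m)
        then show "k \<in> (\<lambda>k. of_int k + 1 / 2) ` {0..<M}"
          using n by blast
      qed
    qed simp
    then have "?b'
        (\<lambda>r. \<Sum>k\<in>?K. qpow \<tau> (- ((2 * m * of_int r + k)\<^sup>2 / (4 * m))) * d k)
      = (\<Sum>k\<in>?K. ?b' (\<lambda>r. qpow \<tau> (- ((2 * m * of_int r + k)\<^sup>2 / (4 * m)))) * d k)"
      by (rule bracket_sum_sum) auto
    then show ?thesis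
      unfolding row d_def by (simp add: mult_ac)
  qed
  have S4: "2 * ?e * ?S4 = (Q.row_coeff m (-1) + ?b (Q.row_coeff m)) * (d m / 2)"
  proof -
    let ?g = "\<lambda>r::int. qpow \<tau> (- (m / 4) * (2 * of_int r + 1)\<^sup>2)"
    have g: "qpow \<tau> (- ((2 * m * of_int r + m)\<^sup>2 / (4 * m))) = ?g r" for r :: int
      using mpos by (intro arg_cong[of _ _ "qpow \<tau>"]) (simp add: field_simps power2_eq_square)
    have gm: "Q.row_coeff m (-1) = ?g (int p - 1)"
      unfolding Q.row_coeff_def using mpos by (auto intro!: arg_cong[of _ _ "qpow \<tau>"] simp: field_simps power2_eq_square)
    \<comment> \<open>The symmetry r -> -1 - r folds the negative r onto 0..p - 2, and the
      additional row supplies the second copy of r = p - 1. For p = 0 the bracket is minus the term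
      r = 0, which cancels the equal term r = -1.\<close>
    have "?g (int p - 1) + ?b' ?g = 2 * sum ?g {0..<int p}"
    proof (cases "p = 0")
      case True
      then show ?thesis
        by (simp add: bracket_sum_def)
    next
      case False
      have "{- int p<..<int p} = {0..<int p} \<union> {- int p<..<0}"
        using False by auto
      moreover have "sum ?g ({0..<int p} \<union> {- int p<..<0}) = sum ?g {0..<int p} + sum ?g {- int p<..<0}"
        by (rule sum.union_disjoint) auto
      ultimately have "sum ?g {- int p<..<int p} = sum ?g {0..<int p} + sum ?g {- int p<..<0}"
        by argo
      also have "sum ?g {- int p<..<0} = sum ?g {0..<int p - 1}"
        by (rule sum.reindex_bij_witness[of _ "\<lambda>r. - 1 - r" "\<lambda>r. - 1 - r"])
          (auto intro!: arg_cong[of _ _ "qpow \<tau>"] simp: power2_eq_square algebra_simps)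
      finally have "sum ?g {- int p<..<int p} = sum ?g {0..<int p} + sum ?g {0..<int p - 1}" .
      moreover have "sum ?g {0..<int p} = ?g (int p - 1) + sum ?g {0..<int p - 1}"
      proof -
        have "{0..<int p} = insert (int p - 1) {0..<int p - 1}"
          using False by auto
        then show ?thesis
          by simp
      qed
      ultimately show ?thesis
        using False by (simp add: bracket_sum_def)
    qed
    then show ?thesis
      unfolding row dm gm g by (simp add: sum_distrib_left sum_distrib_right mult_ac)
  qed
  have "X = bracket_sum ?A1 ?B1 ?f1 + bracket_sum ?A2 ?B2 ?f2 + ?T * ?S3 + ?T * (2 * ?e * ?S4)"
    unfolding X_def Q.quot_coeff_expansion f1 f2 S3 S4 T by simp
  then show ?thesis
    unfolding Phi_eq_0 quot by (simp add: mult_ac)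
qed

end

text \<open>Each part assumes its theta denominator to be nonzero. In the first two this also
  excludes the poles of \<open>Phi\<close>, by \<open>theta_zero\<close>.\<close>

theorem theorem5p1:
  fixes m \<alpha> \<beta> :: real and p :: nat and \<tau> z :: complex
  assumes "Im \<tau> > 0"
    and "m \<in> half_odd_ints" and "m > 0"
    and "\<alpha> = m * (2 * real p + 1) / (2 * m + 1)"
    and "\<beta> = 2 * m * real p / (2 * m + 1)"
  shows
    "(theta 1 0 (1 / 2) \<tau> z \<noteq> 0 \<longrightarrow>
        qpow \<tau> (- m / 4) * theta (-1) ((2 * real p + 1) * m) (m + 1 / 2) \<tau> 0
          * Phi_tilde (-1) m (1 / 2) \<tau> (z / 2 + \<tau> / 2 - 1 / 2) (z / 2 - \<tau> / 2 + 1 / 2) 0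
        = - \<i> * dedekind_eta \<tau> ^ 3
            * (theta_diff (-1) (real p + 1 / 2) (m + 1 / 2) \<tau> z / theta 1 0 (1 / 2) \<tau> z)
          + bracket_sum {(j, r). 0 \<le> r \<and> r < j} {(j, r). j \<le> r \<and> r < 0}
            (\<lambda>(j::int, r::int). \<Sum>k \<in> {k \<in> half_odd_ints. 0 < k \<and> k \<le> m}.
               (-1) powi j * exp (of_real pi * \<i> * of_real k)
               * qpow \<tau> ((m + 1 / 2) * (of_int j + \<alpha>)\<^sup>2 - m * (of_int r + real p + (m + k) / (2 * m))\<^sup>2)
               * theta_diff (-1) k m \<tau> z)
          + bracket_sum {(j, r). 0 \<le> r \<and> r \<le> j} {(j, r). j < r \<and> r < 0}
            (\<lambda>(j::int, r::int). \<Sum>k \<in> {k \<in> half_odd_ints. 0 < k \<and> k < m}.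
               (-1) powi j * exp (of_real pi * \<i> * of_real k)
               * qpow \<tau> ((m + 1 / 2) * (of_int j + \<alpha>)\<^sup>2 - m * (of_int r + real p + (m - k) / (2 * m))\<^sup>2)
               * theta_diff (-1) k m \<tau> z)
          + theta (-1) ((2 * real p + 1) * m) (m + 1 / 2) \<tau> 0
            * (\<Sum>r \<in> {- int p<..int p}. \<Sum>k \<in> {k \<in> half_odd_ints. 0 < k \<and> k < m}.
                 exp (of_real pi * \<i> * of_real k) * qpow \<tau> (- m * (of_int r + (k - m) / (2 * m))\<^sup>2)
                 * theta_diff (-1) k m \<tau> z)
          + exp (of_real pi * \<i> * of_real m) * theta (-1) ((2 * real p + 1) * m) (m + 1 / 2) \<tau> 0
            * (\<Sum>r \<in> {- int p..int p}. qpow \<tau> (- m * (of_int r)\<^sup>2) * theta (-1) m m \<tau> z))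
     \<and>
     (theta (-1) 0 (1 / 2) \<tau> z \<noteq> 0 \<longrightarrow>
        qpow \<tau> (- m / 4) * theta 1 ((2 * real p + 1) * m) (m + 1 / 2) \<tau> 0
          * Phi_tilde (-1) m (1 / 2) \<tau> (z / 2 + \<tau> / 2) (z / 2 - \<tau> / 2) 0
        = dedekind_eta \<tau> ^ 3
            * (theta_diff 1 (real p + 1 / 2) (m + 1 / 2) \<tau> z / theta (-1) 0 (1 / 2) \<tau> z)
          + (-1) ^ p * bracket_sum {(j, r). 0 \<le> r \<and> r < j} {(j, r). j \<le> r \<and> r < 0}
            (\<lambda>(j::int, r::int). \<Sum>k \<in> {k \<in> half_odd_ints. 0 < k \<and> k \<le> m}.
               (-1) powi r
               * qpow \<tau> ((m + 1 / 2) * (of_int j + \<alpha>)\<^sup>2 - m * (of_int r + real p + (m + k) / (2 * m))\<^sup>2)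
               * theta_diff (-1) k m \<tau> z)
          - (-1) ^ p * bracket_sum {(j, r). 0 \<le> r \<and> r \<le> j} {(j, r). j < r \<and> r < 0}
            (\<lambda>(j::int, r::int). \<Sum>k \<in> {k \<in> half_odd_ints. 0 < k \<and> k < m}.
               (-1) powi r
               * qpow \<tau> ((m + 1 / 2) * (of_int j + \<alpha>)\<^sup>2 - m * (of_int r + real p + (m - k) / (2 * m))\<^sup>2)
               * theta_diff (-1) k m \<tau> z)
          - theta 1 ((2 * real p + 1) * m) (m + 1 / 2) \<tau> 0
            * (\<Sum>r \<in> {- int p<..int p}. \<Sum>k \<in> {k \<in> half_odd_ints. 0 < k \<and> k < m}.
                 (-1) powi r * qpow \<tau> (- m * (of_int r + (k - m) / (2 * m))\<^sup>2)
                 * theta_diff (-1) k m \<tau> z)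
          - theta 1 ((2 * real p + 1) * m) (m + 1 / 2) \<tau> 0
            * (\<Sum>r \<in> {- int p..int p}. (-1) powi r * qpow \<tau> (- m * (of_int r)\<^sup>2) * theta (-1) m m \<tau> z))
     \<and>
     (theta 1 (1 / 2) (1 / 2) \<tau> z \<noteq> 0 \<longrightarrow>
        theta (-1) (2 * real p * m) (m + 1 / 2) \<tau> 0
          * Phi (-1) m (1 / 2) \<tau> (z / 2 - 1 / 2) (z / 2 + 1 / 2) 0
        = - \<i> * dedekind_eta \<tau> ^ 3
            * (theta_diff (-1) (real p) (m + 1 / 2) \<tau> z / theta 1 (1 / 2) (1 / 2) \<tau> z)
          + bracket_sum {(j, r). 0 \<le> r \<and> r < j} {(j, r). j \<le> r \<and> r < 0}
            (\<lambda>(j::int, r::int). \<Sum>k \<in> {k \<in> half_odd_ints. 0 < k \<and> k \<le> m}.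
               (-1) powi j * exp (of_real pi * \<i> * of_real k)
               * qpow \<tau> ((m + 1 / 2) * (of_int j + \<beta>)\<^sup>2 - m * (of_int r + real p + k / (2 * m))\<^sup>2)
               * theta_diff (-1) k m \<tau> z)
          + bracket_sum {(j, r). 0 \<le> r \<and> r \<le> j} {(j, r). j < r \<and> r < 0}
            (\<lambda>(j::int, r::int). \<Sum>k \<in> {k \<in> half_odd_ints. 0 < k \<and> k < m}.
               (-1) powi j * exp (of_real pi * \<i> * of_real k)
               * qpow \<tau> ((m + 1 / 2) * (of_int j + \<beta>)\<^sup>2 - m * (of_int r + real p - k / (2 * m))\<^sup>2)
               * theta_diff (-1) k m \<tau> z)
          + theta (-1) (2 * real p * m) (m + 1 / 2) \<tau> 0
            * bracket_sum {- int p<..<int p} {int p..- int p}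
                (\<lambda>r. \<Sum>k \<in> {k \<in> half_odd_ints. 0 < k \<and> k < m}.
                   exp (of_real pi * \<i> * of_real k) * qpow \<tau> (- ((2 * m * of_int r + k)\<^sup>2 / (4 * m)))
                   * theta_diff (-1) k m \<tau> z)
          + 2 * exp (of_real pi * \<i> * of_real m) * theta (-1) (2 * real p * m) (m + 1 / 2) \<tau> 0
            * (\<Sum>r = 0..<int p. qpow \<tau> (- (m / 4) * (2 * of_int r + 1)\<^sup>2) * theta (-1) m m \<tau> z))"
proof -
  obtain n :: int where n: "m = of_int n + 1 / 2"
    using assms(2) half_odd_ints_cases by blast
  have "n + 1 \<ge> 1" "m = of_int (n + 1) - 1 / 2"
    using assms(3) n by simp_all
  note parts = quotient_identity_minus_half[OF assms(1) this _ assms(4)] quotient_identity_plus_half[OF assms(1) this _ assms(4)] quotient_identity_minus_int[OF assms(1) this _ assms(5)]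
  show ?thesis
    by (intro conjI impI parts)
qed

end
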